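(* Let $L$ be a vector space over a field $\mathbb{F}\supseteq\mathbb{C}(\mathsf q)$ of characteristic zero and let $\mathcal{S}$ be a quasi-commutative subset of $\mathcal{E}(L)_t$. There exists a unique smallest graded nonlocal $\mathsf q$-vertex algebra $V\subseteq\mathcal{E}(L)_t$ such that $\mathcal{S}\subseteq V$. Furthermore, if $\mathcal{S}$ consists of homogeneous elements, then $$V=\operatorname{span}\left\{a_1(z,t)_{r_1}\cdots a_k(z,t)_{r_k}\mathbf 1\,:\,a_j(z,t)\in\mathcal{S},\ r_j<0,\ j=1,\dots,k,\ k\in\mathbb{Z}_{\geq 0}\right\},$$ where the products are nested to the right, $a_1(z,t)_{r_1}\bigl(a_2(z,t)_{r_2}(\cdots(a_k(z,t)_{r_k}\mathbf 1))\bigr)$.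
   Context: Operators. $\mathsf q$ is an indeterminate, $\mathbb F\supseteq\mathbb C(\mathsf q)$ is a field of characteristic zero, $L$ an $\mathbb F$-vector space. $L((z_1,\dots,z_m))$ is the space of formal Laurent series in $z_1,\dots,z_m$ with coefficients in $L$ and exponents bounded below in each variable. $\mathcal E(L)=\operatorname{Hom}(L,L((z)))$ and $\mathcal E(L)_t=\mathcal E(L)\otimes\mathbb F[t]$. An element $a(z)\otimes t^{\alpha}$ is called homogeneous, of weight $\alpha$. Put $[r]_{\mathsf q}=(\mathsf q^r-1)/(\mathsf q-1)$, $[r]_{\mathsf q}!=[r]_{\mathsf q}\cdots[1]_{\mathsf q}$, $[0]_{\mathsf q}!=1$, and for integers $m$ and $l\ge 0$ let $\binom{m}{l}_{\mathsf q}=[m]_{\mathsf q}[m-1]_{\mathsf q}\cdots[m-l+1]_{\mathsf q}/[l]_{\mathsf q}!$. The $\mathsf q$-derivative is $a^{[1]}(z)=\frac{a(z\mathsf q)-a(z)}{z(\mathsf q-1)}$, and $a^{[r]}(z)$ is its $r$-th iterate. $\mathbb F[z]_0$ is the set of polynomials $p(z)\in\mathbb F[z]$ with $p(1)=1$ and $p(\mathsf q^n)\ne0$ for all integers $n\ge0$. For $A\in\operatorname{Hom}(L,L((z_1,\dots,z_m)))$ a limit $\lim_{z_j\to z}A$ means replacing all variables by $z$. Quasi-commutativity. A sequence $(a_1(z)\otimes t^{\alpha_1},\dots,a_m(z)\otimes t^{\alpha_m})$ of homogeneous elements is quasi-commutative if there is $p\in\mathbb F[z]_0$ with $$\Bigl(\prod_{1\le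 i<j\le m}p(z_j/z_i)\Bigr)a_1(z_1)a_2(z_2\mathsf q^{\alpha_1})a_3(z_3\mathsf q^{\alpha_1+\alpha_2})\cdots a_m(z_m\mathsf q^{\alpha_1+\cdots+\alpha_{m-1}})\in\operatorname{Hom}(L,L((z_1,\dots,z_m))).$$ A sequence of arbitrary elements, each written as the finite sum of its homogeneous components, is quasi-commutative if every sequence obtained by choosing one component from each entry is quasi-commutative. A subset of $\mathcal E(L)_t$ is quasi-commutative if every finite sequence in it is. Products. For a quasi-commutative pair of homogeneous elements and $r\ge0$, $$(a(z)\otimes t^\alpha)_{-r-1}(b(z)\otimes t^\beta)=\lim_{z_1\to z}\frac{p(z/z_1)}{[r]_{\mathsf q}!}a^{[r]}(z_1)b(z\mathsf q^{\alpha+r})\otimes t^{\alpha+\beta+r},$$ where $p\in\mathbb F[z]_0$ is any polynomial with $p(z/z_1)a^{[r]}(z_1)b(z\mathsf q^{\alpha+r})\in\operatorname{Hom}(L,L((z_1,z)))$ (the result does not depend on $p$); for $r<0$ the product is $0$. Extend bilinearly to arbitrary quasi-commutative pairs. Put $Y(a,z_0)b=\sum_{r\in\mathbb Z}(a_rb)z_0^{-r-1}$ and $\mathbf 1=1\otimes1$ (identity operator of $L$, viewed as a constant series, tensor $1$). Graded nonlocal $\mathsf q$-vertex algebra. This is a triple $(V,Y,\mathbf 1)$ where $V=\coprod_{u\in\mathbb Z}V_{(u)}$ is a $\mathbb Z$-graded $\mathbb F$-vector space, $Y(\cdot,z_0):V\to(\operatorname{End}V)[[z_0^{\pm1}]]$,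 $a\mapsto\sum_r a_rz_0^{-r-1}$, is linear and $\mathbf 1\in V$, such that for all $a,b,c\in V$, $s,u\in\mathbb Z$: $a_rb=0$ for $r$ sufficiently large; $Y(\mathbf 1,z_0)=1_V$; $Y(a,z_0)\mathbf 1\in V[[z_0]]$ and $\lim_{z_0\to0}Y(a,z_0)\mathbf 1=a$; $a_rV_{(s)}\subseteq V_{(s+u-r-1)}$ if $a\in V_{(u)}$; and $Y(a,z_0+z_2)Y(b,z_2\mathsf q^u)c=Y(Y(a,z_0)b,z_2)c$ if $a\in V_{(u)}$, where $z_2z_0=\mathsf qz_0z_2$. In the last axiom the left side is $\sum_{r,s}a_r(b_sc)(z_2\mathsf q^u)^{-s-1}(z_0+z_2)^{-r-1}$ with $(z_0+z_2)^m=\sum_{l\ge0}\binom ml_{\mathsf q}z_0^{m-l}z_2^l$, and the right side is $\sum_{r,s}(a_rb)_sc\,z_0^{-r-1}z_2^{-s-1}$; i.e. $(a_rb)_sc=\sum_{l\ge0}\binom{l-r-1}{l}_{\mathsf q}\mathsf q^{(s+l+1)(r-u+1)}a_{r-l}(b_{s+l}c)$ for all $r,s\in\mathbb Z$. A graded nonlocal $\mathsf q$-vertex algebra $V\subseteq\mathcal E(L)_t$ means a subspace $V$ all of whose pairs are quasi-commutative, with $\mathbf 1\in V$, closed under all products $a_rb$, and such that $(V,Y,\mathbf 1)$ is a graded nonlocal $\mathsf q$-vertex algebra, where $Y(a,z_0)b=\sum_{r\in\mathbb Z}(a_rb)z_0^{-r-1}$ is formed from the products $a_rb$ of quasi-commutative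 pairs in $\mathcal E(L)_t$, $\mathbf 1=1\otimes1$ (identity operator of $L$ tensor $1$), and $V_{(u)}=\{a(z)\otimes t^u\in V\}$. "Smallest" is with respect to inclusion. *)

theory Defs
  imports
    Complex_Main
    "HOL-Library.Function_Algebras"
    "HOL-Library.Groups_Big_Fun"
    "HOL-Library.Poly_Mapping"
    "HOL-Computational_Algebra.Computational_Algebra"
begin

unbundle fps_syntax

section \<open>Quantum integers\<close>

definition q_int :: "'f::field \<Rightarrow> int \<Rightarrow> 'f"
  where "q_int q r = (q powi r - 1) / (q - 1)"

definition q_fact :: "'f::field \<Rightarrow> nat \<Rightarrow> 'f"
  where "q_fact q r = (\<Prod>i=1..r. q_int q (int i))"

definition q_binom :: "'f::field \<Rightarrow> int \<Rightarrow> nat \<Rightarrow> 'f"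
  where "q_binom q m l = (\<Prod>i<l. q_int q (m - int i)) / q_fact q l"


section \<open>Graded nonlocal q-vertex algebras\<close>

text \<open>
  The underlying space \<open>V\<close> is a subspace of an ambient vector space, \<open>V\<^sub>(\<^sub>u\<^sub>)\<close> is \<open>gr u\<close>, and
  \<open>Y(a, z\<^sub>0)\<close> is given by its modes: \<open>prd a r b\<close> is \<open>a\<^sub>r b\<close>, the coefficient of \<open>z\<^sub>0\<^sup>-\<^sup>r\<^sup>-\<^sup>1\<close>
  in \<open>Y(a, z\<^sub>0) b\<close>.  Axiom \<open>associativity\<close> compares the coefficients of
  \<open>z\<^sub>0\<^sup>-\<^sup>r\<^sup>-\<^sup>1 z\<^sub>2\<^sup>-\<^sup>s\<^sup>-\<^sup>1\<close> in
  \<open>Y(a, z\<^sub>0 + z\<^sub>2) Y(b, z\<^sub>2 q\<^sup>u) c = Y(Y(a, z\<^sub>0) b, z\<^sub>2) c\<close>, where \<open>z\<^sub>2 z\<^sub>0 = q z\<^sub>0 z\<^sub>2\<close>.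
  By \<open>truncation\<close> its sum over \<open>l\<close> has finitely many nonzero terms, so \<open>Sum_any\<close> is
  that sum.
\<close>

locale graded_nonlocal_q_vertex_algebra = vector_space scale
  for scale :: "'f::field_char_0 \<Rightarrow> 'v::ab_group_add \<Rightarrow> 'v" (infixr \<open>*v\<close> 75) +
  fixes q :: 'f
    and V :: "'v set"
    and gr :: "int \<Rightarrow> 'v set"
    and prd :: "'v \<Rightarrow> int \<Rightarrow> 'v \<Rightarrow> 'v"
    and vac :: 'v
  assumes subspace_V: "subspace V"
    and subspace_gr: "subspace (gr u)"
    and gr_subset: "gr u \<subseteq> V"
    and direct_sum: "a \<in> V \<Longrightarrow>
      \<exists>!f :: int \<Rightarrow> 'v. finite {u. f u \<noteq> 0} \<and> (\<forall>u. f u \<in> gr u) \<and> a = (\<Sum>u | f u \<noteq> 0. f u)"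
    and prd_closed: "\<lbrakk>a \<in> V; b \<in> V\<rbrakk> \<Longrightarrow> prd a r b \<in> V"
    and prd_add_left: "\<lbrakk>a \<in> V; a' \<in> V; b \<in> V\<rbrakk> \<Longrightarrow> prd (a + a') r b = prd a r b + prd a' r b"
    and prd_scale_left: "\<lbrakk>a \<in> V; b \<in> V\<rbrakk> \<Longrightarrow> prd (x *v a) r b = x *v prd a r b"
    and prd_add_right: "\<lbrakk>a \<in> V; b \<in> V; b' \<in> V\<rbrakk> \<Longrightarrow> prd a r (b + b') = prd a r b + prd a r b'"
    and prd_scale_right: "\<lbrakk>a \<in> V; b \<in> V\<rbrakk> \<Longrightarrow> prd a r (x *v b) = x *v prd a r b"
    and vac_in: "vac \<in> V"
    and truncation: "\<lbrakk>a \<in> V; b \<in> V\<rbrakk> \<Longrightarrow> \<exists>N. \<forall>r\<ge>N. prd a r b = 0"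
    and vacuum: "b \<in> V \<Longrightarrow> prd vac r b = (if r = -1 then b else 0)"
    and creation_regular: "\<lbrakk>a \<in> V; r \<ge> 0\<rbrakk> \<Longrightarrow> prd a r vac = 0"
    and creation_limit: "a \<in> V \<Longrightarrow> prd a (-1) vac = a"
    and grading: "\<lbrakk>a \<in> gr u; b \<in> gr s\<rbrakk> \<Longrightarrow> prd a r b \<in> gr (s + u - r - 1)"
    and associativity: "\<lbrakk>a \<in> gr u; b \<in> V; c \<in> V\<rbrakk> \<Longrightarrow>
      prd (prd a r b) s c =
        Sum_any (\<lambda>l::nat. (q_binom q (int l - r - 1) l * q powi ((s + int l + 1) * (r - u + 1)))
                  *v prd a (r - int l) (prd b (s + int l) c))"


section \<open>The space of operators and its products\<close>

text \<open>
  The embedding of \<open>\<complex>(q)\<close> makes \<open>'f\<close> a field extension of it; \<open>scale\<close> makes \<open>'l\<close> the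
  vector space \<open>L\<close>.
\<close>

locale q_operators = vector_space scale
  for scale :: "'f::field_char_0 \<Rightarrow> 'l::ab_group_add \<Rightarrow> 'l" (infixr \<open>*s\<close> 75) +
  fixes embed :: "complex poly fract \<Rightarrow> 'f"
  assumes embed_one: "embed 1 = 1"
    and embed_add: "embed (x + y) = embed x + embed y"
    and embed_mult: "embed (x * y) = embed x * embed y"
begin

definition q :: 'f
  where "q = embed (to_fract [:0, 1:])"

subsection \<open>Laurent series in one variable\<close>

definition fls_scale :: "'f \<Rightarrow> 'l fls \<Rightarrow> 'l fls"
  where "fls_scale c f = Abs_fls (\<lambda>n. c *s (f $$ n))"

lemma fls_scale_nth [simp]: "fls_scale c f $$ n = c *s (f $$ n)"
  unfolding fls_scale_def
  by (rule nth_Abs_fls_ex_lower_bound) (metis fls_nth_vanishes_belowE scale_zero_right)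

sublocale fls: vector_space fls_scale
  by unfold_locales (auto intro!: fls_eqI simp: scale_right_distrib scale_left_distrib)

text \<open>\<open>fls_dilate k f\<close> is \<open>f(z q\<^sup>k)\<close>.\<close>

definition fls_dilate :: "nat \<Rightarrow> 'l fls \<Rightarrow> 'l fls"
  where "fls_dilate k f = Abs_fls (\<lambda>n. (q powi (int k * n)) *s (f $$ n))"

lemma fls_dilate_nth [simp]: "fls_dilate k f $$ n = (q powi (int k * n)) *s (f $$ n)"
  unfolding fls_dilate_def
  by (rule nth_Abs_fls_ex_lower_bound) (metis fls_nth_vanishes_belowE scale_zero_right)

definition E :: "('l \<Rightarrow> 'l fls) set"
  where "E = {a. Vector_Spaces.linear scale fls_scale a}"

definition dilate :: "nat \<Rightarrow> ('l \<Rightarrow> 'l fls) \<Rightarrow> 'l \<Rightarrow> 'l fls"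
  where "dilate k a = (\<lambda>v. fls_dilate k (a v))"

text \<open>\<open>fls_shift 1\<close> is division by \<open>z\<close>.\<close>

definition q_deriv :: "('l \<Rightarrow> 'l fls) \<Rightarrow> 'l \<Rightarrow> 'l fls"
  where "q_deriv a = (\<lambda>v. fls_scale (1 / (q - 1)) (fls_shift 1 (dilate 1 a v - a v)))"

subsection \<open>The tensor product with polynomials in \<open>t\<close>\<close>

text \<open>
  \<open>E(L) \<otimes> F[t]\<close> is realized as \<open>E(L)[t]\<close>, that is, as the polynomials with coefficients in
  \<open>E\<close>; \<open>a(z) \<otimes> t\<^sup>\<alpha>\<close> is \<open>monom a \<alpha>\<close>.  The additive structure of \<open>'l \<Rightarrow> 'l fls\<close> is the
  pointwise one.
\<close>

definition Et :: "('l \<Rightarrow> 'l fls) poly set"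
  where "Et = {x. \<forall>\<alpha>. coeff x \<alpha> \<in> E}"

definition Et_scale :: "'f \<Rightarrow> ('l \<Rightarrow> 'l fls) poly \<Rightarrow> ('l \<Rightarrow> 'l fls) poly"
  where "Et_scale c = map_poly (\<lambda>a v. fls_scale c (a v))"

lemma coeff_Et_scale [simp]: "coeff (Et_scale c x) \<alpha> = (\<lambda>v. fls_scale c (coeff x \<alpha> v))"
  unfolding Et_scale_def by (rule coeff_map_poly) (simp add: zero_fun_def)

sublocale Et: vector_space Et_scale
  by unfold_locales
    (auto intro!: poly_eqI simp: fun_eq_iff fls.scale_right_distrib fls.scale_left_distrib)

definition homogeneous :: "('l \<Rightarrow> 'l fls) poly \<Rightarrow> bool"
  where "homogeneous x \<longleftrightarrow> (\<exists>a\<in>E. \<exists>\<alpha>. x = monom a \<alpha>)"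

definition Et_one :: "('l \<Rightarrow> 'l fls) poly"
  where "Et_one = monom fls_const 0"

subsection \<open>Series in several variables\<close>

text \<open>
  The variables are \<open>z\<^sub>0, \<dots>, z\<^sub>m\<^sub>-\<^sub>1\<close> (numbered from 0).  A monomial is its exponent vector
  \<open>e :: nat \<Rightarrow>\<^sub>0 int\<close>, a formal series with coefficients in \<open>L\<close> is a function from exponent
  vectors to \<open>'l\<close>, and a Laurent polynomial over the field is an element of
  \<open>(nat \<Rightarrow>\<^sub>0 int) \<Rightarrow>\<^sub>0 'f\<close>.
\<close>

definition laurent :: "nat \<Rightarrow> ((nat \<Rightarrow>\<^sub>0 int) \<Rightarrow> 'l) set"
  where "laurent m = {f. (\<forall>e. f e \<noteq> 0 \<longrightarrow> Poly_Mapping.keys e \<subseteq> {..<m}) \<and>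
    (\<exists>N. \<forall>e. f e \<noteq> 0 \<longrightarrow> (\<forall>i<m. N \<le> Poly_Mapping.lookup e i))}"

definition Hom :: "nat \<Rightarrow> ('l \<Rightarrow> (nat \<Rightarrow>\<^sub>0 int) \<Rightarrow> 'l) set"
  where "Hom m = {A. (\<forall>e. Vector_Spaces.linear scale scale (\<lambda>v. A v e)) \<and> (\<forall>v. A v \<in> laurent m)}"

text \<open>
  \<open>compose_ops [a\<^sub>0, \<dots>, a\<^sub>m\<^sub>-\<^sub>1]\<close> is \<open>a\<^sub>0(z\<^sub>0) \<cdots> a\<^sub>m\<^sub>-\<^sub>1(z\<^sub>m\<^sub>-\<^sub>1)\<close>, a formal series with
  exponents unrestricted in both directions.
\<close>

definition compose_ops :: "('l \<Rightarrow> 'l fls) list \<Rightarrow> 'l \<Rightarrow> (nat \<Rightarrow>\<^sub>0 int) \<Rightarrow> 'l"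
  where "compose_ops as v e =
    (if Poly_Mapping.keys e \<subseteq> {..<length as}
     then foldr (\<lambda>j w. (as ! j) w $$ Poly_Mapping.lookup e j) [0..<length as] v
     else 0)"

text \<open>\<open>poly_ratio p j i\<close> is \<open>p(z\<^sub>j / z\<^sub>i)\<close>.\<close>

definition poly_ratio :: "'f poly \<Rightarrow> nat \<Rightarrow> nat \<Rightarrow> ((nat \<Rightarrow>\<^sub>0 int) \<Rightarrow>\<^sub>0 'f)"
  where "poly_ratio p j i = (\<Sum>k\<le>degree p.
    Poly_Mapping.single (Poly_Mapping.single j (int k) - Poly_Mapping.single i (int k)) (coeff p k))"

definition laurent_poly_mult ::
    "((nat \<Rightarrow>\<^sub>0 int) \<Rightarrow>\<^sub>0 'f) \<Rightarrow> ((nat \<Rightarrow>\<^sub>0 int) \<Rightarrow> 'l) \<Rightarrow> (nat \<Rightarrow>\<^sub>0 int) \<Rightarrow> 'l"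
  where "laurent_poly_mult P f e =
    (\<Sum>d\<in>Poly_Mapping.keys P. Poly_Mapping.lookup P d *s f (e - d))"

text \<open>
  Replacing all variables by the single variable \<open>z\<close>.  The sums are finite for \<open>A \<in> Hom m\<close>, \<open>m > 0\<close>.
\<close>

definition lim_diag :: "('l \<Rightarrow> (nat \<Rightarrow>\<^sub>0 int) \<Rightarrow> 'l) \<Rightarrow> 'l \<Rightarrow> 'l fls"
  where "lim_diag A v = Abs_fls (\<lambda>n.
    \<Sum>e | A v e \<noteq> 0 \<and> (\<Sum>i\<in>Poly_Mapping.keys e. Poly_Mapping.lookup e i) = n. A v e)"

subsection \<open>Quasi-commutativity\<close>

definition F0 :: "'f poly set"
  where "F0 = {p. poly p 1 = 1 \<and> (\<forall>n::nat. poly p (q ^ n) \<noteq> 0)}"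

text \<open>The pair \<open>(a, \<alpha>)\<close> stands for \<open>a(z) \<otimes> t\<^sup>\<alpha>\<close>.\<close>

definition quasi_commutative_hom :: "(('l \<Rightarrow> 'l fls) \<times> nat) list \<Rightarrow> bool"
  where "quasi_commutative_hom xs \<longleftrightarrow> (\<exists>p\<in>F0.
    (\<lambda>v. laurent_poly_mult
        (\<Prod>(i, j)\<in>{(i, j). i < j \<and> j < length xs}. poly_ratio p j i)
        (compose_ops (map (\<lambda>j. dilate (\<Sum>i<j. snd (xs ! i)) (fst (xs ! j))) [0..<length xs]) v))
      \<in> Hom (length xs))"

text \<open>
  The list \<open>\<alpha>s\<close> chooses the component of weight \<open>\<alpha>s ! j\<close> of \<open>xs ! j\<close>.  Choices involving a
  vanishing component impose no condition, since the operator product is then 0.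
\<close>

definition quasi_commutative :: "('l \<Rightarrow> 'l fls) poly list \<Rightarrow> bool"
  where "quasi_commutative xs \<longleftrightarrow> (\<forall>\<alpha>s. length \<alpha>s = length xs \<longrightarrow>
    quasi_commutative_hom (map (\<lambda>(x, \<alpha>). (coeff x \<alpha>, \<alpha>)) (zip xs \<alpha>s)))"

definition quasi_commutative_set :: "('l \<Rightarrow> 'l fls) poly set \<Rightarrow> bool"
  where "quasi_commutative_set S \<longleftrightarrow> (\<forall>xs. set xs \<subseteq> S \<longrightarrow> quasi_commutative xs)"

subsection \<open>Products\<close>

text \<open>
  \<open>hom_prod r a \<alpha> b \<beta>\<close> is \<open>(a(z) \<otimes> t\<^sup>\<alpha>)\<^sub>-\<^sub>r\<^sub>-\<^sub>1 (b(z) \<otimes> t\<^sup>\<beta>)\<close>.  It does not depend on the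
  admissible polynomial picked by \<open>SOME\<close>; it is meaningful only if there is one, as is the case for
  quasi-commutative pairs.
\<close>

definition hom_prod_series :: "'f poly \<Rightarrow> nat \<Rightarrow> ('l \<Rightarrow> 'l fls) \<Rightarrow> nat \<Rightarrow> ('l \<Rightarrow> 'l fls) \<Rightarrow>
    'l \<Rightarrow> (nat \<Rightarrow>\<^sub>0 int) \<Rightarrow> 'l"
  where "hom_prod_series p r a \<alpha> b =
    (\<lambda>v. laurent_poly_mult (poly_ratio p 1 0) (compose_ops [(q_deriv ^^ r) a, dilate (\<alpha> + r) b] v))"

definition hom_prod :: "nat \<Rightarrow> ('l \<Rightarrow> 'l fls) \<Rightarrow> nat \<Rightarrow> ('l \<Rightarrow> 'l fls) \<Rightarrow> nat \<Rightarrow> ('l \<Rightarrow> 'l fls) poly"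
  where "hom_prod r a \<alpha> b \<beta> =
    (let p = (SOME p. p \<in> F0 \<and> hom_prod_series p r a \<alpha> b \<in> Hom 2)
     in monom (\<lambda>v. fls_scale (1 / q_fact q r) (lim_diag (hom_prod_series p r a \<alpha> b) v)) (\<alpha> + \<beta> + r))"

text \<open>\<open>Et_prod x r y\<close> is \<open>x\<^sub>r y\<close>.\<close>

definition Et_prod :: "('l \<Rightarrow> 'l fls) poly \<Rightarrow> int \<Rightarrow> ('l \<Rightarrow> 'l fls) poly \<Rightarrow> ('l \<Rightarrow> 'l fls) poly"
  where "Et_prod x r y =
    (if r < 0
     then (\<Sum>\<alpha>\<le>degree x. \<Sum>\<beta>\<le>degree y. hom_prod (nat (- r - 1)) (coeff x \<alpha>) \<alpha> (coeff y \<beta>) \<beta>)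
     else 0)"

subsection \<open>Graded nonlocal q-vertex algebras of operators\<close>

definition weight_space :: "('l \<Rightarrow> 'l fls) poly set \<Rightarrow> int \<Rightarrow> ('l \<Rightarrow> 'l fls) poly set"
  where "weight_space V u = (if u < 0 then {0} else {x\<in>V. \<exists>a\<in>E. x = monom a (nat u)})"

definition q_vertex_algebra_in_Et :: "('l \<Rightarrow> 'l fls) poly set \<Rightarrow> bool"
  where "q_vertex_algebra_in_Et V \<longleftrightarrow>
    V \<subseteq> Et \<and> Et.subspace V \<and>
    (\<forall>x\<in>V. \<forall>y\<in>V. quasi_commutative [x, y]) \<and>
    Et_one \<in> V \<and>
    (\<forall>x\<in>V. \<forall>y\<in>V. \<forall>r. Et_prod x r y \<in> V) \<and>
    graded_nonlocal_q_vertex_algebra Et_scale q V (weight_space V) Et_prod Et_one"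

definition smallest_q_vertex_algebra ::
    "('l \<Rightarrow> 'l fls) poly set \<Rightarrow> ('l \<Rightarrow> 'l fls) poly set \<Rightarrow> bool"
  where "smallest_q_vertex_algebra S V \<longleftrightarrow>
    q_vertex_algebra_in_Et V \<and> S \<subseteq> V \<and>
    (\<forall>W. q_vertex_algebra_in_Et W \<and> S \<subseteq> W \<longrightarrow> V \<subseteq> W)"

text \<open>\<open>nested_prod [(a\<^sub>1, r\<^sub>1), \<dots>, (a\<^sub>k, r\<^sub>k)]\<close> is \<open>(a\<^sub>1)\<^sub>r\<^sub>1 (\<cdots> ((a\<^sub>k)\<^sub>r\<^sub>k 1))\<close>.\<close>

definition nested_prod :: "(('l \<Rightarrow> 'l fls) poly \<times> int) list \<Rightarrow> ('l \<Rightarrow> 'l fls) poly"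
  where "nested_prod ars = foldr (\<lambda>(a, r) x. Et_prod a r x) ars Et_one"

end

end

theory Submission
  imports Defs
begin

text \<open>
  Multiplication by a product \<open>P\<close> of factors \<open>p(z\<^sub>j / z\<^sub>i)\<close> turns
  \<open>a\<^sub>1(z\<^sub>1) \<cdots> a\<^sub>m(z\<^sub>m)\<close> into an honest Laurent series, and since \<open>p(1) = 1\<close> such factors survive
  the identification of variables as factors of the same kind.  Identifying
  \<open>z\<^sub>k\<close> and \<open>z\<^sub>k\<^sub>+\<^sub>1\<close> therefore replaces \<open>a\<^sub>k\<close> and \<open>a\<^sub>k\<^sub>+\<^sub>1\<close> by their product in a quasi-commutative
  sequence; the condition \<open>p(q\<^sup>n) \<noteq> 0\<close> allows one to dilate the variables by increasing powers
  of \<open>q\<close>, and hence to take q-derivatives first.  The product of operators obtained in this way is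
  associative, which together with the q-Leibniz rule is the associativity axiom.

  By Zorn's lemma the homogeneous components of the elements of \<open>S\<close> lie in a maximal
  quasi-commutative family.  By maximality it is closed under linear combinations and products, so it
  consists of the homogeneous elements of a q-vertex algebra.  All axioms pass to subspaces closed under
  products and homogeneous components, so the intersection of all q-vertex algebras
  containing \<open>S\<close> is one.  The span of the nested products is closed under products
  because associativity rewrites \<open>(a\<^sub>r b)\<^sub>s c\<close> in terms of \<open>a\<^sub>r\<^sub>' (b\<^sub>s\<^sub>' c)\<close>.
\<close>

section \<open>Exponent vectors\<close>

text \<open>The algebra asks for quasi-commuting pairs only, but testing a product against a third
  operator involves a triple, and iterated products involve ever longer sequences. Hence all
  arguments run over sequences of arbitrary length. Adjoining products one by one would require
  control over all sequences that mix old and new members; maximality reduces this to a single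
  replacement inside one sequence. The weights are absorbed into the operators by dilation, which
  leaves a weightless notion \<open>compat\<close> and a weightless product \<open>pmul\<close>. An
  r-th q-derivative of a(z) involves a(z q^i) for 0 <= i <= r, so everything to its right is dilated
  by q^r to keep the exponents of q increasing. This explains the dilation by \<alpha> + r in the
  product and its weight \<alpha> + \<beta> + r. The powers of q in the associativity axiom come
  from moving q-derivatives past dilations. The product of two neighbours has a denominator of its
  own, and is formed inside a series that is not yet Laurent in the other variables. Identification
  of variables is therefore treated for all series with finite fibres.\<close>

lemma sum_monomials: "P = (\<Sum>d\<in>Poly_Mapping.keys P. Poly_Mapping.single d (Poly_Mapping.lookup P d))"
  by (rule poly_mapping_eqI) (auto simp: lookup_sum lookup_single when_def in_keys_iff)

text \<open>The exponent vector of a monomial after substituting z_(g j) for z_j. The map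
  \<open>g\<close> need not be injective: exponents of variables that become equal are
  added.\<close>

definition push :: "(nat \<Rightarrow> nat) \<Rightarrow> (nat \<Rightarrow>\<^sub>0 int) \<Rightarrow> (nat \<Rightarrow>\<^sub>0 int)"
  where "push g e = (\<Sum>j\<in>Poly_Mapping.keys e. Poly_Mapping.single (g j) (Poly_Mapping.lookup e j))"

lemma push_superset:
  assumes "finite A" "Poly_Mapping.keys e \<subseteq> A"
  shows "push g e = (\<Sum>j\<in>A. Poly_Mapping.single (g j) (Poly_Mapping.lookup e j))"
  unfolding push_def by (rule sum.mono_neutral_left) (use assms in \<open>auto simp: in_keys_iff\<close>)

lemma push_add: "push g (d + e) = push g d + push g e"
proof -
  let ?A = "Poly_Mapping.keys d \<union> Poly_Mapping.keys e"
  have "push g (d + e) = (\<Sum>j\<in>?A. Poly_Mapping.single (g j) (Poly_Mapping.lookup (d + e) j))"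
    by (rule push_superset) (simp_all add: Poly_Mapping.keys_add)
  also have "\<dots> = push g d + push g e"
    by (simp add: lookup_add single_add sum.distrib push_superset[of ?A])
  finally show ?thesis .
qed

lemma push_diff: "push g (d - e) = push g d - push g e"
  using push_add[of g "d - e" e] by (simp add: algebra_simps)

lemma push_single [simp]: "push g (Poly_Mapping.single j n) = Poly_Mapping.single (g j) n"
  by (simp add: push_def)

lemma push_push: "push h (push g e) = push (h \<circ> g) e"
proof -
  have *: "finite A \<Longrightarrow> push h (\<Sum>j\<in>A. F j) = (\<Sum>j\<in>A. push h (F j))" for A and F :: "nat \<Rightarrow> _"
    by (induction A rule: finite_induct) (auto simp: push_add, simp add: push_def)
  show ?thesis
    by (subst push_def[of g]) (simp add: * push_def[of "h \<circ> g"])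
qed

lemma lookup_push:
  assumes "Poly_Mapping.keys e \<subseteq> {..<m}"
  shows "Poly_Mapping.lookup (push g e) i = (\<Sum>j | j < m \<and> g j = i. Poly_Mapping.lookup e j)"
proof -
  have "Poly_Mapping.lookup (push g e) i
      = (\<Sum>j<m. if g j = i then Poly_Mapping.lookup e j else 0)"
    using assms by (simp add: push_superset[of "{..<m}"] lookup_sum lookup_single when_def)
  also have "\<dots> = (\<Sum>j | j < m \<and> g j = i. Poly_Mapping.lookup e j)"
    by (subst sum.inter_filter[symmetric]) simp_all
  finally show ?thesis .
qed

lemma keys_push: "Poly_Mapping.keys (push g e) \<subseteq> g ` Poly_Mapping.keys e"
proof -
  have "Poly_Mapping.lookup (push g e) i \<noteq> 0 \<Longrightarrow> i \<in> g ` Poly_Mapping.keys e" for i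
    by (auto simp: push_def lookup_sum lookup_single when_def elim!: sum.not_neutral_contains_not_neutral
        split: if_splits)
  then show ?thesis by (auto simp: in_keys_iff)
qed

lemma keys_subset_diff:
  assumes "Poly_Mapping.keys (d :: nat \<Rightarrow>\<^sub>0 int) \<subseteq> X"
  shows "Poly_Mapping.keys (e - d) \<subseteq> X \<longleftrightarrow> Poly_Mapping.keys e \<subseteq> X"
proof -
  have "i \<notin> X \<Longrightarrow> Poly_Mapping.lookup (e - d) i = Poly_Mapping.lookup e i" for i
    using assms by (auto simp: lookup_minus in_keys_iff subset_iff)
  then show ?thesis
    by (auto simp: in_keys_iff subset_iff) (metis)+
qed

text \<open>The exponent vector of \<open>z\<^sub>j / z\<^sub>i\<close>, raised to the \<open>k\<close>-th power.\<close>

definition rexp :: "nat \<Rightarrow> nat \<Rightarrow> int \<Rightarrow> (nat \<Rightarrow>\<^sub>0 int)"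
  where "rexp j i k = Poly_Mapping.single j k - Poly_Mapping.single i k"

lemma rexp_add: "rexp j i (k + l) = rexp j i k + rexp j i l"
  by (simp add: rexp_def single_add algebra_simps)

lemma rexp_0 [simp]: "rexp j i 0 = 0"
  by (simp add: rexp_def)

lemma rexp_refl [simp]: "rexp i i k = 0"
  by (simp add: rexp_def)

lemma push_rexp [simp]: "push g (rexp j i k) = rexp (g j) (g i) k"
  by (simp add: rexp_def push_diff)

lemma keys_rexp: "Poly_Mapping.keys (rexp j i k) \<subseteq> {i, j}"
  by (auto simp: rexp_def in_keys_iff lookup_minus lookup_single when_def split: if_splits)

definition mk_exp :: "nat \<Rightarrow> (nat \<Rightarrow> int) \<Rightarrow> (nat \<Rightarrow>\<^sub>0 int)"
  where "mk_exp m \<eta> = (\<Sum>j<m. Poly_Mapping.single j (\<eta> j))"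

lemma lookup_mk_exp [simp]: "Poly_Mapping.lookup (mk_exp m \<eta>) i = (if i < m then \<eta> i else 0)"
  by (simp add: mk_exp_def lookup_sum lookup_single when_def)

lemma keys_mk_exp: "Poly_Mapping.keys (mk_exp m \<eta>) \<subseteq> {..<m}"
  by (auto simp: in_keys_iff split: if_splits)

text \<open>The total degree is the push-forward along a constant map, which makes the diagonal
  limit an instance of the general identification of variables.\<close>

lemma sum_lookup_push_const:
  "push (\<lambda>_. 0) e = Poly_Mapping.single 0 (\<Sum>i\<in>Poly_Mapping.keys e. Poly_Mapping.lookup e i)"
  by (rule poly_mapping_eqI) (auto simp: push_def lookup_sum lookup_single when_def)

text \<open>Every substitution preserves the total degree. A fixed total together with a lower bound
  on each exponent also bounds each exponent from above.\<close>

lemma finite_bounded_exponents: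
  "finite {e :: nat \<Rightarrow>\<^sub>0 int. Poly_Mapping.keys e \<subseteq> {..<m} \<and> (\<forall>i<m. N \<le> Poly_Mapping.lookup e i)
     \<and> push g e = e'}" (is "finite ?S")
proof -
  obtain T where T: "push (\<lambda>_. 0) e' = Poly_Mapping.single 0 T"
    using sum_lookup_push_const by blast
  \<comment> \<open>What is left of the total T for one exponent when the other m - 1 exponents are
    at least N.\<close>
  define M where "M = T - (int m - 1) * N"
  have tot: "(\<Sum>j<m. Poly_Mapping.lookup e j) = T" if "e \<in> ?S" for e
  proof -
    have "push (\<lambda>_. 0) e = Poly_Mapping.single 0 T"
      using that T push_push[of "\<lambda>_. 0" g e] by (auto simp: o_def)
    moreover have "Poly_Mapping.lookup (push (\<lambda>_. 0) e) 0 = (\<Sum>j<m. Poly_Mapping.lookup e j)"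
      using lookup_push[of e m "\<lambda>_. 0" 0] that by (auto simp: lessThan_def)
    ultimately show ?thesis by simp
  qed
  have le: "Poly_Mapping.lookup e i \<le> M" if "e \<in> ?S" "i < m" for e i
  proof -
    have "T = Poly_Mapping.lookup e i + (\<Sum>j\<in>{..<m} - {i}. Poly_Mapping.lookup e j)"
      using tot[OF that(1)] that(2) by (simp add: sum.remove)
    moreover have "(\<Sum>j\<in>{..<m} - {i}. Poly_Mapping.lookup e j) \<ge> (\<Sum>j\<in>{..<m} - {i}. N)"
      by (rule sum_mono) (use that in auto)
    ultimately show ?thesis using that by (simp add: M_def of_nat_diff)
  qed
  have "?S \<subseteq> (\<lambda>xs. mk_exp m (\<lambda>i. xs ! i)) ` {xs. set xs \<subseteq> {N..M} \<and> length xs = m}"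
  proof
    fix e assume e: "e \<in> ?S"
    have "e = mk_exp m (\<lambda>i. map (Poly_Mapping.lookup e) [0..<m] ! i)"
      using e by (intro poly_mapping_eqI) (auto simp: in_keys_iff)
    moreover have "set (map (Poly_Mapping.lookup e) [0..<m]) \<subseteq> {N..M}"
      using e le[OF e] by auto
    ultimately show "e \<in> (\<lambda>xs. mk_exp m (\<lambda>i. xs ! i)) ` {xs. set xs \<subseteq> {N..M} \<and> length xs = m}"
      by (intro image_eqI) auto
  qed
  then show ?thesis
    by (rule finite_subset) (intro finite_imageI finite_lists_length_eq finite_atLeastAtMost_int)
qed

text \<open>Identifies the variables z_k and z_(k+1) and closes the gap in the numbering.\<close>

definition contr :: "nat \<Rightarrow> nat \<Rightarrow> nat"
  where "contr k j = (if j \<le> k then j else j - 1)"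

lemma lookup_push_contr:
  assumes "Poly_Mapping.keys e \<subseteq> {..<m}" "Suc k < m"
  shows "Poly_Mapping.lookup (push (contr k) e) i =
    (if i < k then Poly_Mapping.lookup e i
     else if i = k then Poly_Mapping.lookup e k + Poly_Mapping.lookup e (Suc k)
     else Poly_Mapping.lookup e (Suc i))"
proof -
  have "{j. j < m \<and> contr k j = i} =
      (if i < k then {i} else if i = k then {k, Suc k} else if Suc i < m then {Suc i} else {})"
    using assms(2) by (auto simp: contr_def split: if_splits)
  moreover have "\<not> Suc i < m \<Longrightarrow> Poly_Mapping.lookup e (Suc i) = 0"
    using assms(1) by (auto simp: in_keys_iff)
  ultimately show ?thesis
    by (subst lookup_push[OF assms(1)]) auto
qed

lemma push_cong: "(\<And>j. j \<in> Poly_Mapping.keys e \<Longrightarrow> g j = h j) \<Longrightarrow> push g e = push h e"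
  by (simp add: push_def)

lemma push_id: "push (\<lambda>j. j) e = e"
  by (simp add: push_def sum_monomials[symmetric])

lemma sum_fun_apply: "(\<Sum>i\<in>X. (f i :: 'a \<Rightarrow> 'b::comm_monoid_add)) v = (\<Sum>i\<in>X. f i v)"
  by (induction X rule: infinite_finite_induct) auto

context q_operators
begin

section \<open>Laurent series and identification of variables\<close>

abbreviation "act \<equiv> laurent_poly_mult"

lemma act_superset:
  assumes "finite A" "Poly_Mapping.keys P \<subseteq> A"
  shows "act P f e = (\<Sum>d\<in>A. Poly_Mapping.lookup P d *s f (e - d))"
  unfolding laurent_poly_mult_def
  by (rule sum.mono_neutral_left) (use assms in \<open>auto simp: in_keys_iff\<close>)

lemma act_zero_left [simp]: "act 0 f = (\<lambda>e. 0)"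
  by (rule ext) (simp add: laurent_poly_mult_def)

lemma act_zero_right [simp]: "act P (\<lambda>e. 0) = (\<lambda>e. 0)"
  by (rule ext) (simp add: laurent_poly_mult_def)

lemma act_add_left: "act (P + Q) f e = act P f e + act Q f e"
proof -
  let ?A = "Poly_Mapping.keys P \<union> Poly_Mapping.keys Q"
  have "act (P + Q) f e = (\<Sum>d\<in>?A. Poly_Mapping.lookup (P + Q) d *s f (e - d))"
    by (rule act_superset) (simp_all add: Poly_Mapping.keys_add)
  then show ?thesis
    by (simp add: lookup_add scale_left_distrib sum.distrib act_superset[of ?A])
qed

lemma act_sum_left: "act (\<Sum>x\<in>X. P x) f e = (\<Sum>x\<in>X. act (P x) f e)"
  by (induction X rule: infinite_finite_induct) (auto simp: act_add_left)

lemma act_single [simp]: "act (Poly_Mapping.single d c) f e = c *s f (e - d)"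
  by (simp add: laurent_poly_mult_def)

lemma act_one [simp]: "act 1 f = f"
  by (rule ext) (simp flip: single_one)

lemma act_add_right: "act P (\<lambda>e. f e + g e) e = act P f e + act P g e"
  by (simp add: laurent_poly_mult_def scale_right_distrib sum.distrib)

lemma act_scale_right: "act P (\<lambda>e. c *s f e) e = c *s act P f e"
  by (simp add: laurent_poly_mult_def scale_sum_right mult.commute)

lemma act_shift: "act P (\<lambda>e. f (e - d)) e = act P f (e - d)"
  by (simp add: laurent_poly_mult_def algebra_simps)

lemma act_mult: "act (P * Q) f = act P (act Q f)"
proof
  fix e
  have P: "P = (\<Sum>d\<in>Poly_Mapping.keys P. Poly_Mapping.single d (Poly_Mapping.lookup P d))"
    by (rule sum_monomials)
  have *: "act (Poly_Mapping.single d c * Q) f e = c *s act Q f (e - d)" for d c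
  proof -
    have Q: "Q = (\<Sum>d\<in>Poly_Mapping.keys Q. Poly_Mapping.single d (Poly_Mapping.lookup Q d))"
      by (rule sum_monomials)
    have "act (Poly_Mapping.single d c * Q) f e =
        act (\<Sum>k\<in>Poly_Mapping.keys Q. Poly_Mapping.single (d + k) (c * Poly_Mapping.lookup Q k)) f e"
      by (subst Q) (simp add: sum_distrib_left mult_single)
    also have "\<dots> = c *s act Q f (e - d)"
      by (simp add: act_sum_left laurent_poly_mult_def[of Q] scale_sum_right algebra_simps)
    finally show ?thesis .
  qed
  have "act (P * Q) f e = (\<Sum>d\<in>Poly_Mapping.keys P. Poly_Mapping.lookup P d *s act Q f (e - d))"
    by (subst P) (simp add: sum_distrib_right act_sum_left *)
  then show "act (P * Q) f e = act P (act Q f) e"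
    by (simp add: laurent_poly_mult_def[of P])
qed

lemma act_commute: "act P (act Q f) = act Q (act P f)"
  by (metis act_mult mult.commute)

lemma poly_ratio_superset:
  assumes "degree p \<le> N"
  shows "poly_ratio p j i = (\<Sum>k\<le>N. Poly_Mapping.single (rexp j i (int k)) (coeff p k))"
  unfolding poly_ratio_def rexp_def
  by (rule sum.mono_neutral_left) (use assms in \<open>auto simp: coeff_eq_0\<close>)

lemma poly_ratio_add: "poly_ratio (p + r) j i = poly_ratio p j i + poly_ratio r j i"
  by (simp add: poly_ratio_superset[of _ "max (degree p) (degree r)"] degree_add_le single_add
      sum.distrib)

lemma poly_ratio_smult: "poly_ratio (smult c p) j i = Poly_Mapping.single 0 c * poly_ratio p j i"
  by (simp add: poly_ratio_superset[of _ "degree p"] mult_single sum_distrib_left)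

lemma poly_ratio_0 [simp]: "poly_ratio 0 j i = 0"
  by (simp add: poly_ratio_def)

lemma poly_ratio_1 [simp]: "poly_ratio 1 j i = 1"
  by (simp add: poly_ratio_def single_zero)

text \<open>The recursion p = c + X p', from which an induction on \<open>p\<close> shows that p |->
  p(z_j / z_i) is multiplicative.\<close>

lemma poly_ratio_pCons:
  "poly_ratio (pCons c p) j i
    = Poly_Mapping.single 0 c + Poly_Mapping.single (rexp j i 1) 1 * poly_ratio p j i"
proof -
  have "poly_ratio (pCons c p) j i
      = (\<Sum>k\<le>Suc (degree p). Poly_Mapping.single (rexp j i (int k)) (coeff (pCons c p) k))"
    by (rule poly_ratio_superset) (simp add: degree_pCons_le)
  also have "\<dots> = Poly_Mapping.single 0 c
      + (\<Sum>k\<le>degree p. Poly_Mapping.single (rexp j i 1 + rexp j i (int k)) (coeff p k))"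
    by (subst sum.atMost_Suc_shift) (simp add: rexp_add[symmetric])
  finally show ?thesis
    by (simp add: poly_ratio_superset[of p "degree p"] mult_single sum_distrib_left)
qed

lemma poly_ratio_mult: "poly_ratio (p * r) j i = poly_ratio p j i * poly_ratio r j i"
  by (induction p)
    (simp_all add: poly_ratio_add poly_ratio_smult poly_ratio_pCons algebra_simps)

lemma act_poly_ratio:
  assumes "degree p \<le> N"
  shows "act (poly_ratio p j i) f e = (\<Sum>k\<le>N. coeff p k *s f (e - rexp j i (int k)))"
  by (simp add: poly_ratio_superset[OF assms] act_sum_left)

text \<open>For j = i the ratio is 1. This is what happens to a denominator when its two variables
  are identified: it becomes the scalar p(1), which is 1 for members of \<open>F0\<close>.\<close>

lemma act_poly_ratio_refl: "act (poly_ratio p i i) f e = poly p 1 *s f e"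
  by (simp add: act_poly_ratio[of p "degree p"] poly_altdef scale_sum_left)

section \<open>Substitution of variables in formal series\<close>

text \<open>The sums in \<open>Lim\<close> are then finite; a \<open>sum\<close> over an infinite
  set would be 0 and \<open>Lim\<close> would fail to be additive. The condition is weaker than
  being a Laurent series and is met by series that are still unbounded in the other
  variables.\<close>

definition fin_fibres :: "(nat \<Rightarrow> nat) \<Rightarrow> ((nat \<Rightarrow>\<^sub>0 int) \<Rightarrow> 'l) \<Rightarrow> bool"
  where "fin_fibres g f \<longleftrightarrow> (\<forall>e'. finite {e. f e \<noteq> 0 \<and> push g e = e'})"

text \<open>Substituting the variable \<open>z\<^sub>g\<^sub>(\<^sub>j\<^sub>)\<close> for \<open>z\<^sub>j\<close>.\<close>

definition Lim :: "(nat \<Rightarrow> nat) \<Rightarrow> ((nat \<Rightarrow>\<^sub>0 int) \<Rightarrow> 'l) \<Rightarrow> (nat \<Rightarrow>\<^sub>0 int) \<Rightarrow> 'l"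
  where "Lim g f e' = (\<Sum>e | f e \<noteq> 0 \<and> push g e = e'. f e)"

lemma Lim_superset:
  assumes "finite A" "\<And>e. e \<in> A \<Longrightarrow> push g e = e'" "\<And>e. f e \<noteq> 0 \<Longrightarrow> push g e = e' \<Longrightarrow> e \<in> A"
  shows "Lim g f e' = sum f A"
  unfolding Lim_def by (rule sum.mono_neutral_left) (use assms in auto)

lemma Lim_zero [simp]: "Lim g (\<lambda>e. 0) = (\<lambda>e. 0)"
  by (rule ext) (simp add: Lim_def)

lemma fin_fibres_zero [simp]: "fin_fibres g (\<lambda>e. 0)"
  by (simp add: fin_fibres_def)

lemma fin_fibres_add:
  assumes "fin_fibres g f" "fin_fibres g h"
  shows "fin_fibres g (\<lambda>e. f e + h e)"
  unfolding fin_fibres_def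
proof
  fix e'
  have "{e. f e + h e \<noteq> 0 \<and> push g e = e'}
      \<subseteq> {e. f e \<noteq> 0 \<and> push g e = e'} \<union> {e. h e \<noteq> 0 \<and> push g e = e'}" by auto
  then show "finite {e. f e + h e \<noteq> 0 \<and> push g e = e'}"
    by (rule finite_subset) (use assms in \<open>auto simp: fin_fibres_def\<close>)
qed

lemma Lim_add:
  assumes "fin_fibres g f" "fin_fibres g h"
  shows "Lim g (\<lambda>e. f e + h e) e' = Lim g f e' + Lim g h e'"
proof -
  let ?A = "{e. f e \<noteq> 0 \<and> push g e = e'} \<union> {e. h e \<noteq> 0 \<and> push g e = e'}"
  have A: "finite ?A" using assms by (auto simp: fin_fibres_def)
  have "Lim g f e' = sum f ?A" "Lim g h e' = sum h ?A" 
    "Lim g (\<lambda>e. f e + h e) e' = sum (\<lambda>e. f e + h e) ?A"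
    by (rule Lim_superset; use A in auto)+
  then show ?thesis by (simp add: sum.distrib)
qed

lemma fin_fibres_scale: "fin_fibres g f \<Longrightarrow> fin_fibres g (\<lambda>e. c *s f e)"
  unfolding fin_fibres_def by (auto elim!: allE finite_subset[rotated])

lemma Lim_scale: "Lim g (\<lambda>e. c *s f e) e' = c *s Lim g f e'"
  by (cases "c = 0") (simp_all add: Lim_def scale_sum_right)

lemma fibre_shift:
  "{e. f (e - d) \<noteq> 0 \<and> push g e = e'} = (\<lambda>e. e + d) ` {e. f e \<noteq> 0 \<and> push g e = e' - push g d}"
  by (auto simp: push_add push_diff image_iff algebra_simps intro!: exI[of _ "_ - d"])

lemma fin_fibres_shift: "fin_fibres g f \<Longrightarrow> fin_fibres g (\<lambda>e. f (e - d))"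
  unfolding fin_fibres_def by (simp add: fibre_shift)

lemma Lim_shift: "Lim g (\<lambda>e. f (e - d)) e' = Lim g f (e' - push g d)"
  unfolding Lim_def fibre_shift by (subst sum.reindex) (auto simp: inj_on_def)

lemma fin_fibres_sum:
  "(\<And>x. x \<in> X \<Longrightarrow> fin_fibres g (f x)) \<Longrightarrow> fin_fibres g (\<lambda>e. \<Sum>x\<in>X. f x e)"
  by (induction X rule: infinite_finite_induct) (auto intro: fin_fibres_add)

lemma Lim_sum:
  "(\<And>x. x \<in> X \<Longrightarrow> fin_fibres g (f x)) \<Longrightarrow> Lim g (\<lambda>e. \<Sum>x\<in>X. f x e) e' = (\<Sum>x\<in>X. Lim g (f x) e')"
  by (induction X rule: infinite_finite_induct) (auto simp: Lim_add fin_fibres_sum)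

lemma act_poly_ratio_fun: 
  "act (poly_ratio p j i) f = (\<lambda>e. \<Sum>k\<le>degree p. coeff p k *s f (e - rexp j i (int k)))"
  by (simp add: fun_eq_iff act_poly_ratio)

lemma fin_fibres_act: "fin_fibres g f \<Longrightarrow> fin_fibres g (act (poly_ratio p j i) f)"
  unfolding act_poly_ratio_fun by (intro fin_fibres_sum fin_fibres_scale fin_fibres_shift)

lemma Lim_act:
  "fin_fibres g f \<Longrightarrow> Lim g (act (poly_ratio p j i) f) = act (poly_ratio p (g j) (g i)) (Lim g f)"
  unfolding act_poly_ratio_fun
  by (simp add: fun_eq_iff Lim_sum fin_fibres_scale fin_fibres_shift Lim_scale Lim_shift)

text \<open>Each fibre of the composite substitution is the disjoint union of fibres of
  \<open>push g\<close>, so the sum over it can be taken in two stages.\<close>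

lemma Lim_Lim:
  assumes f: "fin_fibres h f"  "fin_fibres g f" and hg: "\<And>e. push h' (push g e) = push h e"
  shows "Lim h' (Lim g f) e' = Lim h f e'"
proof -
  let ?A = "{e. f e \<noteq> 0 \<and> push h e = e'}"
  have A: "finite ?A" using f by (simp add: fin_fibres_def)
  have "Lim h' (Lim g f) e' = sum (Lim g f) (push g ` ?A)"
  proof (rule Lim_superset)
    fix e assume "Lim g f e \<noteq> 0" "push h' e = e'"
    then obtain d where "f d \<noteq> 0" "push g d = e"
      by (auto simp: Lim_def elim: sum.not_neutral_contains_not_neutral)
    then show "e \<in> push g ` ?A" using hg \<open>push h' e = e'\<close> by force
  qed (use A hg in auto)
  also have "\<dots> = (\<Sum>y\<in>push g ` ?A. sum f {x \<in> ?A. push g x = y})"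
  proof (rule sum.cong[OF refl])
    fix y assume "y \<in> push g ` ?A"
    then have "{e. f e \<noteq> 0 \<and> push g e = y} = {x \<in> ?A. push g x = y}"
      by (auto simp: hg[symmetric])
    then show "Lim g f y = sum f {x \<in> ?A. push g x = y}"
      by (simp add: Lim_def)
  qed
  also have "\<dots> = Lim h f e'"
    unfolding Lim_def by (rule sum.image_gen[OF A, symmetric])
  finally show ?thesis .
qed

section \<open>Series with exponents bounded below\<close>

lemma laurent_zero [simp]: "(\<lambda>e. 0) \<in> laurent m"
  by (simp add: laurent_def)

lemma laurent_add:
  assumes "f \<in> laurent m" "h \<in> laurent m"
  shows "(\<lambda>e. f e + h e) \<in> laurent m"
proof -
  obtain M N where
    "\<And>e i. f e \<noteq> 0 \<Longrightarrow> i < m \<Longrightarrow> M \<le> Poly_Mapping.lookup e i"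
    "\<And>e i. h e \<noteq> 0 \<Longrightarrow> i < m \<Longrightarrow> N \<le> Poly_Mapping.lookup e i"
    using assms unfolding laurent_def by blast
  then have "min M N \<le> Poly_Mapping.lookup e i" if "f e + h e \<noteq> 0" "i < m" for e i
    using that by (cases "f e = 0") (auto simp: min_le_iff_disj)
  moreover have "Poly_Mapping.keys e \<subseteq> {..<m}" if "f e + h e \<noteq> 0" for e
  proof -
    have "f e \<noteq> 0 \<or> h e \<noteq> 0" using that by auto
    then show ?thesis using assms unfolding laurent_def by blast
  qed
  ultimately show ?thesis unfolding laurent_def by blast
qed

lemma laurent_scale: "f \<in> laurent m \<Longrightarrow> (\<lambda>e. c *s f e) \<in> laurent m"
  unfolding laurent_def by simp blast

lemma laurent_sum: "(\<And>x. x \<in> X \<Longrightarrow> f x \<in> laurent m) \<Longrightarrow> (\<lambda>e. \<Sum>x\<in>X. f x e) \<in> laurent m"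
  by (induction X rule: infinite_finite_induct) (auto intro: laurent_add)

lemma laurent_shift:
  assumes "f \<in> laurent m" and d: "Poly_Mapping.keys d \<subseteq> {..<m}"
  shows "(\<lambda>e. f (e - d)) \<in> laurent m"
proof -
  obtain N where N: "\<And>e i. f e \<noteq> 0 \<Longrightarrow> i < m \<Longrightarrow> N \<le> Poly_Mapping.lookup e i"
    using assms unfolding laurent_def by blast
  obtain M where M: "\<And>i. i < m \<Longrightarrow> M \<le> Poly_Mapping.lookup d i"
  proof
    show "i < m \<Longrightarrow> Min (insert 0 (Poly_Mapping.lookup d ` {..<m})) \<le> Poly_Mapping.lookup d i" for i
      by (rule Min_le) auto
  qed
  have "f (e - d) \<noteq> 0 \<Longrightarrow> i < m \<Longrightarrow> M + N \<le> Poly_Mapping.lookup e i" for e i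
    using N[of "e - d" i] M[of i] by (simp add: lookup_minus)
  moreover have "f (e - d) \<noteq> 0 \<Longrightarrow> Poly_Mapping.keys e \<subseteq> {..<m}" for e
    using assms keys_subset_diff[OF d] unfolding laurent_def by blast
  ultimately show ?thesis unfolding laurent_def by blast
qed

lemma laurent_act:
  assumes "f \<in> laurent m" "i < m" "j < m"
  shows "act (poly_ratio p j i) f \<in> laurent m"
  unfolding act_poly_ratio_fun using assms keys_rexp[of j i]
  by (intro laurent_sum laurent_scale laurent_shift) auto

lemma laurent_fin_fibres:
  assumes "f \<in> laurent m"
  shows "fin_fibres g f"
  unfolding fin_fibres_def
proof
  fix e'
  obtain N where "\<And>e. f e \<noteq> 0 \<Longrightarrow> Poly_Mapping.keys e \<subseteq> {..<m} \<and> (\<forall>i<m. N \<le> Poly_Mapping.lookup e i)"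
    using assms unfolding laurent_def by blast
  then have "{e. f e \<noteq> 0 \<and> push g e = e'} \<subseteq> {e. Poly_Mapping.keys e \<subseteq> {..<m} \<and>
      (\<forall>i<m. N \<le> Poly_Mapping.lookup e i) \<and> push g e = e'}" by auto
  then show "finite {e. f e \<noteq> 0 \<and> push g e = e'}"
    using finite_bounded_exponents finite_subset by blast
qed

lemma laurent_Lim:
  assumes "f \<in> laurent m" and g: "\<And>i. i < m \<Longrightarrow> g i < m'"
  shows "Lim g f \<in> laurent m'"
proof -
  obtain N where N: "\<And>e i. f e \<noteq> 0 \<Longrightarrow> i < m \<Longrightarrow> N \<le> Poly_Mapping.lookup e i"
    using assms unfolding laurent_def by blast
  \<comment> \<open>A nonpositive bound: the sum over any subset of the m indices is then at least m
    * M, whatever the size of the fibre of \<open>g\<close>.\<close>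
  define M where "M = min N 0"
  have "Poly_Mapping.keys e' \<subseteq> {..<m'} \<and> (\<forall>i<m'. int m * M \<le> Poly_Mapping.lookup e' i)"
    if "Lim g f e' \<noteq> 0" for e'
  proof -
    obtain e where e: "f e \<noteq> 0" "push g e = e'"
      using \<open>Lim g f e' \<noteq> 0\<close> by (auto simp: Lim_def elim: sum.not_neutral_contains_not_neutral)
    have k: "Poly_Mapping.keys e \<subseteq> {..<m}" using assms e unfolding laurent_def by blast
    have "int m * M \<le> Poly_Mapping.lookup e' i" for i
    proof -
      have "int m * M = (\<Sum>j<m. M)" by simp
      also have "\<dots> \<le> (\<Sum>j | j < m \<and> g j = i. M)"
        by (rule sum_mono2[of "{..<m}", where f="\<lambda>_. -M", simplified sum_negf neg_le_iff_le])
           (auto simp: M_def)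
      also have "\<dots> \<le> (\<Sum>j | j < m \<and> g j = i. Poly_Mapping.lookup e j)"
        by (rule sum_mono) (use N e in \<open>auto simp: M_def min.coboundedI1\<close>)
      finally show ?thesis using lookup_push[OF k, of g i] e by simp
    qed
    moreover have "Poly_Mapping.keys e' \<subseteq> {..<m'}"
      using keys_push[of g e] k g e by (auto dest!: subsetD)
    ultimately show ?thesis by blast
  qed
  then show ?thesis unfolding laurent_def by blast
qed

lemma lim_diag_nth:
  assumes "A v \<in> laurent m"
  shows "lim_diag A v $$ n = Lim (\<lambda>_. 0) (A v) (Poly_Mapping.single 0 n)"
proof -
  have eq: "(\<Sum>e | A v e \<noteq> 0 \<and> (\<Sum>i\<in>Poly_Mapping.keys e. Poly_Mapping.lookup e i) = n. A v e)
      = Lim (\<lambda>_. 0) (A v) (Poly_Mapping.single 0 n)" for n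
    unfolding Lim_def sum_lookup_push_const by (rule sum.cong) (auto simp: inj_eq)
  obtain N where N: "\<And>e i. Lim (\<lambda>_. 0) (A v) e \<noteq> 0 \<Longrightarrow> N \<le> Poly_Mapping.lookup e 0"
    using laurent_Lim[OF assms, of "\<lambda>_. 0" 1] unfolding laurent_def by auto
  have "n < N \<Longrightarrow> Lim (\<lambda>_. 0) (A v) (Poly_Mapping.single 0 n) = 0" for n
    using N[of "Poly_Mapping.single 0 n"] by fastforce
  then show ?thesis
    unfolding lim_diag_def eq by (intro nth_Abs_fls_lower_bound[of N]) auto
qed

section \<open>Denominators and compatible sequences of operators\<close>

lemma embed_zero: "embed 0 = 0"
  using embed_add[of 0 0] by simp

lemma embed_power: "embed (x ^ n) = embed x ^ n"
  by (induction n) (auto simp: embed_one embed_mult)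

lemma embed_eq_iff: "embed x = embed y \<longleftrightarrow> x = y"
proof
  assume *: "embed x = embed y"
  have "embed (x - y) = 0" using embed_add[of "x - y" y] * by simp
  moreover have "embed (x - y) \<noteq> 0" if "x \<noteq> y"
    using embed_mult[of "x - y" "inverse (x - y)"] that embed_one by auto
  ultimately show "x = y" by blast
qed simp

lemma q_nonzero [simp]: "q \<noteq> 0"
proof -
  have "to_fract [:0, 1::complex:] \<noteq> 0" by simp
  then show ?thesis using embed_eq_iff[of _ 0] embed_zero unfolding q_def by simp
qed

lemma to_fract_pow: "to_fract (x ^ n) = to_fract x ^ n"
  by (induction n) auto

text \<open>A field embedding is injective, and X^n has positive degree, so q is not a root of
  unity.\<close>

lemma q_pow_ne_1:
  assumes "n > 0"
  shows "q ^ n \<noteq> 1"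
proof
  assume "q ^ n = 1"
  then have "embed (to_fract ([:0, 1:] ^ n)) = embed 1"
    by (simp add: q_def embed_power embed_one to_fract_pow)
  then have "to_fract ([:0, 1::complex:] ^ n) = to_fract 1"
    by (simp add: embed_eq_iff)
  then have "([:0, 1::complex:] ^ n) = 1" by (simp only: to_fract_eq_iff)
  then have "degree ([:0, 1::complex:] ^ n) = 0" by simp
  then show False using assms by (simp add: degree_power_eq)
qed

lemma q_ne_1 [simp]: "q \<noteq> 1"
  using q_pow_ne_1[of 1] by simp

lemma q_powi_eq_1_iff [simp]: "q powi n = 1 \<longleftrightarrow> n = 0"
proof
  assume *: "q powi n = 1"
  show "n = 0"
  proof (rule ccontr)
    assume n: "n \<noteq> 0"
    then have "q ^ nat \<bar>n\<bar> = 1"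
      using * by (cases "n \<ge> 0") (auto simp: power_int_def power_inverse)
    then show False using q_pow_ne_1[of "nat \<bar>n\<bar>"] n by simp
  qed
qed simp

lemma q_int_eq_0_iff [simp]: "q_int q n = 0 \<longleftrightarrow> n = 0"
  by (simp add: q_int_def)

lemma q_fact_nonzero [simp]: "q_fact q n \<noteq> 0"
  by (simp add: q_fact_def)

lemma q_fact_Suc: "q_fact q (Suc n) = q_int q (int (Suc n)) * q_fact q n"
  by (simp add: q_fact_def mult.commute)

section \<open>Denominators\<close>

lemma F0_one: "1 \<in> F0"
  by (simp add: F0_def)

lemma F0_mult: "p \<in> F0 \<Longrightarrow> r \<in> F0 \<Longrightarrow> p * r \<in> F0"
  by (simp add: F0_def)

lemma F0_poly_1: "p \<in> F0 \<Longrightarrow> poly p 1 = 1"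
  by (simp add: F0_def)

text \<open>The polynomial p(q^d X), rescaled to take the value 1 at 1. It stays in
  \<open>F0\<close> because q^d q^n is again a power of q with nonnegative exponent.\<close>

definition qdil :: "nat \<Rightarrow> 'f poly \<Rightarrow> 'f poly"
  where "qdil d p = smult (1 / poly p (q ^ d)) (pcompose p [:0, q ^ d:])"

lemma qdil_F0: "p \<in> F0 \<Longrightarrow> qdil d p \<in> F0"
  by (simp add: F0_def qdil_def poly_pcompose flip: power_add)

text \<open>Products of factors \<open>p(z\<^sub>j / z\<^sub>i)\<close> with \<open>i < j\<close> in which \<open>p\<close> may vary.  Unlike those with a
  single \<open>p\<close>, they are preserved when variables are identified.\<close>

inductive_set dens :: "nat \<Rightarrow> ((nat \<Rightarrow>\<^sub>0 int) \<Rightarrow>\<^sub>0 'f) set" for m where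
  dens_one: "1 \<in> dens m"
| dens_ratio: "p \<in> F0 \<Longrightarrow> i < j \<Longrightarrow> j < m \<Longrightarrow> P \<in> dens m \<Longrightarrow> poly_ratio p j i * P \<in> dens m"

lemma dens_mult: "P \<in> dens m \<Longrightarrow> Q \<in> dens m \<Longrightarrow> P * Q \<in> dens m"
  by (induction rule: dens.induct) (auto simp: mult.assoc intro: dens_ratio)

lemma laurent_dens: "P \<in> dens m \<Longrightarrow> f \<in> laurent m \<Longrightarrow> act P f \<in> laurent m"
  by (induction rule: dens.induct) (auto simp: act_mult intro!: laurent_act)

definition std_den :: "nat \<Rightarrow> 'f poly \<Rightarrow> ((nat \<Rightarrow>\<^sub>0 int) \<Rightarrow>\<^sub>0 'f)"
  where "std_den m p = (\<Prod>(i, j)\<in>{(i, j). i < j \<and> j < m}. poly_ratio p j i)"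

lemma finite_pairs [simp]: "finite {(i, j). i < j \<and> j < (m::nat)}"
  by (rule finite_subset[of _ "{..<m} \<times> {..<m}"]) auto

lemma dens_prod:
  assumes "p \<in> F0" "X \<subseteq> {(i, j). i < j \<and> j < m}"
  shows "(\<Prod>(i, j)\<in>X. poly_ratio p j i) \<in> dens m"
proof -
  have "finite X" using finite_subset[OF assms(2)] by simp
  then show ?thesis using assms(2)
    by (induction X rule: finite_induct) (auto intro: dens.intros assms(1))
qed

lemma std_den_dens: "p \<in> F0 \<Longrightarrow> std_den m p \<in> dens m"
  unfolding std_den_def by (rule dens_prod) auto

lemma std_den_mult: "std_den m (p * r) = std_den m p * std_den m r"
  unfolding std_den_def prod.distrib[symmetric]
  by (rule prod.cong) (auto simp: poly_ratio_mult)

text \<open>Take the product of all polynomials that occur in \<open>P\<close> as the single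
  polynomial and supply the missing factors. This links the flexible denominators to the ones in the
  definition of quasi-commutativity.\<close>

lemma dens_dvd_std: "P \<in> dens m \<Longrightarrow> \<exists>p\<in>F0. \<exists>Q\<in>dens m. Q * P = std_den m p"
proof (induction rule: dens.induct)
  case dens_one
  have "1 * 1 = std_den m 1" by (simp add: std_den_def split_beta)
  then show ?case using F0_one dens.dens_one by metis
next
  case (dens_ratio p i j P)
  then obtain r Q where r: "r \<in> F0" "Q \<in> dens m" "Q * P = std_den m r" by blast
  let ?X = "{(i, j). i < j \<and> j < m} - {(i, j)}"
  have *: "std_den m p = poly_ratio p j i * (\<Prod>(i, j)\<in>?X. poly_ratio p j i)"
    unfolding std_den_def using dens_ratio.hyps by (subst prod.remove[of _ "(i, j)"]) auto
  have "((\<Prod>(i, j)\<in>?X. poly_ratio p j i) * Q) * (poly_ratio p j i * P) = std_den m (p * r)"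
    unfolding std_den_mult * r(3)[symmetric] by (simp add: mult_ac)
  moreover have "(\<Prod>(i, j)\<in>?X. poly_ratio p j i) * Q \<in> dens m"
    using dens_ratio.hyps r by (intro dens_mult dens_prod) auto
  ultimately show ?case using F0_mult dens_ratio.hyps r by blast
qed

lemma std_den_2: "std_den 2 p = poly_ratio p 1 0"
proof -
  have "{(i, j). i < j \<and> j < (2::nat)} = {(0, 1)}" by auto
  then show ?thesis by (simp add: std_den_def)
qed

text \<open>A monotone renumbering sends i < j either to an ordered pair, where the factor keeps its
  shape, or to equal indices, where it becomes p(1) = 1. The new denominator is chosen before
  \<open>f\<close>, so one denominator serves the series for all vectors v.\<close>

lemma Lim_dens:
  assumes "P \<in> dens m" and g: "\<And>i j. i < j \<Longrightarrow> j < m \<Longrightarrow> g i \<le> g j \<and> g j < m'"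
  shows "\<exists>P'\<in>dens m'. \<forall>f. fin_fibres g f \<longrightarrow>
    fin_fibres g (act P f) \<and> Lim g (act P f) = act P' (Lim g f)"
  using assms(1)
proof (induction rule: dens.induct)
  case dens_one
  then show ?case by (auto intro!: bexI[of _ 1] dens.dens_one)
next
  case (dens_ratio p i j P)
  then obtain P' where P': "P' \<in> dens m'" "\<And>f. fin_fibres g f \<Longrightarrow>
    fin_fibres g (act P f) \<and> Lim g (act P f) = act P' (Lim g f)" by blast
  show ?case
  proof (cases "g i = g j")
    case True
    have "act (poly_ratio p (g j) (g i)) f = f" for f
      using True dens_ratio.hyps by (simp add: fun_eq_iff act_poly_ratio_refl F0_poly_1)
    then show ?thesis
      using P' by (intro bexI[of _ P']) (auto simp: act_mult fin_fibres_act Lim_act)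
  next
    case False
    then have "g i < g j" "g j < m'" using g[of i j] dens_ratio.hyps by auto
    then show ?thesis
      using P' by (intro bexI[of _ "poly_ratio p (g j) (g i) * P'"])
        (auto simp: act_mult fin_fibres_act Lim_act intro!: dens.dens_ratio dens_ratio.hyps)
  qed
qed

lemma Lim_dens_const:
  "P \<in> dens m \<Longrightarrow> fin_fibres (\<lambda>_. k) f \<Longrightarrow>
    fin_fibres (\<lambda>_. k) (act P f) \<and> Lim (\<lambda>_. k) (act P f) = Lim (\<lambda>_. k) f"
  by (induction rule: dens.induct)
    (auto simp: act_mult fin_fibres_act Lim_act fun_eq_iff act_poly_ratio_refl F0_poly_1)

section \<open>Dilation of the variables by powers of q\<close>

text \<open>The exponent of q that the monomial with exponent vector \<open>e\<close> picks up under
  the substitution of z_i q^(\<kappa> i) for z_i.\<close>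

definition wt :: "(nat \<Rightarrow> nat) \<Rightarrow> (nat \<Rightarrow>\<^sub>0 int) \<Rightarrow> int"
  where "wt \<kappa> e = (\<Sum>i\<in>Poly_Mapping.keys e. int (\<kappa> i) * Poly_Mapping.lookup e i)"

lemma wt_superset:
  assumes "finite A" "Poly_Mapping.keys e \<subseteq> A"
  shows "wt \<kappa> e = (\<Sum>i\<in>A. int (\<kappa> i) * Poly_Mapping.lookup e i)"
  unfolding wt_def by (rule sum.mono_neutral_left) (use assms in \<open>auto simp: in_keys_iff\<close>)

lemma wt_add: "wt \<kappa> (d + e) = wt \<kappa> d + wt \<kappa> e"
proof -
  let ?A = "Poly_Mapping.keys d \<union> Poly_Mapping.keys e"
  have "wt \<kappa> (d + e) = (\<Sum>i\<in>?A. int (\<kappa> i) * Poly_Mapping.lookup (d + e) i)"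
    by (rule wt_superset) (simp_all add: Poly_Mapping.keys_add)
  then show ?thesis
    by (simp add: lookup_add algebra_simps sum.distrib wt_superset[of ?A])
qed

lemma wt_diff: "wt \<kappa> (d - e) = wt \<kappa> d - wt \<kappa> e"
  using wt_add[of \<kappa> "d - e" e] by simp

lemma wt_single [simp]: "wt \<kappa> (Poly_Mapping.single j k) = int (\<kappa> j) * k"
  by (simp add: wt_def)

lemma wt_rexp: "wt \<kappa> (rexp j i k) = (int (\<kappa> j) - int (\<kappa> i)) * k"
  by (simp add: rexp_def wt_diff algebra_simps)

text \<open>Substituting \<open>z\<^sub>i q\<^bsup>\<kappa> i\<^esup>\<close> for \<open>z\<^sub>i\<close>.\<close>

definition qsub :: "(nat \<Rightarrow> nat) \<Rightarrow> ((nat \<Rightarrow>\<^sub>0 int) \<Rightarrow> 'l) \<Rightarrow> (nat \<Rightarrow>\<^sub>0 int) \<Rightarrow> 'l"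
  where "qsub \<kappa> f e = q powi wt \<kappa> e *s f e"

lemma qsub_laurent: "f \<in> laurent m \<Longrightarrow> qsub \<kappa> f \<in> laurent m"
  unfolding laurent_def qsub_def by auto

text \<open>The substitution turns p(z_j / z_i) into p(q^d z_j / z_i) with d = \<kappa> j - \<kappa>
  i. The scalar is the normalisation built into \<open>qdil\<close>.\<close>

lemma act_ratio_qsub:
  assumes "\<kappa> i \<le> \<kappa> j"
  shows "act (poly_ratio (qdil (\<kappa> j - \<kappa> i) p) j i) (qsub \<kappa> f) e
    = (1 / poly p (q ^ (\<kappa> j - \<kappa> i))) *s qsub \<kappa> (act (poly_ratio p j i) f) e"
proof -
  let ?d = "\<kappa> j - \<kappa> i" and ?N = "degree p"
  have deg: "degree (qdil ?d p) \<le> ?N"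
  proof -
    have "degree (qdil ?d p) \<le> degree (pcompose p [:0, q ^ ?d:])"
      unfolding qdil_def by (rule degree_smult_le)
    also have "\<dots> \<le> ?N" using degree_pcompose_le[of p "[:0, q ^ ?d:]"] by simp
    finally show ?thesis .
  qed
  have "(coeff (qdil ?d p) k * q powi wt \<kappa> (e - rexp j i (int k)))
      = (1 / poly p (q ^ ?d)) * q powi wt \<kappa> e * coeff p k" for k
  proof -
    have "q powi wt \<kappa> e = q powi (wt \<kappa> (e - rexp j i (int k)) + int (?d * k))"
      using assms by (simp add: wt_diff wt_rexp of_nat_diff)
    also have "\<dots> = q powi wt \<kappa> (e - rexp j i (int k)) * (q ^ ?d) ^ k"
      by (simp add: power_int_add power_mult del: of_nat_mult)
    finally show ?thesis
      by (simp add: qdil_def coeff_pcompose_linear)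
  qed
  then show ?thesis
    by (simp add: act_poly_ratio[OF deg] act_poly_ratio[of p ?N] qsub_def scale_sum_right)
qed

text \<open>The scalar \<open>c\<close> collects the normalising constants of the dilated factors;
  neither it nor the new denominator depends on \<open>f\<close>.\<close>

lemma dens_qsub:
  assumes "P \<in> dens m" and \<kappa>: "\<And>i j. i < j \<Longrightarrow> j < m \<Longrightarrow> \<kappa> i \<le> \<kappa> j"
  shows "\<exists>P'\<in>dens m. \<exists>c. \<forall>f. act P' (qsub \<kappa> f) = (\<lambda>e. c *s qsub \<kappa> (act P f) e)"
  using assms(1)
proof (induction rule: dens.induct)
  case dens_one
  then show ?case by (intro bexI[of _ 1] exI[of _ 1]) (auto intro!: dens.dens_one)
next
  case (dens_ratio p i j P)
  then obtain P' c where P': "P' \<in> dens m" "\<And>f. act P' (qsub \<kappa> f) = (\<lambda>e. c *s qsub \<kappa> (act P f) e)"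
    by blast
  let ?d = "\<kappa> j - \<kappa> i"
  have "act (poly_ratio (qdil ?d p) j i * P') (qsub \<kappa> f)
      = (\<lambda>e. (c * (1 / poly p (q ^ ?d))) *s qsub \<kappa> (act (poly_ratio p j i * P) f) e)" for f
    using \<kappa>[of i j] dens_ratio.hyps
    by (auto simp: fun_eq_iff act_mult P'(2) act_scale_right act_ratio_qsub)
  moreover have "poly_ratio (qdil ?d p) j i * P' \<in> dens m"
    using dens_ratio.hyps P' by (intro dens.dens_ratio qdil_F0)
  ultimately show ?case by blast
qed

section \<open>Operator products and their compatibility\<close>

lemma E_add: "a \<in> E \<Longrightarrow> a (v + w) = a v + a w"
  and E_scale: "a \<in> E \<Longrightarrow> a (c *s v) = fls_scale c (a v)"
  by (auto simp: E_def Vector_Spaces.linear_iff)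

lemma E_I:
  assumes "\<And>v w. a (v + w) = a v + a w" "\<And>c v. a (c *s v) = fls_scale c (a v)"
  shows "a \<in> E"
  using assms by (simp add: E_def Vector_Spaces.linear_iff vector_space_axioms fls.vector_space_axioms)

lemma E_zero: "a \<in> E \<Longrightarrow> a 0 = 0"
  using E_scale[of a 0 0] by (simp add: fls_eq_iff)

text \<open>The coefficient of an operator product by recursion on the list. The exponents are an
  arbitrary function that is shifted along the list, so that a product can be split in the
  middle.\<close>

primrec ocomp :: "('l \<Rightarrow> 'l fls) list \<Rightarrow> 'l \<Rightarrow> (nat \<Rightarrow> int) \<Rightarrow> 'l" where
  "ocomp [] v \<eta> = v"
| "ocomp (a # as) v \<eta> = a (ocomp as v (\<lambda>i. \<eta> (Suc i))) $$ \<eta> 0"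

lemma foldr_ocomp:
  "foldr (\<lambda>j w. (as ! j) w $$ \<eta> j) [0..<length as] v = ocomp as v \<eta>"
proof (induction as arbitrary: \<eta>)
  case (Cons a as)
  have "[0..<length (a # as)] = 0 # map Suc [0..<length as]"
    by (simp add: upt_conv_Cons map_Suc_upt del: upt_Suc)
  then show ?case
    using Cons[of "\<lambda>i. \<eta> (Suc i)"] by (simp add: foldr_map o_def del: upt_Suc)
qed simp

lemma compose_ops_eq:
  "compose_ops as v e = (if Poly_Mapping.keys e \<subseteq> {..<length as}
     then ocomp as v (Poly_Mapping.lookup e) else 0)"
  by (simp add: compose_ops_def foldr_ocomp)

lemma ocomp_append:
  "ocomp (us @ ws) v \<eta> = ocomp us (ocomp ws v (\<lambda>i. \<eta> (i + length us))) \<eta>"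
  by (induction us arbitrary: \<eta>) auto

lemma ocomp_cong: "(\<And>i. i < length as \<Longrightarrow> \<eta> i = \<theta> i) \<Longrightarrow> ocomp as v \<eta> = ocomp as v \<theta>"
proof (induction as arbitrary: \<eta> \<theta>)
  case (Cons a as)
  have "ocomp as v (\<lambda>i. \<eta> (Suc i)) = ocomp as v (\<lambda>i. \<theta> (Suc i))"
    by (rule Cons.IH) (use Cons.prems in auto)
  moreover have "\<eta> 0 = \<theta> 0" using Cons.prems by simp
  ultimately show ?case by simp
qed simp

lemma ocomp_add: "set as \<subseteq> E \<Longrightarrow> ocomp as (v + w) \<eta> = ocomp as v \<eta> + ocomp as w \<eta>"
  by (induction as arbitrary: \<eta>) (auto simp: E_add)

lemma ocomp_scale: "set as \<subseteq> E \<Longrightarrow> ocomp as (c *s v) \<eta> = c *s ocomp as v \<eta>"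
  by (induction as arbitrary: \<eta>) (auto simp: E_scale)

lemma ocomp_zero: "set as \<subseteq> E \<Longrightarrow> ocomp as 0 \<eta> = 0"
  using ocomp_scale[of as 0 0] by simp

lemma ocomp_sum: "set as \<subseteq> E \<Longrightarrow> ocomp as (\<Sum>x\<in>X. f x) \<eta> = (\<Sum>x\<in>X. ocomp as (f x) \<eta>)"
  by (induction X rule: infinite_finite_induct) (auto simp: ocomp_add ocomp_zero)

lemma compose_add: "set as \<subseteq> E \<Longrightarrow> compose_ops as (v + w) e = compose_ops as v e + compose_ops as w e"
  by (simp add: compose_ops_eq ocomp_add)

lemma compose_scale: "set as \<subseteq> E \<Longrightarrow> compose_ops as (c *s v) e = c *s compose_ops as v e"
  by (simp add: compose_ops_eq ocomp_scale)

lemma act_compose_linear: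
  assumes "set as \<subseteq> E"
  shows "Vector_Spaces.linear scale scale (\<lambda>v. act P (compose_ops as v) e)"
  using assms
  by (simp add: Vector_Spaces.linear_iff vector_space_axioms laurent_poly_mult_def compose_add compose_scale
      scale_right_distrib sum.distrib scale_sum_right mult.commute)

text \<open>Quasi-commutativity without weights: the dilations are already part of the operators in
  the list. The factors of the denominator may use different polynomials.\<close>

definition compat :: "('l \<Rightarrow> 'l fls) list \<Rightarrow> bool"
  where "compat as \<longleftrightarrow> (\<exists>P\<in>dens (length as). \<forall>v. act P (compose_ops as v) \<in> laurent (length as))"

lemma compat_std:
  "compat as \<longleftrightarrow> (\<exists>p\<in>F0. \<forall>v. act (std_den (length as) p) (compose_ops as v) \<in> laurent (length as))"
proof
  assume "compat as"
  then obtain P where P: "P \<in> dens (length as)"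
      "\<And>v. act P (compose_ops as v) \<in> laurent (length as)"
    unfolding compat_def by blast
  obtain p Q where "p \<in> F0" "Q \<in> dens (length as)" "Q * P = std_den (length as) p"
    using dens_dvd_std[OF P(1)] by blast
  then show "\<exists>p\<in>F0. \<forall>v. act (std_den (length as) p) (compose_ops as v) \<in> laurent (length as)"
    using P(2) laurent_dens by (metis act_mult)
qed (use std_den_dens in \<open>auto simp: compat_def\<close>)

text \<open>Linearity in v is inherited from the operators, so only the bounds on the exponents are
  at stake.\<close>

lemma act_std_Hom:
  assumes "set as \<subseteq> E"
  shows "(\<lambda>v. act P (compose_ops as v)) \<in> Hom (length as)
    \<longleftrightarrow> (\<forall>v. act P (compose_ops as v) \<in> laurent (length as))"
  using act_compose_linear[OF assms] by (auto simp: Hom_def)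

lemma compat_cong_qsub:
  assumes "compat as" "length bs = length as"
    and "\<And>i j. i < j \<Longrightarrow> j < length as \<Longrightarrow> \<kappa> i \<le> \<kappa> j"
    and bs: "\<And>v. compose_ops bs v = qsub \<kappa> (compose_ops as v)"
  shows "compat bs"
proof -
  obtain P where P: "P \<in> dens (length as)" "\<And>v. act P (compose_ops as v) \<in> laurent (length as)"
    using assms(1) unfolding compat_def by blast
  obtain P' c where P': "P' \<in> dens (length as)"
      "\<And>f. act P' (qsub \<kappa> f) = (\<lambda>e. c *s qsub \<kappa> (act P f) e)"
    using dens_qsub[OF P(1), of \<kappa>] assms(3) by blast
  have "act P' (compose_ops bs v) \<in> laurent (length as)" for v
    unfolding bs P'(2) by (intro laurent_scale qsub_laurent P(2))
  then show ?thesis unfolding compat_def assms(2) using P'(1) by blast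
qed

lemma dilate_E: "a \<in> E \<Longrightarrow> dilate k a \<in> E"
  by (rule E_I) (auto simp: dilate_def fls_eq_iff E_add E_scale scale_right_distrib mult.commute)

lemma dilate_nth: "dilate k a v $$ n = q powi (int k * n) *s a v $$ n"
  by (simp add: dilate_def)

lemma dilate_dilate: "dilate k (dilate l a) = dilate (k + l) a"
  by (simp add: dilate_def fun_eq_iff fls_eq_iff algebra_simps power_int_add)

lemma dilate_0 [simp]: "dilate 0 a = a"
  by (simp add: dilate_def fun_eq_iff fls_eq_iff)

definition dilate_seq :: "(nat \<Rightarrow> nat) \<Rightarrow> ('l \<Rightarrow> 'l fls) list \<Rightarrow> ('l \<Rightarrow> 'l fls) list"
  where "dilate_seq \<kappa> as = map (\<lambda>j. dilate (\<kappa> j) (as ! j)) [0..<length as]"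

lemma length_dilate_seq [simp]: "length (dilate_seq \<kappa> as) = length as"
  by (simp add: dilate_seq_def)

lemma dilate_seq_Nil [simp]: "dilate_seq \<kappa> [] = []"
  by (simp add: dilate_seq_def)

lemma dilate_seq_Cons [simp]:
  "dilate_seq \<kappa> (a # as) = dilate (\<kappa> 0) a # dilate_seq (\<lambda>j. \<kappa> (Suc j)) as"
  unfolding dilate_seq_def
  by (simp add: upt_conv_Cons map_Suc_upt[symmetric] o_def del: upt_Suc)

lemma dilate_seq_append:
  "dilate_seq \<kappa> (as @ bs) = dilate_seq \<kappa> as @ dilate_seq (\<lambda>j. \<kappa> (j + length as)) bs"
  by (induction as arbitrary: \<kappa>) auto

lemma dilate_seq_cong:
  "(\<And>j. j < length as \<Longrightarrow> \<kappa> j = \<mu> j) \<Longrightarrow> dilate_seq \<kappa> as = dilate_seq \<mu> as"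
  by (auto simp: dilate_seq_def)

lemma ocomp_dilate_seq:
  "set as \<subseteq> E \<Longrightarrow> ocomp (dilate_seq \<kappa> as) v \<eta>
    = q powi (\<Sum>i<length as. int (\<kappa> i) * \<eta> i) *s ocomp as v \<eta>"
proof (induction as arbitrary: \<kappa> \<eta>)
  case (Cons a as)
  have "(\<Sum>i<length (a # as). int (\<kappa> i) * \<eta> i)
      = int (\<kappa> 0) * \<eta> 0 + (\<Sum>i<length as. int (\<kappa> (Suc i)) * \<eta> (Suc i))"
    unfolding length_Cons by (rule sum.lessThan_Suc_shift)
  with Cons show ?case
    by (simp add: dilate_nth E_scale power_int_add del: sum.lessThan_Suc)
qed simp

lemma compose_dilate_seq:
  assumes "set as \<subseteq> E"
  shows "compose_ops (dilate_seq \<kappa> as) v = qsub \<kappa> (compose_ops as v)"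
  using assms
  by (auto simp: fun_eq_iff compose_ops_eq qsub_def ocomp_dilate_seq wt_superset[of "{..<length as}"])

lemma compat_dilate_seq:
  assumes "compat as" "set as \<subseteq> E"
    and "\<And>i j. i < j \<Longrightarrow> j < length as \<Longrightarrow> \<kappa> i \<le> \<kappa> j"
  shows "compat (dilate_seq \<kappa> as)"
  by (rule compat_cong_qsub[OF assms(1) _ assms(3) compose_dilate_seq]) (use assms in auto)

section \<open>Stability of compatibility under linear combinations and q-derivatives\<close>

abbreviation op_scale :: "'f \<Rightarrow> ('l \<Rightarrow> 'l fls) \<Rightarrow> 'l \<Rightarrow> 'l fls"
  where "op_scale c a \<equiv> (\<lambda>v. fls_scale c (a v))"

abbreviation zdiv :: "('l \<Rightarrow> 'l fls) \<Rightarrow> 'l \<Rightarrow> 'l fls"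
  where "zdiv a \<equiv> (\<lambda>v. fls_shift 1 (a v))"

lemma q_deriv_eq: "q_deriv a = op_scale (1 / (q - 1)) (zdiv (dilate 1 a - a))"
  by (simp add: q_deriv_def)

lemma op_scale_E: "a \<in> E \<Longrightarrow> op_scale c a \<in> E"
  by (rule E_I) (auto simp: fls_eq_iff E_add E_scale scale_right_distrib mult.commute)

lemma zdiv_E: "a \<in> E \<Longrightarrow> zdiv a \<in> E"
  by (rule E_I) (auto simp: fls_eq_iff E_add E_scale)

lemma add_E: "a \<in> E \<Longrightarrow> b \<in> E \<Longrightarrow> a + b \<in> E"
  by (rule E_I) (auto simp: fls_eq_iff E_add E_scale scale_right_distrib)

lemma diff_E: "a \<in> E \<Longrightarrow> b \<in> E \<Longrightarrow> a - b \<in> E"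
  by (rule E_I) (auto simp: fls_eq_iff E_add E_scale scale_right_diff_distrib)

lemma zero_E: "0 \<in> E"
  by (rule E_I) (auto simp: fls_eq_iff)

lemma fls_const_E: "fls_const \<in> E"
  by (rule E_I) (auto simp: fls_eq_iff)

lemma q_deriv_E: "a \<in> E \<Longrightarrow> q_deriv a \<in> E"
  unfolding q_deriv_eq by (intro op_scale_E zdiv_E diff_E dilate_E)

lemma compose_op_add:
  "set us \<subseteq> E \<Longrightarrow> compose_ops (us @ (x + y) # ws) v
    = (\<lambda>e. compose_ops (us @ x # ws) v e + compose_ops (us @ y # ws) v e)"
  by (auto simp: fun_eq_iff compose_ops_eq ocomp_append ocomp_add)

lemma compose_op_scale:
  "set us \<subseteq> E \<Longrightarrow> compose_ops (us @ op_scale c x # ws) v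
    = (\<lambda>e. c *s compose_ops (us @ x # ws) v e)"
  by (auto simp: fun_eq_iff compose_ops_eq ocomp_append ocomp_scale)

lemma compose_op_zdiv:
  "compose_ops (us @ zdiv x # ws) v
    = (\<lambda>e. compose_ops (us @ x # ws) v (e - Poly_Mapping.single (length us) (-1)))"
proof
  fix e
  let ?d = "Poly_Mapping.single (length us) (-1) :: nat \<Rightarrow>\<^sub>0 int"
  have "Poly_Mapping.keys (e - ?d) \<subseteq> {..<length (us @ x # ws)}
      \<longleftrightarrow> Poly_Mapping.keys e \<subseteq> {..<length (us @ x # ws)}"
    by (rule keys_subset_diff) auto
  moreover have "ocomp us w (Poly_Mapping.lookup (e - ?d)) = ocomp us w (Poly_Mapping.lookup e)" for w
    by (rule ocomp_cong) (simp add: lookup_minus lookup_single)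
  moreover have "ocomp ws w (\<lambda>i. Poly_Mapping.lookup (e - ?d) (Suc (i + length us)))
      = ocomp ws w (\<lambda>i. Poly_Mapping.lookup e (Suc (i + length us)))" for w
    by (rule ocomp_cong) (simp add: lookup_minus lookup_single when_def)
  ultimately show "compose_ops (us @ zdiv x # ws) v e = compose_ops (us @ x # ws) v (e - ?d)"
    by (simp add: compose_ops_eq ocomp_append lookup_minus)
qed

text \<open>The two summands may have different denominators; their product clears both.\<close>

lemma compat_add:
  assumes "set us \<subseteq> E" "compat (us @ x # ws)" "compat (us @ y # ws)"
  shows "compat (us @ (x + y) # ws)"
proof -
  let ?m = "length us + Suc (length ws)"
  obtain P Q where PQ: "P \<in> dens ?m" "\<And>v. act P (compose_ops (us @ x # ws) v) \<in> laurent ?m"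
      "Q \<in> dens ?m" "\<And>v. act Q (compose_ops (us @ y # ws) v) \<in> laurent ?m"
    using assms(2,3) unfolding compat_def by auto
  have "act (P * Q) (compose_ops (us @ (x + y) # ws) v) \<in> laurent ?m" for v
  proof -
    have "act (P * Q) (compose_ops (us @ (x + y) # ws) v) =
      (\<lambda>e. act (P * Q) (compose_ops (us @ x # ws) v) e
         + act (P * Q) (compose_ops (us @ y # ws) v) e)"
      by (rule ext) (simp only: compose_op_add[OF assms(1)] act_add_right)
    moreover have "act (P * Q) (compose_ops (us @ x # ws) v) \<in> laurent ?m"
      using laurent_dens[OF PQ(3) PQ(2)] by (simp only: act_mult act_commute[of P Q])
    moreover have "act (P * Q) (compose_ops (us @ y # ws) v) \<in> laurent ?m"
      using laurent_dens[OF PQ(1) PQ(4)] by (simp only: act_mult)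
    ultimately show ?thesis using laurent_add by simp
  qed
  then show ?thesis unfolding compat_def using dens_mult[OF PQ(1,3)] by auto
qed

lemma compat_scale:
  assumes "set us \<subseteq> E" "compat (us @ x # ws)"
  shows "compat (us @ op_scale c x # ws)"
proof -
  let ?m = "length us + Suc (length ws)"
  obtain P where P: "P \<in> dens ?m" "\<And>v. act P (compose_ops (us @ x # ws) v) \<in> laurent ?m"
    using assms(2) unfolding compat_def by auto
  have "act P (compose_ops (us @ op_scale c x # ws) v) \<in> laurent ?m" for v
  proof -
    have "act P (compose_ops (us @ op_scale c x # ws) v)
        = (\<lambda>e. c *s act P (compose_ops (us @ x # ws) v) e)"
      by (rule ext) (simp only: compose_op_scale[OF assms(1)] act_scale_right)
    then show ?thesis using laurent_scale[OF P(2)] by simp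
  qed
  then show ?thesis unfolding compat_def using P(1) by auto
qed

lemma compat_zdiv:
  assumes "compat (us @ x # ws)"
  shows "compat (us @ zdiv x # ws)"
proof -
  let ?m = "length us + Suc (length ws)"
  let ?d = "Poly_Mapping.single (length us) (-1) :: nat \<Rightarrow>\<^sub>0 int"
  obtain P where P: "P \<in> dens ?m" "\<And>v. act P (compose_ops (us @ x # ws) v) \<in> laurent ?m"
    using assms unfolding compat_def by auto
  have "act P (compose_ops (us @ zdiv x # ws) v) \<in> laurent ?m" for v
  proof -
    have "act P (compose_ops (us @ zdiv x # ws) v)
        = (\<lambda>e. act P (compose_ops (us @ x # ws) v) (e - ?d))"
      by (rule ext) (simp only: compose_op_zdiv act_shift)
    then show ?thesis
      using laurent_shift[OF P(2), of ?d v] by simp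
  qed
  then show ?thesis unfolding compat_def using P(1) by auto
qed

lemma compat_diff:
  assumes "set us \<subseteq> E" "compat (us @ x # ws)" "compat (us @ y # ws)"
  shows "compat (us @ (x - y) # ws)"
proof -
  have "x - y = x + op_scale (-1) y" by (simp add: fun_eq_iff fls_eq_iff)
  then show ?thesis using assms compat_add compat_scale by metis
qed

lemma map_dilate_0 [simp]: "map (dilate 0) as = as"
  by (induction as) auto

lemma dilate_seq_const: "dilate_seq (\<lambda>_. k) as = map (dilate k) as"
  by (induction as) auto

text \<open>The q-derivative is built from x(z q) and x(z). Both may stand before operators dilated
  by q, since the exponents 0 on \<open>us\<close>, then k = 1 or k = 0 at \<open>x\<close>, then 1
  on \<open>ws\<close> are increasing. Without the dilation of \<open>ws\<close> the term x(z q)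
  would break this order.\<close>

lemma compat_deriv:
  assumes "compat (us @ x # ws)" "set us \<subseteq> E" "x \<in> E" "set ws \<subseteq> E"
  shows "compat (us @ q_deriv x # map (dilate 1) ws)"
proof -
  have *: "compat (us @ dilate k x # map (dilate 1) ws)" if "k \<le> 1" for k
  proof -
    let ?\<kappa> = "\<lambda>j. if j < length us then 0 else if j = length us then k else 1"
    have "dilate_seq ?\<kappa> us = us"
      by (subst dilate_seq_cong[of us _ "\<lambda>_. 0"]) (auto simp: dilate_seq_const)
    then have "dilate_seq ?\<kappa> (us @ x # ws) = us @ dilate k x # map (dilate 1) ws"
      by (simp add: dilate_seq_append dilate_seq_const)
    moreover have "compat (dilate_seq ?\<kappa> (us @ x # ws))"
      by (rule compat_dilate_seq) (use assms that in auto)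
    ultimately show ?thesis by simp
  qed
  show ?thesis
    unfolding q_deriv_eq
    using *[of 1] *[of 0] assms by (intro compat_scale compat_zdiv compat_diff) auto
qed

lemma q_deriv_pow_E: "a \<in> E \<Longrightarrow> (q_deriv ^^ r) a \<in> E"
  by (induction r) (auto intro: q_deriv_E)

lemma compat_deriv_pow:
  assumes "compat (us @ x # ws)" "set us \<subseteq> E" "x \<in> E" "set ws \<subseteq> E"
  shows "compat (us @ (q_deriv ^^ r) x # map (dilate r) ws)"
proof (induction r)
  case (Suc r)
  have "map (dilate (Suc r)) ws = map (dilate 1) (map (dilate r) ws)"
    by (auto simp: dilate_dilate)
  moreover have "compat (us @ q_deriv ((q_deriv ^^ r) x) # map (dilate 1) (map (dilate r) ws))"
    by (rule compat_deriv[OF Suc]) (use assms in \<open>auto intro!: q_deriv_pow_E dilate_E\<close>)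
  ultimately show ?case by (simp only: funpow.simps o_apply)
qed (use assms in simp)

section \<open>Contraction of neighbouring operators\<close>

text \<open>Fixing the exponents of \<open>ws\<close> turns \<open>ws\<close> applied to v into a
  single vector, and the operators in \<open>us\<close> are linear. The factor therefore acts on the
  product of the two neighbours alone.\<close>

lemma act_compose_pair:
  fixes us ws
  defines "k \<equiv> length us" and "m \<equiv> length us + 2 + length ws"
  assumes us: "set us \<subseteq> E"
  shows "act (poly_ratio p (Suc k) k) (compose_ops (us @ x # y # ws) v) e =
    (if Poly_Mapping.keys e \<subseteq> {..<m}
     then ocomp us (act (poly_ratio p 1 0)
         (compose_ops [x, y] (ocomp ws v (\<lambda>i. Poly_Mapping.lookup e (i + k + 2))))
         (Poly_Mapping.single 0 (Poly_Mapping.lookup e k)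
           + Poly_Mapping.single 1 (Poly_Mapping.lookup e (Suc k)))) (Poly_Mapping.lookup e)
     else 0)"
proof -
  define w where "w = ocomp ws v (\<lambda>i. Poly_Mapping.lookup e (i + k + 2))"
  define d where "d = Poly_Mapping.single 0 (Poly_Mapping.lookup e k)
           + Poly_Mapping.single (1::nat) (Poly_Mapping.lookup e (Suc k))"
  have 1: "compose_ops (us @ x # y # ws) v (e - rexp (Suc k) k t) =
     (if Poly_Mapping.keys e \<subseteq> {..<m}
      then ocomp us (x (y w $$ (Poly_Mapping.lookup e (Suc k) - t)) $$ (Poly_Mapping.lookup e k + t))
        (Poly_Mapping.lookup e) else 0)" for t
  proof -
    let ?e = "e - rexp (Suc k) k t"
    have "Poly_Mapping.keys ?e \<subseteq> {..<m} \<longleftrightarrow> Poly_Mapping.keys e \<subseteq> {..<m}"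
      by (rule keys_subset_diff) (use keys_rexp[of "Suc k" k t] in \<open>auto simp: k_def m_def\<close>)
    moreover have "ocomp us u (Poly_Mapping.lookup ?e) = ocomp us u (Poly_Mapping.lookup e)" for u
      by (rule ocomp_cong) (simp add: lookup_minus lookup_single rexp_def k_def)
    moreover have "ocomp ws v (\<lambda>i. Poly_Mapping.lookup ?e (Suc (Suc (i + k)))) = w"
      unfolding w_def
      by (rule ocomp_cong) (simp add: lookup_minus lookup_single rexp_def k_def when_def)
    ultimately show ?thesis
      by (simp add: compose_ops_eq ocomp_append m_def k_def)
        (simp add: lookup_minus lookup_single rexp_def)
  qed
  have 2: "compose_ops [x, y] w (d - rexp 1 0 t)
      = x (y w $$ (Poly_Mapping.lookup e (Suc k) - t)) $$ (Poly_Mapping.lookup e k + t)" for t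
  proof -
    have "Poly_Mapping.keys (d - rexp 1 0 t) \<subseteq> {..<2}"
      by (auto simp: in_keys_iff d_def rexp_def lookup_minus lookup_add lookup_single when_def
          split: if_splits)
    then show ?thesis
      by (simp add: compose_ops_eq numeral_2_eq_2)
        (simp add: d_def lookup_minus lookup_add lookup_single rexp_def)
  qed
  show ?thesis
    unfolding w_def[symmetric] d_def[symmetric]
    by (simp add: act_poly_ratio[of p "degree p"] 1 2[simplified] ocomp_sum[OF us] ocomp_scale[OF us])
qed

text \<open>A single factor already makes the identification of z_k and z_(k+1) well defined: for
  fixed other exponents the fibre only sees the product of \<open>x\<close> and \<open>y\<close>
  applied to one vector, and that is Laurent in two variables after multiplication by the
  factor.\<close>

lemma contract_Lim:
  fixes us ws v
  defines "k \<equiv> length us" and "m \<equiv> length us + 2 + length ws"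
  assumes us: "set us \<subseteq> E"
    and xy: "\<And>w. act (poly_ratio p 1 0) (compose_ops [x, y] w) \<in> laurent 2"
    and z: "\<And>w n. z w $$ n
      = Lim (\<lambda>_. 0) (act (poly_ratio p 1 0) (compose_ops [x, y] w)) (Poly_Mapping.single 0 n)"
  defines "B \<equiv> act (poly_ratio p (Suc k) k) (compose_ops (us @ x # y # ws) v)"
  shows "fin_fibres (contr k) B \<and> Lim (contr k) B = compose_ops (us @ z # ws) v"
proof -
  have "finite {e. B e \<noteq> 0 \<and> push (contr k) e = e'} \<and>
    Lim (contr k) B e' = compose_ops (us @ z # ws) v e'" for e'
  proof (cases "Poly_Mapping.keys e' \<subseteq> {..<m - 1}")
    case False
    have S: "{e. B e \<noteq> 0 \<and> push (contr k) e = e'} = {}"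
    proof safe
      fix e assume "B e \<noteq> 0" and e': "e' = push (contr k) e"
      then have "Poly_Mapping.keys e \<subseteq> {..<m}"
        using act_compose_pair[OF us] unfolding B_def k_def m_def by metis
      then have "contr k ` Poly_Mapping.keys e \<subseteq> {..<m - 1}"
        by (auto simp: contr_def k_def m_def)
      then have "Poly_Mapping.keys e' \<subseteq> {..<m - 1}"
        using keys_push[of "contr k" e] unfolding e' by blast
      then show "e \<in> {}" using False by blast
    qed
    have "compose_ops (us @ z # ws) v e' = 0"
      using False by (simp add: compose_ops_eq m_def)
    then show ?thesis unfolding Lim_def S by simp
  next
    case True
    define \<eta> where "\<eta> = Poly_Mapping.lookup e'"
    define w where "w = ocomp ws v (\<lambda>i. \<eta> (i + k + 1))"
    define H where "H = act (poly_ratio p 1 0) (compose_ops [x, y] w)"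
    \<comment> \<open>The fibre over \<open>e'\<close> is parametrised by the exponent t of z_(k+1).
      The exponent \<eta> k is split as (\<eta> k - t) + t, in two variables by \<open>pr\<close>
      and in all m variables by \<open>ins\<close>; \<open>T\<close> is the finite set of t that
      contribute.\<close>
    define pr :: "int \<Rightarrow> (nat \<Rightarrow>\<^sub>0 int)"
      where "pr t = Poly_Mapping.single 0 (\<eta> k - t) + Poly_Mapping.single 1 t" for t
    define ins where "ins t = mk_exp m (\<lambda>j. if j < k then \<eta> j else if j = k then \<eta> k - t
      else if j = Suc k then t else \<eta> (j - 1))" for t
    define T where "T = {t. H (pr t) \<noteq> 0}"
    have km: "Suc k < m" by (simp add: k_def m_def)
    have H: "H \<in> laurent 2" using xy by (simp add: H_def)
    have pr: "push (\<lambda>_. 0) e = Poly_Mapping.single 0 (\<eta> k) \<Longrightarrow> Poly_Mapping.keys e \<subseteq> {..<2}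
        \<Longrightarrow> e = pr (Poly_Mapping.lookup e 1)" for e
    proof (rule poly_mapping_eqI)
      fix i assume *: "push (\<lambda>_. 0) e = Poly_Mapping.single 0 (\<eta> k)" "Poly_Mapping.keys e \<subseteq> {..<2}"
      have "{j. j < (2::nat)} = {0, 1}" by auto
      then have "Poly_Mapping.lookup e 0 + Poly_Mapping.lookup e 1 = \<eta> k"
        using lookup_push[OF *(2), of "\<lambda>_. 0" 0] *(1) by simp
      moreover have "i \<ge> 2 \<Longrightarrow> Poly_Mapping.lookup e i = 0"
        using *(2) by (auto simp: in_keys_iff)
      moreover have "i = 0 \<or> i = 1 \<or> i \<ge> 2" by linarith
      ultimately show "Poly_Mapping.lookup e i = Poly_Mapping.lookup (pr (Poly_Mapping.lookup e 1)) i"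
        by (auto simp: pr_def lookup_add lookup_single when_def)
    qed
    have push_pr: "push (\<lambda>_. 0) (pr t) = Poly_Mapping.single 0 (\<eta> k)" for t
      by (simp add: pr_def push_add flip: single_add)
    have inj_pr: "inj pr"
    proof (rule injI)
      fix s t assume "pr s = pr t"
      then have "Poly_Mapping.lookup (pr s) 1 = Poly_Mapping.lookup (pr t) 1" by simp
      then show "s = t" by (simp add: pr_def lookup_add lookup_single)
    qed
    have T: "finite T"
    proof -
      have "finite {e. H e \<noteq> 0 \<and> push (\<lambda>_. 0) e = Poly_Mapping.single 0 (\<eta> k)}"
        using laurent_fin_fibres[OF H] by (simp add: fin_fibres_def)
      then have "finite (pr -` {e. H e \<noteq> 0 \<and> push (\<lambda>_. 0) e = Poly_Mapping.single 0 (\<eta> k)})"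
        using inj_pr by (rule finite_vimageI)
      then show ?thesis by (simp add: T_def push_pr vimage_def)
    qed
    have Bins: "B (ins t) = ocomp us (H (pr t)) \<eta>" for t
    proof -
      have "ocomp ws v (\<lambda>i. Poly_Mapping.lookup (ins t) (i + k + 2)) = w"
        unfolding w_def by (rule ocomp_cong) (simp add: ins_def m_def k_def)
      moreover have "ocomp us u (Poly_Mapping.lookup (ins t)) = ocomp us u \<eta>" for u
        by (rule ocomp_cong) (simp add: ins_def m_def k_def)
      moreover have "Poly_Mapping.keys (ins t) \<subseteq> {..<m}"
        unfolding ins_def by (rule keys_mk_exp)
      moreover have "Poly_Mapping.lookup (ins t) k = \<eta> k - t" "Poly_Mapping.lookup (ins t) (Suc k) = t"
        using km by (auto simp: ins_def)
      ultimately show ?thesis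
        using act_compose_pair[OF us, of p x y ws v "ins t"]
        by (simp add: B_def H_def pr_def m_def k_def)
    qed
    have push_ins: "push (contr k) (ins t) = e'" for t
    proof (rule poly_mapping_eqI)
      fix i
      have "\<not> Suc i < m \<Longrightarrow> \<eta> i = 0"
        using True by (auto simp: \<eta>_def in_keys_iff)
      then show "Poly_Mapping.lookup (push (contr k) (ins t)) i = Poly_Mapping.lookup e' i"
        using km lookup_push_contr[OF keys_mk_exp km, of
            "\<lambda>j. if j < k then \<eta> j else if j = k then \<eta> k - t
              else if j = Suc k then t else \<eta> (j - 1)" i]
        by (auto simp: ins_def \<eta>_def)
    qed
    have ins: "e = ins (Poly_Mapping.lookup e (Suc k))"
      if "push (contr k) e = e'" "Poly_Mapping.keys e \<subseteq> {..<m}" for e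
    proof (rule poly_mapping_eqI)
      fix i
      have \<eta>: "\<eta> i = (if i < k then Poly_Mapping.lookup e i
         else if i = k then Poly_Mapping.lookup e k + Poly_Mapping.lookup e (Suc k)
         else Poly_Mapping.lookup e (Suc i))" for i
        using lookup_push_contr[OF that(2) km, of i] that(1) by (simp add: \<eta>_def)
      have "\<not> i < m \<Longrightarrow> Poly_Mapping.lookup e i = 0"
        using that(2) by (auto simp: in_keys_iff)
      then show "Poly_Mapping.lookup e i = Poly_Mapping.lookup (ins (Poly_Mapping.lookup e (Suc k))) i"
        by (auto simp: ins_def \<eta>)
    qed
    have inj_ins: "inj ins"
    proof (rule injI)
      fix s t assume "ins s = ins t"
      then have "Poly_Mapping.lookup (ins s) (Suc k) = Poly_Mapping.lookup (ins t) (Suc k)" by simp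
      then show "s = t" using km by (simp add: ins_def)
    qed
    have sub: "e \<in> ins ` T" if "B e \<noteq> 0" "push (contr k) e = e'" for e
    proof -
      have "Poly_Mapping.keys e \<subseteq> {..<m}"
        using act_compose_pair[OF us] that(1) unfolding B_def k_def m_def by metis
      then have e: "e = ins (Poly_Mapping.lookup e (Suc k))" using ins that by blast
      then have "ocomp us (H (pr (Poly_Mapping.lookup e (Suc k)))) \<eta> \<noteq> 0"
        using Bins that(1) by metis
      then have "H (pr (Poly_Mapping.lookup e (Suc k))) \<noteq> 0"
        using ocomp_zero[OF us] by metis
      then show ?thesis using e unfolding T_def by blast
    qed
    have "Lim (contr k) B e' = sum B (ins ` T)"
      by (rule Lim_superset) (use T push_ins sub in auto)
    also have "\<dots> = (\<Sum>t\<in>T. ocomp us (H (pr t)) \<eta>)"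
      using inj_ins by (subst sum.reindex) (auto simp: Bins inj_on_def)
    also have "\<dots> = ocomp us (\<Sum>t\<in>T. H (pr t)) \<eta>"
      by (simp add: ocomp_sum[OF us])
    also have "(\<Sum>t\<in>T. H (pr t)) = sum H (pr ` T)"
      using inj_pr by (subst sum.reindex) (auto simp: inj_on_def)
    also have "\<dots> = Lim (\<lambda>_. 0) H (Poly_Mapping.single 0 (\<eta> k))"
    proof (rule Lim_superset[symmetric])
      fix e assume e: "H e \<noteq> 0" "push (\<lambda>_. 0) e = Poly_Mapping.single 0 (\<eta> k)"
      then have "Poly_Mapping.keys e \<subseteq> {..<2}" using H by (auto simp: laurent_def)
      then have "e = pr (Poly_Mapping.lookup e 1)" using pr e by blast
      then show "e \<in> pr ` T" using e(1) by (metis (mono_tags) T_def imageI mem_Collect_eq)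
    qed (use T push_pr in auto)
    also have "\<dots> = z w $$ \<eta> k" by (simp add: z H_def)
    also have "ocomp us (z w $$ \<eta> k) \<eta> = compose_ops (us @ z # ws) v e'"
      using True by (simp add: compose_ops_eq ocomp_append m_def k_def w_def \<eta>_def)
    finally have "Lim (contr k) B e' = compose_ops (us @ z # ws) v e'" .
    moreover have "finite {e. B e \<noteq> 0 \<and> push (contr k) e = e'}"
      by (rule finite_subset[of _ "ins ` T"]) (use sub T in auto)
    ultimately show ?thesis by blast
  qed
  then show ?thesis by (auto simp: fin_fibres_def)
qed

text \<open>The product without weights and derivatives. The choice of \<open>p\<close> has the same
  form as in \<open>hom_prod\<close>, so the two products can be matched by unfolding.\<close>

definition pmul :: "('l \<Rightarrow> 'l fls) \<Rightarrow> ('l \<Rightarrow> 'l fls) \<Rightarrow> 'l \<Rightarrow> 'l fls"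
  where "pmul a b = (let p = SOME p. p \<in> F0 \<and> (\<lambda>v. act (poly_ratio p 1 0) (compose_ops [a, b] v)) \<in> Hom 2
    in lim_diag (\<lambda>v. act (poly_ratio p 1 0) (compose_ops [a, b] v)))"

lemma pmul_choice:
  assumes "compat [a, b]" "a \<in> E" "b \<in> E"
  obtains p where "p \<in> F0" "\<And>v. act (poly_ratio p 1 0) (compose_ops [a, b] v) \<in> laurent 2"
    "\<And>v n. pmul a b v $$ n
      = Lim (\<lambda>_. 0) (act (poly_ratio p 1 0) (compose_ops [a, b] v)) (Poly_Mapping.single 0 n)"
proof -
  define p where
    "p = (SOME p. p \<in> F0 \<and> (\<lambda>v. act (poly_ratio p 1 0) (compose_ops [a, b] v)) \<in> Hom 2)"
  have l: "length [a, b] = 2" by simp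
  have H: "(\<lambda>v. act P (compose_ops [a, b] v)) \<in> Hom 2
      \<longleftrightarrow> (\<forall>v. act P (compose_ops [a, b] v) \<in> laurent 2)" for P
    using act_std_Hom[of "[a, b]" P] assms unfolding l by simp
  have "\<exists>p. p \<in> F0 \<and> (\<lambda>v. act (poly_ratio p 1 0) (compose_ops [a, b] v)) \<in> Hom 2"
    using assms(1) unfolding compat_std H l std_den_2 by blast
  then have "p \<in> F0 \<and> (\<lambda>v. act (poly_ratio p 1 0) (compose_ops [a, b] v)) \<in> Hom 2"
    unfolding p_def by (rule someI_ex)
  then have p: "p \<in> F0" "\<And>v. act (poly_ratio p 1 0) (compose_ops [a, b] v) \<in> laurent 2"
    unfolding H by auto
  have "pmul a b = lim_diag (\<lambda>v. act (poly_ratio p 1 0) (compose_ops [a, b] v))"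
    by (simp add: pmul_def p_def)
  then have "pmul a b v $$ n
      = Lim (\<lambda>_. 0) (act (poly_ratio p 1 0) (compose_ops [a, b] v)) (Poly_Mapping.single 0 n)" for v n
    using lim_diag_nth[of "\<lambda>v. act (poly_ratio p 1 0) (compose_ops [a, b] v)", OF p(2)] by simp
  then show ?thesis using that p by blast
qed

lemma ratio_dens_2: "p \<in> F0 \<Longrightarrow> poly_ratio p 1 0 \<in> dens 2"
  using std_den_dens[of p 2] by (simp add: std_den_2)

text \<open>The limit does not depend on the denominator because \<open>p(1) = 1\<close>.\<close>

lemma pmul_nth:
  assumes "compat [a, b]" "a \<in> E" "b \<in> E"
    and P: "P \<in> dens 2" "act P (compose_ops [a, b] v) \<in> laurent 2"
  shows "pmul a b v $$ n = Lim (\<lambda>_. 0) (act P (compose_ops [a, b] v)) (Poly_Mapping.single 0 n)"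
proof -
  obtain p where p: "p \<in> F0" "\<And>v. act (poly_ratio p 1 0) (compose_ops [a, b] v) \<in> laurent 2"
    "\<And>v n. pmul a b v $$ n
      = Lim (\<lambda>_. 0) (act (poly_ratio p 1 0) (compose_ops [a, b] v)) (Poly_Mapping.single 0 n)"
    using pmul_choice[OF assms(1-3)] by metis
  let ?A = "compose_ops [a, b] v" and ?R = "poly_ratio p 1 0"
  have "Lim (\<lambda>_. 0) (act ?R ?A) = Lim (\<lambda>_. 0) (act P (act ?R ?A))"
    using Lim_dens_const[OF P(1) laurent_fin_fibres[OF p(2)]] by simp
  also have "\<dots> = Lim (\<lambda>_. 0) (act ?R (act P ?A))"
    by (subst act_commute) (rule refl)
  also have "\<dots> = Lim (\<lambda>_. 0) (act P ?A)"
    using Lim_dens_const[OF ratio_dens_2[OF p(1)] laurent_fin_fibres[OF P(2)]] by simp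
  finally show ?thesis by (simp add: p(3))
qed

lemma pmul_E:
  assumes "compat [a, b]" "a \<in> E" "b \<in> E"
  shows "pmul a b \<in> E"
proof -
  obtain p where p: "p \<in> F0" "\<And>v. act (poly_ratio p 1 0) (compose_ops [a, b] v) \<in> laurent 2"
    "\<And>v n. pmul a b v $$ n
      = Lim (\<lambda>_. 0) (act (poly_ratio p 1 0) (compose_ops [a, b] v)) (Poly_Mapping.single 0 n)"
    using pmul_choice[OF assms(1-3)] by metis
  define A where "A v = act (poly_ratio p 1 0) (compose_ops [a, b] v)" for v
  have lin: "Vector_Spaces.linear scale scale (\<lambda>v. A v e)" for e
    unfolding A_def using assms by (intro act_compose_linear) simp
  have add: "A (v + w) = (\<lambda>e. A v e + A w e)" for v w
    by (rule ext) (use lin in \<open>simp add: Vector_Spaces.linear_iff\<close>)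
  have sc: "A (c *s v) = (\<lambda>e. c *s A v e)" for c v
    by (rule ext) (use lin in \<open>simp add: Vector_Spaces.linear_iff\<close>)
  have ff: "fin_fibres (\<lambda>_. 0) (A v)" for v
    unfolding A_def by (rule laurent_fin_fibres[OF p(2)])
  have nth: "pmul a b v $$ n = Lim (\<lambda>_. 0) (A v) (Poly_Mapping.single 0 n)" for v n
    unfolding A_def by (rule p(3))
  show ?thesis
    by (rule E_I) (simp_all add: fls_eq_iff nth add sc Lim_add Lim_scale ff)
qed

text \<open>The factor belonging to the pair and the denominator \<open>P\<close> of the whole
  sequence commute. Applied first, the factor creates the product of the pair; applied last, it
  disappears under the identification. The exact equation, beyond mere compatibility, is what
  associativity needs.\<close>

lemma contract:
  fixes us ws
  defines "k \<equiv> length us" and "m \<equiv> length us + 2 + length ws"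
  assumes us: "set us \<subseteq> E" and xy: "x \<in> E" "y \<in> E" "compat [x, y]"
    and P: "P \<in> dens m" "\<And>v. act P (compose_ops (us @ x # y # ws) v) \<in> laurent m"
  shows "\<exists>P'\<in>dens (m - 1). \<forall>v. act P' (compose_ops (us @ pmul x y # ws) v) \<in> laurent (m - 1) \<and>
    act P' (compose_ops (us @ pmul x y # ws) v)
      = Lim (contr k) (act P (compose_ops (us @ x # y # ws) v))"
proof -
  obtain p where p: "p \<in> F0" "\<And>v. act (poly_ratio p 1 0) (compose_ops [x, y] v) \<in> laurent 2"
    "\<And>v n. pmul x y v $$ n
      = Lim (\<lambda>_. 0) (act (poly_ratio p 1 0) (compose_ops [x, y] v)) (Poly_Mapping.single 0 n)"
    using pmul_choice[OF xy(3,1,2)] by metis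
  have contr: "i < m \<Longrightarrow> contr k i < m - 1" "i < j \<Longrightarrow> contr k i \<le> contr k j" for i j
    by (auto simp: contr_def m_def k_def)
  obtain P' where P': "P' \<in> dens (m - 1)" "\<And>f. fin_fibres (contr k) f \<Longrightarrow>
    Lim (contr k) (act P f) = act P' (Lim (contr k) f)"
    using Lim_dens[OF P(1), of "contr k" "m - 1"] contr by blast
  have eq: "act P' (compose_ops (us @ pmul x y # ws) v)
      = Lim (contr k) (act P (compose_ops (us @ x # y # ws) v))" for v
  proof -
    let ?A = "compose_ops (us @ x # y # ws) v"
    let ?R = "poly_ratio p (Suc k) k"
    have B: "fin_fibres (contr k) (act ?R ?A)"
      "Lim (contr k) (act ?R ?A) = compose_ops (us @ pmul x y # ws) v"
      using contract_Lim[OF us p(2), where z="pmul x y" and ws=ws and v=v] p(3)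
      unfolding k_def by auto
    have "act P' (compose_ops (us @ pmul x y # ws) v) = Lim (contr k) (act P (act ?R ?A))"
      using B P'(2) by simp
    \<comment> \<open>Now the inner series is Laurent, so \<open>Lim\<close> may be exchanged with
      \<open>?R\<close>, whose two variables both become z_k.\<close>
    also have "\<dots> = Lim (contr k) (act ?R (act P ?A))"
      by (subst act_commute) (rule refl)
    also have "\<dots> = act (poly_ratio p k k) (Lim (contr k) (act P ?A))"
      by (subst Lim_act[OF laurent_fin_fibres[OF P(2)]]) (simp add: contr_def)
    also have "\<dots> = Lim (contr k) (act P ?A)"
      by (simp add: fun_eq_iff act_poly_ratio_refl F0_poly_1 p(1))
    finally show ?thesis .
  qed
  have "act P' (compose_ops (us @ pmul x y # ws) v) \<in> laurent (m - 1)" for v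
    unfolding eq by (rule laurent_Lim[OF P(2)]) (rule contr(1))
  then show ?thesis using P'(1) eq by blast
qed

lemma compat_contract:
  assumes "set us \<subseteq> E" "x \<in> E" "y \<in> E" "compat [x, y]" "compat (us @ x # y # ws)"
  shows "compat (us @ pmul x y # ws)"
proof -
  let ?m = "length us + 2 + length ws"
  obtain P where "P \<in> dens ?m" "\<And>v. act P (compose_ops (us @ x # y # ws) v) \<in> laurent ?m"
    using assms(5) unfolding compat_def by auto
  from contract[OF assms(1-4) this] obtain P' where "P' \<in> dens (?m - 1)"
    "\<And>v. act P' (compose_ops (us @ pmul x y # ws) v) \<in> laurent (?m - 1)"
    by blast
  then show ?thesis unfolding compat_def by auto
qed

text \<open>Both sides are the full diagonal limit of one and the same Laurent series in three
  variables. They differ only in which neighbouring pair is identified first.\<close>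

lemma pmul_assoc:
  assumes E: "a \<in> E" "b \<in> E" "c \<in> E"
    and ab: "compat [a, b]" and bc: "compat [b, c]" and abc: "compat [a, b, c]"
  shows "pmul a (pmul b c) = pmul (pmul a b) c"
proof -
  obtain P where P: "P \<in> dens 3" "\<And>v. act P (compose_ops [a, b, c] v) \<in> laurent 3"
    using abc unfolding compat_def numeral_3_eq_3 by auto
  have L: "Lim (\<lambda>_. 0) (Lim (contr k) (act P (compose_ops [a, b, c] v)))
      = Lim (\<lambda>_. 0) (act P (compose_ops [a, b, c] v))" for k v
    by (rule ext, rule Lim_Lim) (use P in \<open>auto simp: push_push o_def intro: laurent_fin_fibres\<close>)
  have "\<exists>Q\<in>dens 2. \<forall>v. act Q (compose_ops [a, pmul b c] v) \<in> laurent 2 \<and>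
      act Q (compose_ops [a, pmul b c] v) = Lim (contr 1) (act P (compose_ops [a, b, c] v))"
    using contract[of "[a]" b c P "[]"] E ab bc P by (simp add: numeral_2_eq_2 numeral_3_eq_3)
  then obtain P1 where P1: "P1 \<in> dens 2"
    "\<And>v. act P1 (compose_ops [a, pmul b c] v) \<in> laurent 2"
    "\<And>v. act P1 (compose_ops [a, pmul b c] v) = Lim (contr 1) (act P (compose_ops [a, b, c] v))"
    by blast
  have "\<exists>Q\<in>dens 2. \<forall>v. act Q (compose_ops [pmul a b, c] v) \<in> laurent 2 \<and>
      act Q (compose_ops [pmul a b, c] v) = Lim (contr 0) (act P (compose_ops [a, b, c] v))"
    using contract[of "[]" a b P "[c]"] E ab bc P by (simp add: numeral_2_eq_2 numeral_3_eq_3)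
  then obtain P2 where P2: "P2 \<in> dens 2"
    "\<And>v. act P2 (compose_ops [pmul a b, c] v) \<in> laurent 2"
    "\<And>v. act P2 (compose_ops [pmul a b, c] v) = Lim (contr 0) (act P (compose_ops [a, b, c] v))"
    by blast
  have c1: "compat [a, pmul b c]" and c2: "compat [pmul a b, c]"
    using compat_contract[of "[a]" b c "[]"] compat_contract[of "[]" a b "[c]"] assms by auto
  show ?thesis
    using pmul_nth[OF c1 _ _ P1(1,2)] pmul_nth[OF c2 _ _ P2(1,2)] pmul_E E ab bc
    by (auto simp: fun_eq_iff fls_eq_iff P1(3) P2(3) L)
qed

lemma Lim_const_compose_single: "Lim (\<lambda>_. 0) (compose_ops [a] v) (Poly_Mapping.single 0 n) = a v $$ n"
proof -
  have "Lim (\<lambda>_. 0) (compose_ops [a] v) (Poly_Mapping.single 0 n)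
      = sum (compose_ops [a] v) {Poly_Mapping.single 0 n}"
  proof (rule Lim_superset)
    fix e assume e: "compose_ops [a] v e \<noteq> 0" "push (\<lambda>_. 0) e = Poly_Mapping.single 0 n"
    then have "Poly_Mapping.keys e \<subseteq> {0}" by (auto simp: compose_ops_eq split: if_splits)
    then have "push (\<lambda>_. 0) e = push (\<lambda>j. j) e" by (intro push_cong) auto
    then show "e \<in> {Poly_Mapping.single 0 n}" using e push_id[of e] by simp
  qed auto
  then show ?thesis by (simp add: compose_ops_eq)
qed

lemma compose_single_laurent: "compose_ops [a] v \<in> laurent 1"
proof -
  have "compose_ops [a] v e \<noteq> 0 \<Longrightarrow>
      Poly_Mapping.keys e \<subseteq> {..<1} \<and> fls_subdegree (a v) \<le> Poly_Mapping.lookup e 0" for e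
    by (auto simp: compose_ops_eq not_less[symmetric] split: if_splits)
  then show ?thesis unfolding laurent_def by fastforce
qed

section \<open>The identity operator as a unit\<close>

text \<open>Renumbers the variables so that position \<open>k\<close> becomes free.\<close>

definition skip :: "nat \<Rightarrow> nat \<Rightarrow> nat"
  where "skip k j = (if j < k then j else Suc j)"

text \<open>The identity contributes only exponent 0, so inserting it is a renumbering of the
  variables. The renumbering is injective, hence its fibres have at most one element.\<close>

lemma compose_insert_one:
  fixes us ws
  defines "k \<equiv> length us"
  shows "fin_fibres (skip k) f"
    and "set us \<subseteq> E \<Longrightarrow> compose_ops (us @ fls_const # ws) v = Lim (skip k) (compose_ops (us @ ws) v)"
proof -
  have left: "push (contr k) (push (skip k) e) = e" for e
  proof -
    have "push (contr k) (push (skip k) e) = push (\<lambda>j. j) e"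
      unfolding push_push by (rule push_cong) (simp add: contr_def skip_def)
    then show ?thesis by (simp add: push_id)
  qed
  show "fin_fibres (skip k) f"
    unfolding fin_fibres_def
  proof
    fix e'
    show "finite {e. f e \<noteq> 0 \<and> push (skip k) e = e'}"
      by (rule finite_subset[of _ "{push (contr k) e'}"]) (auto simp: left)
  qed
  assume us: "set us \<subseteq> E"
  show "compose_ops (us @ fls_const # ws) v = Lim (skip k) (compose_ops (us @ ws) v)"
  proof
    fix e'
    let ?m = "length us + length ws"
    let ?e = "push (contr k) e'"
    show "compose_ops (us @ fls_const # ws) v e' = Lim (skip k) (compose_ops (us @ ws) v) e'"
    proof (cases "Poly_Mapping.lookup e' k = 0")
      case False
      have "{e. push (skip k) e = e'} = {}"
      proof safe
        fix e assume "e' = push (skip k) e"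
        then have "k \<in> skip k ` Poly_Mapping.keys e"
          using False keys_push[of "skip k" e] by (auto simp: in_keys_iff)
        then show "e \<in> {}" by (auto simp: skip_def split: if_splits)
      qed
      then show ?thesis
        using False by (auto simp: Lim_def compose_ops_eq ocomp_append k_def ocomp_zero[OF us])
    next
      case True
      have right: "push (skip k) ?e = e'"
      proof -
        have "push (skip k) ?e = push (\<lambda>j. j) e'"
          unfolding push_push
        proof (rule push_cong)
          fix j assume "j \<in> Poly_Mapping.keys e'"
          then have "j \<noteq> k" using True by (auto simp: in_keys_iff)
          then show "(skip k \<circ> contr k) j = j" by (auto simp: skip_def contr_def)
        qed
        then show ?thesis by (simp add: push_id)
      qed
      have "Lim (skip k) (compose_ops (us @ ws) v) e' = sum (compose_ops (us @ ws) v) {?e}"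
        by (rule Lim_superset) (auto simp: left right)
      also have "\<dots> = compose_ops (us @ fls_const # ws) v e'"
      proof (cases "Poly_Mapping.keys e' \<subseteq> {..<Suc ?m}")
        case k': True
        have "contr k ` Poly_Mapping.keys e' \<subseteq> {..<?m}"
        proof safe
          fix j assume j: "j \<in> Poly_Mapping.keys e'"
          then have "j \<noteq> k" using True by (auto simp: in_keys_iff)
          then show "contr k j < ?m" using j k' by (auto simp: contr_def k_def)
        qed
        then have ke: "Poly_Mapping.keys ?e \<subseteq> {..<?m}"
          using keys_push[of "contr k" e'] by blast
        have l: "Poly_Mapping.lookup ?e i = Poly_Mapping.lookup e' (skip k i)" for i
        proof -
          have "Poly_Mapping.lookup e' (skip k i) = Poly_Mapping.lookup (push (skip k) ?e) (skip k i)"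
            by (simp add: right)
          also have "\<dots> = (\<Sum>j | j < ?m \<and> skip k j = skip k i. Poly_Mapping.lookup ?e j)"
            by (rule lookup_push[OF ke])
          also have "{j. j < ?m \<and> skip k j = skip k i} = (if i < ?m then {i} else {})"
            by (auto simp: skip_def split: if_splits)
          finally show ?thesis using ke by (auto simp: in_keys_iff)
        qed
        have "ocomp us u (Poly_Mapping.lookup ?e) = ocomp us u (Poly_Mapping.lookup e')" for u
          by (rule ocomp_cong) (simp only: l, simp add: skip_def k_def)
        moreover have "ocomp ws v (\<lambda>i. Poly_Mapping.lookup ?e (i + length us))
            = ocomp ws v (\<lambda>i. Poly_Mapping.lookup e' (Suc (i + length us)))"
          by (rule ocomp_cong) (simp only: l, simp add: skip_def k_def)
        ultimately show ?thesis
          using k' ke True by (simp add: compose_ops_eq ocomp_append k_def)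
      next
        case False
        have "\<not> Poly_Mapping.keys ?e \<subseteq> {..<?m}"
        proof
          assume "Poly_Mapping.keys ?e \<subseteq> {..<?m}"
          then have "skip k ` Poly_Mapping.keys ?e \<subseteq> {..<Suc ?m}"
            by (auto simp: skip_def)
          then show False using keys_push[of "skip k" ?e] False unfolding right by blast
        qed
        then show ?thesis using False by (simp add: compose_ops_eq)
      qed
      finally show ?thesis by simp
    qed
  qed
qed

lemma insert_one:
  assumes us: "set us \<subseteq> E" and P: "P \<in> dens (length us + length ws)"
    "\<And>v. act P (compose_ops (us @ ws) v) \<in> laurent (length us + length ws)"
  shows "\<exists>P'\<in>dens (Suc (length us + length ws)). \<forall>v.
    act P' (compose_ops (us @ fls_const # ws) v) \<in> laurent (Suc (length us + length ws)) \<and>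
    act P' (compose_ops (us @ fls_const # ws) v)
      = Lim (skip (length us)) (act P (compose_ops (us @ ws) v))"
proof -
  let ?m = "length us + length ws" and ?g = "skip (length us)"
  obtain P' where P': "P' \<in> dens (Suc ?m)" "\<And>f. fin_fibres ?g f \<Longrightarrow>
    Lim ?g (act P f) = act P' (Lim ?g f)"
  proof -
    have "i < j \<Longrightarrow> j < ?m \<Longrightarrow> ?g i \<le> ?g j \<and> ?g j < Suc ?m" for i j
      by (auto simp: skip_def)
    then show ?thesis using Lim_dens[OF P(1), of ?g "Suc ?m"] that by blast
  qed
  have eq: "act P' (compose_ops (us @ fls_const # ws) v) = Lim ?g (act P (compose_ops (us @ ws) v))" for v
    by (simp add: compose_insert_one(2)[OF us] P'(2)[OF compose_insert_one(1)])
  have "act P' (compose_ops (us @ fls_const # ws) v) \<in> laurent (Suc ?m)" for v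
    unfolding eq by (rule laurent_Lim[OF P(2)]) (auto simp: skip_def)
  then show ?thesis using P'(1) eq by blast
qed

lemma compat_insert_one:
  assumes "set us \<subseteq> E" "compat (us @ ws)"
  shows "compat (us @ fls_const # ws)"
proof -
  obtain P where "P \<in> dens (length us + length ws)"
      "\<And>v. act P (compose_ops (us @ ws) v) \<in> laurent (length us + length ws)"
    using assms(2) unfolding compat_def by auto
  from insert_one[OF assms(1) this] show ?thesis unfolding compat_def by auto
qed

lemma compat_single: "compat [a]"
  unfolding compat_def using compose_single_laurent
  by (auto intro!: bexI[of _ 1] dens_one)

lemma pmul_one:
  assumes "a \<in> E"
  shows "pmul fls_const a = a" "pmul a fls_const = a"
proof -
  have L: "Lim (\<lambda>_. 0) (Lim (skip k) (compose_ops [a] v)) (Poly_Mapping.single 0 n) = a v $$ n" for k v n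
  proof -
    have "Lim (\<lambda>_. 0) (Lim (skip k) (compose_ops [a] v)) (Poly_Mapping.single 0 n)
      = Lim (\<lambda>_. 0) (compose_ops [a] v) (Poly_Mapping.single 0 n)"
      by (rule Lim_Lim)
        (auto simp: push_push o_def intro: laurent_fin_fibres[OF compose_single_laurent])
    then show ?thesis by (simp add: Lim_const_compose_single)
  qed
  have "\<exists>Q\<in>dens 2. \<forall>v. act Q (compose_ops [fls_const, a] v) \<in> laurent 2 \<and>
      act Q (compose_ops [fls_const, a] v) = Lim (skip 0) (compose_ops [a] v)"
    using insert_one[where P=1 and us="[]" and ws="[a]"] compose_single_laurent[of a] assms
    by (simp add: numeral_2_eq_2 dens_one)
  then obtain P where P: "P \<in> dens 2"
    "\<And>v. act P (compose_ops [fls_const, a] v) \<in> laurent 2"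
    "\<And>v. act P (compose_ops [fls_const, a] v) = Lim (skip 0) (compose_ops [a] v)"
    by blast
  have "compat [fls_const, a]"
    using compat_insert_one[of "[]" "[a]"] compat_single assms by simp
  then show "pmul fls_const a = a"
    using pmul_nth[OF _ fls_const_E assms P(1,2)] by (simp add: fun_eq_iff fls_eq_iff P(3) L)
  have "\<exists>Q\<in>dens 2. \<forall>v. act Q (compose_ops [a, fls_const] v) \<in> laurent 2 \<and>
      act Q (compose_ops [a, fls_const] v) = Lim (skip 1) (compose_ops [a] v)"
    using insert_one[where P=1 and us="[a]" and ws="[]"] compose_single_laurent[of a] assms
    by (simp add: numeral_2_eq_2 dens_one)
  then obtain Q where Q: "Q \<in> dens 2"
    "\<And>v. act Q (compose_ops [a, fls_const] v) \<in> laurent 2"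
    "\<And>v. act Q (compose_ops [a, fls_const] v) = Lim (skip 1) (compose_ops [a] v)"
    by blast
  have "compat [a, fls_const]"
    using compat_insert_one[of "[a]" "[]"] compat_single assms by simp
  then show "pmul a fls_const = a"
    using pmul_nth[OF _ assms fls_const_E Q(1,2)] by (simp add: fun_eq_iff fls_eq_iff Q(3) L)
qed

section \<open>The q-Leibniz rule and associativity\<close>

lemma compat_pairE:
  assumes "compat [a, b]"
  shows "\<exists>P\<in>dens 2. \<forall>v. act P (compose_ops [a, b] v) \<in> laurent 2"
  using assms unfolding compat_def by (simp add: numeral_2_eq_2)

text \<open>Stated through the composed series, so that linearity in the left and in the right
  argument are both instances. The product of the three denominators clears all three series at
  once.\<close>

lemma pmul_linear:
  assumes c: "compat [a, b]" "compat [a1, b1]" "compat [a2, b2]"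
    and E: "a \<in> E" "b \<in> E" "a1 \<in> E" "b1 \<in> E" "a2 \<in> E" "b2 \<in> E"
    and eq: "\<And>v. compose_ops [a, b] v
      = (\<lambda>e. x *s compose_ops [a1, b1] v e + compose_ops [a2, b2] v e)"
  shows "pmul a b = op_scale x (pmul a1 b1) + pmul a2 b2"
proof -
  obtain P where P: "P \<in> dens 2" "\<And>v. act P (compose_ops [a, b] v) \<in> laurent 2"
    using compat_pairE[OF c(1)] by blast
  obtain P1 where P1: "P1 \<in> dens 2" "\<And>v. act P1 (compose_ops [a1, b1] v) \<in> laurent 2"
    using compat_pairE[OF c(2)] by blast
  obtain P2 where P2: "P2 \<in> dens 2" "\<And>v. act P2 (compose_ops [a2, b2] v) \<in> laurent 2"
    using compat_pairE[OF c(3)] by blast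
  define R where "R = P * P1 * P2"
  have R: "R \<in> dens 2" unfolding R_def by (intro dens_mult P(1) P1(1) P2(1))
  have L: "act R (compose_ops [a, b] v) \<in> laurent 2" for v
  proof -
    have "R = P1 * P2 * P" by (simp add: R_def mult_ac)
    then show ?thesis using laurent_dens[OF dens_mult[OF P1(1) P2(1)] P(2)] by (simp add: act_mult)
  qed
  have L1: "act R (compose_ops [a1, b1] v) \<in> laurent 2" for v
  proof -
    have "R = P * P2 * P1" by (simp add: R_def mult_ac)
    then show ?thesis using laurent_dens[OF dens_mult[OF P(1) P2(1)] P1(2)] by (simp add: act_mult)
  qed
  have L2: "act R (compose_ops [a2, b2] v) \<in> laurent 2" for v
    using laurent_dens[OF dens_mult[OF P(1) P1(1)] P2(2)] by (simp add: R_def act_mult)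
  have A: "act R (compose_ops [a, b] v)
      = (\<lambda>e. x *s act R (compose_ops [a1, b1] v) e + act R (compose_ops [a2, b2] v) e)" for v
    by (rule ext) (simp only: eq act_add_right act_scale_right)
  show ?thesis
  proof (intro ext fls_eqI)
    fix v n
    have "pmul a b v $$ n = Lim (\<lambda>_. 0) (act R (compose_ops [a, b] v)) (Poly_Mapping.single 0 n)"
      by (rule pmul_nth[OF c(1) E(1,2) R L])
    also have "\<dots> = Lim (\<lambda>_. 0) (\<lambda>e. x *s act R (compose_ops [a1, b1] v) e) (Poly_Mapping.single 0 n)
        + Lim (\<lambda>_. 0) (act R (compose_ops [a2, b2] v)) (Poly_Mapping.single 0 n)"
      unfolding A by (rule Lim_add) (intro fin_fibres_scale laurent_fin_fibres[OF L1] laurent_fin_fibres[OF L2])+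
    also have "\<dots> = x *s pmul a1 b1 v $$ n + pmul a2 b2 v $$ n"
      unfolding Lim_scale pmul_nth[OF c(2) E(3,4) R L1] pmul_nth[OF c(3) E(5,6) R L2] by (rule refl)
    finally show "pmul a b v $$ n = (op_scale x (pmul a1 b1) + pmul a2 b2) v $$ n" by simp
  qed
qed

lemma compose_op_lin:
  assumes "set us \<subseteq> E"
  shows "compose_ops (us @ (op_scale c x + y) # ws) v
    = (\<lambda>e. c *s compose_ops (us @ x # ws) v e + compose_ops (us @ y # ws) v e)"
  by (simp only: compose_op_add[OF assms] compose_op_scale[OF assms])

lemma pmul_lin_left:
  assumes "compat [a, b]" "compat [a', b]" "a \<in> E" "a' \<in> E" "b \<in> E"
  shows "pmul (op_scale x a + a') b = op_scale x (pmul a b) + pmul a' b"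
proof (rule pmul_linear)
  show "compat [op_scale x a + a', b]"
    using compat_add[of "[]", OF _ compat_scale[of "[]"]] assms by simp
  show "compose_ops [op_scale x a + a', b] v
      = (\<lambda>e. x *s compose_ops [a, b] v e + compose_ops [a', b] v e)" for v
    using compose_op_lin[of "[]"] by simp
qed (use assms in \<open>auto intro: add_E op_scale_E\<close>)

lemma pmul_lin_right:
  assumes "compat [a, b]" "compat [a, b']" "a \<in> E" "b \<in> E" "b' \<in> E"
  shows "pmul a (op_scale x b + b') = op_scale x (pmul a b) + pmul a b'"
proof (rule pmul_linear)
  show "compat [a, op_scale x b + b']"
    using compat_add[of "[a]", OF _ compat_scale[of "[a]"]] assms by simp
  show "compose_ops [a, op_scale x b + b'] v
      = (\<lambda>e. x *s compose_ops [a, b] v e + compose_ops [a, b'] v e)" for v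
    using compose_op_lin[of "[a]"] assms by simp
qed (use assms in \<open>auto intro: add_E op_scale_E\<close>)

lemma lim_diag_zero: "lim_diag (\<lambda>v e. 0) v = 0"
  by (rule fls_eqI) (simp add: lim_diag_nth[of _ _ 0])

lemma pmul_zero_left: "pmul 0 b = 0"
proof -
  have "compose_ops [0, b] = (\<lambda>v e. 0)"
    by (simp add: fun_eq_iff compose_ops_eq)
  then show ?thesis by (intro ext) (simp add: pmul_def lim_diag_zero)
qed

lemma pmul_zero_right:
  assumes "a \<in> E"
  shows "pmul a 0 = 0"
proof -
  have "compose_ops [a, 0] = (\<lambda>v e. 0)"
    by (simp add: fun_eq_iff compose_ops_eq E_zero[OF assms])
  then show ?thesis by (intro ext) (simp add: pmul_def lim_diag_zero)
qed

lemma op_scale_0: "op_scale 0 a = 0"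
  by (simp add: fun_eq_iff fls_eq_iff)

lemma compat_zero:
  assumes "set us \<subseteq> E" "compat (us @ x # ws)"
  shows "compat (us @ 0 # ws)"
  using compat_scale[OF assms, of 0] by (simp only: op_scale_0)

lemma pmul_add_left:
  assumes "compat [a, b]" "compat [a', b]" "a \<in> E" "a' \<in> E" "b \<in> E"
  shows "pmul (a + a') b = pmul a b + pmul a' b"
  using pmul_lin_left[OF assms, of 1] by simp

lemma pmul_scale_left:
  assumes "compat [a, b]" "a \<in> E" "b \<in> E"
  shows "pmul (op_scale x a) b = op_scale x (pmul a b)"
  using pmul_lin_left[of a b 0 x] compat_zero[of "[]" a "[b]"] assms
  by (simp add: zero_E pmul_zero_left)

lemma pmul_scale_right:
  assumes "compat [a, b]" "a \<in> E" "b \<in> E"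
  shows "pmul a (op_scale x b) = op_scale x (pmul a b)"
  using pmul_lin_right[of a b 0 x] compat_zero[of "[a]" b "[]"] assms
  by (simp add: zero_E pmul_zero_right)

lemma op_diff: "op_scale (-1) a + b = b - a"
  by (simp add: fun_eq_iff fls_eq_iff)

lemma pmul_diff_left:
  assumes "compat [a, b]" "compat [a', b]" "a \<in> E" "a' \<in> E" "b \<in> E"
  shows "pmul (a' - a) b = pmul a' b - pmul a b"
  using pmul_lin_left[OF assms, of "-1"] by (simp only: op_diff)

lemma pmul_diff_right:
  assumes "compat [a, b]" "compat [a, b']" "a \<in> E" "b \<in> E" "b' \<in> E"
  shows "pmul a (b' - b) = pmul a b' - pmul a b"
  using pmul_lin_right[OF assms, of "-1"] by (simp only: op_diff)

text \<open>The operator \<open>a0\<close> serves the empty sum: scaling it by 0 yields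
  \<open>compat [0, b]\<close>.\<close>

lemma pmul_sum_left:
  assumes "finite X" "\<And>i. i \<in> X \<Longrightarrow> a i \<in> E" "\<And>i. i \<in> X \<Longrightarrow> compat [a i, b]" "b \<in> E"
    and "compat [a0, b]"
  shows "compat [\<Sum>i\<in>X. a i, b] \<and> (\<Sum>i\<in>X. a i) \<in> E \<and> pmul (\<Sum>i\<in>X. a i) b = (\<Sum>i\<in>X. pmul (a i) b)"
  using assms(1,2,3)
proof (induction X rule: finite_induct)
  case empty
  have "compat [0, b]" using compat_zero[of "[]" a0 "[b]"] assms(5) by simp
  then show ?case unfolding sum.empty using zero_E pmul_zero_left by blast
next
  case (insert i X)
  then have "compat [\<Sum>i\<in>X. a i, b]" "(\<Sum>i\<in>X. a i) \<in> E"
      "pmul (\<Sum>i\<in>X. a i) b = (\<Sum>i\<in>X. pmul (a i) b)" "compat [a i, b]" "a i \<in> E"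
    by auto
  moreover from this have "compat [a i + (\<Sum>i\<in>X. a i), b]"
    using compat_add[of "[]" "a i" "[b]" "\<Sum>i\<in>X. a i"] by simp
  ultimately show ?case
    unfolding sum.insert[OF insert.hyps] using assms(4) by (metis add_E pmul_add_left)
qed

text \<open>Division by z_0 and division by z_1 become the same shift once the two variables are
  identified.\<close>

lemma pmul_zdiv:
  assumes "compat [a, b]" "a \<in> E" "b \<in> E"
  shows "pmul (zdiv a) b = zdiv (pmul a b)" "pmul a (zdiv b) = zdiv (pmul a b)"
proof -
  obtain P where P: "P \<in> dens 2" "\<And>v. act P (compose_ops [a, b] v) \<in> laurent 2"
    using compat_pairE[OF assms(1)] by blast
  note nth = pmul_nth[OF assms P]
  have "Poly_Mapping.keys (Poly_Mapping.single i (-1) :: nat \<Rightarrow>\<^sub>0 int) \<subseteq> {..<2}" if "i < 2" for i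
    using that by auto
  note sh = laurent_shift[OF P(2) this]
  have A: "act P (compose_ops [zdiv a, b] v)
      = (\<lambda>e. act P (compose_ops [a, b] v) (e - Poly_Mapping.single 0 (-1)))" for v
    by (rule ext) (use compose_op_zdiv[of "[]" a "[b]" v] in \<open>simp add: act_shift\<close>)
  have "compat [zdiv a, b]" using compat_zdiv[of "[]"] assms by simp
  then show "pmul (zdiv a) b = zdiv (pmul a b)"
    using sh[of 0] assms
    by (auto simp: fun_eq_iff fls_eq_iff pmul_nth[OF _ _ _ P(1)] A zdiv_E nth Lim_shift
        simp flip: single_diff)
  have B: "act P (compose_ops [a, zdiv b] v)
      = (\<lambda>e. act P (compose_ops [a, b] v) (e - Poly_Mapping.single 1 (-1)))" for v
    by (rule ext) (use compose_op_zdiv[of "[a]" b "[]" v] in \<open>simp add: act_shift\<close>)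
  have "compat [a, zdiv b]" using compat_zdiv[of "[a]"] assms by simp
  then show "pmul a (zdiv b) = zdiv (pmul a b)"
    using sh[of 1] assms
    by (auto simp: fun_eq_iff fls_eq_iff pmul_nth[OF _ _ _ P(1)] B zdiv_E nth Lim_shift
        simp flip: single_diff)
qed

lemma qdil_0: "p \<in> F0 \<Longrightarrow> qdil 0 p = p"
  by (simp add: qdil_def F0_poly_1)

text \<open>A common dilation of all variables leaves every ratio z_j / z_i unchanged.\<close>

lemma act_qsub_const: "P \<in> dens m \<Longrightarrow> act P (qsub (\<lambda>_. k) f) = qsub (\<lambda>_. k) (act P f)"
proof (induction arbitrary: f rule: dens.induct)
  case (dens_ratio p i j P)
  have "act (poly_ratio p j i) (qsub (\<lambda>_. k) g) = qsub (\<lambda>_. k) (act (poly_ratio p j i) g)" for g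
    using act_ratio_qsub[of "\<lambda>_. k" i j p g] dens_ratio.hyps
    by (simp add: fun_eq_iff qdil_0 F0_poly_1)
  then show ?case by (simp add: act_mult dens_ratio.IH)
qed simp

lemma Lim_const_qsub:
  "Lim (\<lambda>_. 0) (qsub (\<lambda>_. k) f) (Poly_Mapping.single 0 n)
    = q powi (int k * n) *s Lim (\<lambda>_. 0) f (Poly_Mapping.single 0 n)"
proof -
  have "wt (\<lambda>_. k) e = int k * n" if "push (\<lambda>_. 0) e = Poly_Mapping.single 0 n" for e
  proof -
    have "(\<Sum>i\<in>Poly_Mapping.keys e. Poly_Mapping.lookup e i) = n"
      using that unfolding sum_lookup_push_const by (simp add: inj_eq)
    then show ?thesis by (simp add: wt_def flip: sum_distrib_left)
  qed
  then show ?thesis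
    by (auto simp: Lim_def qsub_def scale_sum_right intro!: sum.cong)
qed

lemma pmul_dilate:
  assumes "compat [a, b]" "a \<in> E" "b \<in> E"
  shows "pmul (dilate k a) (dilate k b) = dilate k (pmul a b)"
proof -
  obtain P where P: "P \<in> dens 2" "\<And>v. act P (compose_ops [a, b] v) \<in> laurent 2"
    using compat_pairE[OF assms(1)] by blast
  have c: "compat [dilate k a, dilate k b]"
    using compat_dilate_seq[of "[a, b]" "\<lambda>_. k"] assms by simp
  have A: "act P (compose_ops [dilate k a, dilate k b] v) = qsub (\<lambda>_. k) (act P (compose_ops [a, b] v))" for v
    using compose_dilate_seq[of "[a, b]" "\<lambda>_. k" v] assms by (simp add: act_qsub_const[OF P(1)])
  have "act P (compose_ops [dilate k a, dilate k b] v) \<in> laurent 2" for v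
    unfolding A by (rule qsub_laurent[OF P(2)])
  from pmul_nth[OF c _ _ P(1) this] show ?thesis
    using assms
    by (simp add: fun_eq_iff fls_eq_iff dilate_E dilate_nth A Lim_const_qsub pmul_nth[OF assms P])
qed

lemma compat_pair_dilate:
  assumes "compat [a, b]" "a \<in> E" "b \<in> E" "i \<le> j"
  shows "compat [dilate i a, dilate j b]"
  using compat_dilate_seq[of "[a, b]" "\<lambda>n. if n = 0 then i else j"] assms by simp

lemma q_deriv_nth:
  "q_deriv a v $$ n = ((q powi (n + 1) - 1) / (q - 1)) *s a v $$ (n + 1)"
  by (simp add: q_deriv_def dilate_def scale_left_diff_distrib diff_divide_distrib
      scale_right_diff_distrib)

text \<open>The chain rule for z |-> z q^l; the source of the powers of q in associativity.\<close>

lemma q_deriv_dilate: "q_deriv (dilate l a) = op_scale (q ^ l) (dilate l (q_deriv a))"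
proof -
  have "q powi (int l * (n + 1)) = q ^ l * q powi (int l * n)" for n
    by (simp add: algebra_simps power_int_add)
  then show ?thesis
    by (simp add: fun_eq_iff fls_eq_iff q_deriv_nth dilate_nth mult_ac)
qed

text \<open>The telescoping identity a(zq) b(zq) - a(z) b(z) = (a(zq) - a(z)) b(zq) + a(z) (b(zq) -
  b(z)), divided by z (q - 1).\<close>

lemma q_deriv_pmul:
  assumes "compat [a, b]" "a \<in> E" "b \<in> E"
  shows "q_deriv (pmul a b) = pmul (q_deriv a) (dilate 1 b) + pmul a (q_deriv b)"
proof -
  let ?c = "1 / (q - 1)" and ?a = "dilate 1 a" and ?b = "dilate 1 b"
  have E: "?a \<in> E" "?b \<in> E" using assms by (auto intro: dilate_E)
  have 1: "compat [?a, ?b]" "compat [a, ?b]"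
    using compat_pair_dilate[OF assms, of 1 1] compat_pair_dilate[OF assms, of 0 1] by auto
  have 2: "compat [?a - a, ?b]" using compat_diff[of "[]" ?a "[?b]" a] 1 by simp
  have 3: "compat [a, ?b - b]" using compat_diff[of "[a]" ?b "[]" b] 1 assms by simp
  have "compat [zdiv (?a - a), ?b]" using compat_zdiv[of "[]" "?a - a" "[?b]"] 2 by simp
  from pmul_scale_left[OF this zdiv_E E(2)]
  have "pmul (q_deriv a) ?b = op_scale ?c (zdiv (pmul ?a ?b - pmul a ?b))"
    unfolding q_deriv_eq pmul_zdiv(1)[OF 2 diff_E[OF E(1) assms(2)] E(2)]
      pmul_diff_left[OF 1(2,1) assms(2) E(1,2)]
    by (simp only: diff_E[OF E(1) assms(2)])
  moreover have "compat [a, zdiv (?b - b)]" using compat_zdiv[of "[a]" "?b - b" "[]"] 3 by simp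
  from pmul_scale_right[OF this assms(2) zdiv_E]
  have "pmul a (q_deriv b) = op_scale ?c (zdiv (pmul a ?b - pmul a b))"
    unfolding q_deriv_eq pmul_zdiv(2)[OF 3 assms(2) diff_E[OF E(2) assms(3)]]
      pmul_diff_right[OF assms(1) 1(2) assms(2,3) E(2)]
    by (simp only: diff_E[OF E(2) assms(3)])
  moreover have "q_deriv (pmul a b) = op_scale ?c (zdiv (pmul ?a ?b - pmul a b))"
    unfolding q_deriv_eq pmul_dilate[OF assms] by (rule refl)
  ultimately show ?thesis
    by (simp add: fun_eq_iff fls_eq_iff flip: scale_right_distrib)
qed

text \<open>The Gaussian binomial coefficient with natural upper argument. The value 0 for l > n
  lets the Pascal rule hold at the boundary.\<close>

definition qbin :: "nat \<Rightarrow> nat \<Rightarrow> 'f"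
  where "qbin n l = (if l \<le> n then q_fact q n / (q_fact q l * q_fact q (n - l)) else 0)"

lemma q_fact_0 [simp]: "q_fact q 0 = 1"
  by (simp add: q_fact_def)

lemma qbin_0 [simp]: "qbin n 0 = 1"
  by (simp add: qbin_def)

lemma q_int_add: "q_int q (int (i + j)) = q_int q (int i) + q ^ i * q_int q (int j)"
  by (simp add: q_int_def power_int_add power_add right_diff_distrib flip: add_divide_distrib)

text \<open>The q-Pascal rule. With n = l + k + 1 it reduces to [n + 1] = [l + 1] + q^(l+1) [k + 1],
  because all three coefficients have the common form [..] [n]! / ([l + 1]! [k + 1]!).\<close>

lemma qbin_Suc: "qbin (Suc n) (Suc l) = qbin n l + q ^ Suc l * qbin n (Suc l)"
proof -
  consider "l < n" | "l = n" | "l > n" by linarith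
  then show ?thesis
  proof cases
    case 1
    then obtain k where n: "n = Suc (l + k)"
      using less_imp_Suc_add by blast
    have s: "q_int q (int (Suc n)) = q_int q (int (Suc l)) + q ^ Suc l * q_int q (int (Suc k))"
      using q_int_add[of "Suc l" "Suc k"] by (simp add: n)
    have nz: "q_int q (int (Suc l)) \<noteq> 0" "q_int q (int (Suc k)) \<noteq> 0"
      by (simp_all del: of_nat_Suc)
    have "qbin (Suc n) (Suc l) = q_int q (int (Suc n)) * q_fact q n / (q_fact q (Suc l) * q_fact q (Suc k))"
      by (simp add: qbin_def n q_fact_Suc[of "Suc (l + k)"] del: of_nat_Suc)
    moreover have "qbin n l = q_int q (int (Suc l)) * q_fact q n / (q_fact q (Suc l) * q_fact q (Suc k))"
      using nz by (simp add: qbin_def n q_fact_Suc[of l] Suc_diff_le del: of_nat_Suc)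
    moreover have "qbin n (Suc l) = q_int q (int (Suc k)) * q_fact q n / (q_fact q (Suc l) * q_fact q (Suc k))"
      using nz by (simp add: qbin_def n q_fact_Suc[of k] del: of_nat_Suc)
    ultimately show ?thesis
      unfolding s by (simp add: add_divide_distrib distrib_right mult.assoc del: of_nat_Suc power_Suc)
  qed (auto simp: qbin_def)
qed

lemma compat_deriv_pair:
  assumes "compat [a, b]" "a \<in> E" "b \<in> E"
  shows "compat [(q_deriv ^^ l) a, dilate l ((q_deriv ^^ k) b)]"
proof -
  have "compat [a, (q_deriv ^^ k) b]"
    using compat_deriv_pow[of "[a]" b "[]" k] assms by simp
  then show ?thesis
    using compat_deriv_pow[of "[]" a "[(q_deriv ^^ k) b]" l] assms by (simp add: q_deriv_pow_E)
qed

text \<open>The iterated q-Leibniz rule: l derivatives reach the left factor, each dilating the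
  right one by q.\<close>

lemma q_deriv_pmul_pow:
  assumes "compat [a, b]" "a \<in> E" "b \<in> E"
  defines "T \<equiv> \<lambda>l k. pmul ((q_deriv ^^ l) a) (dilate l ((q_deriv ^^ k) b))"
  shows "(q_deriv ^^ n) (pmul a b) v $$ j = (\<Sum>l\<le>n. qbin n l *s T l (n - l) v $$ j)"
proof (induction n arbitrary: j)
  case 0
  then show ?case by (simp add: T_def)
next
  case (Suc n)
  \<comment> \<open>One more derivative either reaches the left factor and dilates the right one, or
    passes the dilation of the right factor at the cost of q^l.\<close>
  have DT: "q_deriv (T l k) = T (Suc l) k + op_scale (q ^ l) (T l (Suc k))" for l k
  proof -
    note E = q_deriv_pow_E[OF assms(2)] q_deriv_pow_E[OF assms(3)]
    have "q_deriv (T l k) = pmul ((q_deriv ^^ Suc l) a) (dilate 1 (dilate l ((q_deriv ^^ k) b)))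
        + pmul ((q_deriv ^^ l) a) (q_deriv (dilate l ((q_deriv ^^ k) b)))"
      unfolding T_def
      by (subst q_deriv_pmul) (use compat_deriv_pair[OF assms(1-3)] E in \<open>auto intro: dilate_E\<close>)
    also have "pmul ((q_deriv ^^ l) a) (q_deriv (dilate l ((q_deriv ^^ k) b))) = op_scale (q ^ l) (T l (Suc k))"
      unfolding q_deriv_dilate T_def
      using compat_deriv_pair[OF assms(1-3), of l "Suc k"] E(1)[of l] E(2)[of "Suc k"]
      by (subst pmul_scale_right) (auto intro: dilate_E)
    finally show ?thesis by (simp only: T_def dilate_dilate plus_1_eq_Suc)
  qed
  let ?\<kappa> = "(q powi (j + 1) - 1) / (q - 1)"
  have "(q_deriv ^^ Suc n) (pmul a b) v $$ j = ?\<kappa> *s (\<Sum>l\<le>n. qbin n l *s T l (n - l) v $$ (j + 1))"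
    by (simp add: q_deriv_nth Suc)
  also have "\<dots> = (\<Sum>l\<le>n. qbin n l *s q_deriv (T l (n - l)) v $$ j)"
    by (simp add: q_deriv_nth scale_sum_right mult.commute)
  also have "\<dots> = (\<Sum>l\<le>n. qbin n l *s T (Suc l) (n - l) v $$ j)
      + (\<Sum>l\<le>n. (q ^ l * qbin n l) *s T l (Suc n - l) v $$ j)"
    by (simp add: DT scale_right_distrib sum.distrib Suc_diff_le mult.commute)
  \<comment> \<open>The added term l = n + 1 has coefficient \<open>qbin n (Suc n) = 0\<close>. It
    allows the shift of the index that separates l = 0.\<close>
  also have "(\<Sum>l\<le>n. (q ^ l * qbin n l) *s T l (Suc n - l) v $$ j)
      = (\<Sum>l\<le>Suc n. (q ^ l * qbin n l) *s T l (Suc n - l) v $$ j)"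
    by (simp add: qbin_def[of n "Suc n"])
  also have "\<dots> = T 0 (Suc n) v $$ j
      + (\<Sum>l\<le>n. (q ^ Suc l * qbin n (Suc l)) *s T (Suc l) (n - l) v $$ j)"
    by (subst sum.atMost_Suc_shift) simp
  also have "(\<Sum>l\<le>n. qbin n l *s T (Suc l) (n - l) v $$ j) + (T 0 (Suc n) v $$ j
      + (\<Sum>l\<le>n. (q ^ Suc l * qbin n (Suc l)) *s T (Suc l) (n - l) v $$ j))
      = (\<Sum>l\<le>Suc n. qbin (Suc n) l *s T l (Suc n - l) v $$ j)"
    unfolding sum.atMost_Suc_shift
    by (simp add: qbin_Suc scale_left_distrib sum.distrib add_ac del: power_Suc)
  finally show ?case .
qed

lemma q_deriv_op_scale: "q_deriv (op_scale c a) = op_scale c (q_deriv a)"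
  by (simp add: fun_eq_iff fls_eq_iff q_deriv_nth mult.commute)

lemma q_deriv_pow_op_scale: "(q_deriv ^^ n) (op_scale c a) = op_scale c ((q_deriv ^^ n) a)"
  by (induction n) (auto simp: q_deriv_op_scale)

lemma dilate_op_scale: "dilate k (op_scale c a) = op_scale c (dilate k a)"
  by (simp add: fun_eq_iff fls_eq_iff dilate_nth mult.commute)

lemma q_deriv_pow_dilate:
  "(q_deriv ^^ n) (dilate l a) = op_scale (q ^ (l * n)) (dilate l ((q_deriv ^^ n) a))"
proof (induction n)
  case (Suc n)
  then have "(q_deriv ^^ Suc n) (dilate l a)
      = op_scale (q ^ (l * n)) (q_deriv (dilate l ((q_deriv ^^ n) a)))"
    by (simp add: q_deriv_op_scale)
  then show ?case
    by (simp add: q_deriv_dilate power_add mult.commute)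
qed simp

section \<open>Products of weighted operators\<close>

text \<open>The operator part of \<open>hom_prod\<close>: the weight of the right factor enters only
  the weight of the result.\<close>

definition hprod :: "nat \<Rightarrow> ('l \<Rightarrow> 'l fls) \<Rightarrow> nat \<Rightarrow> ('l \<Rightarrow> 'l fls) \<Rightarrow> 'l \<Rightarrow> 'l fls"
  where "hprod r a \<alpha> b = op_scale (1 / q_fact q r) (pmul ((q_deriv ^^ r) a) (dilate (\<alpha> + r) b))"

lemma hom_prod_eq: "hom_prod r a \<alpha> b \<beta> = monom (hprod r a \<alpha> b) (\<alpha> + \<beta> + r)"
  by (simp add: hom_prod_def hprod_def pmul_def Let_def hom_prod_series_def)

lemma compat_hprod_pair:
  assumes "compat [a, dilate \<alpha> b]" "a \<in> E" "b \<in> E"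
  shows "compat [(q_deriv ^^ r) a, dilate (\<alpha> + r) b]"
  using compat_deriv_pow[of "[]" a "[dilate \<alpha> b]" r] assms
  by (simp add: dilate_E dilate_dilate add.commute)

lemma hprod_E:
  assumes "compat [a, dilate \<alpha> b]" "a \<in> E" "b \<in> E"
  shows "hprod r a \<alpha> b \<in> E"
  unfolding hprod_def
  by (intro op_scale_E pmul_E compat_hprod_pair[OF assms] q_deriv_pow_E dilate_E assms)

text \<open>Differentiating at the left factor dilates everything to its right by q^r, and this
  matches the extra weight r of the product. The pair then carries the common dilation q^s and can
  be contracted.\<close>

lemma compat_hprod:
  assumes us: "set us \<subseteq> E" and ws: "set ws \<subseteq> E" and E: "a \<in> E" "b \<in> E"
    and ab: "compat [a, dilate \<alpha> b]"
    and c: "compat (us @ dilate s a # dilate (s + \<alpha>) b # ws)"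
  shows "compat (us @ dilate s (hprod r a \<alpha> b) # map (dilate r) ws)"
proof -
  let ?a = "(q_deriv ^^ r) a" and ?b = "dilate (\<alpha> + r) b"
  have ab': "compat [?a, ?b]" by (rule compat_hprod_pair[OF ab E])
  have Eab: "?a \<in> E" "?b \<in> E" using E by (auto intro: dilate_E q_deriv_pow_E)
  have "compat (us @ (q_deriv ^^ r) (dilate s a) # map (dilate r) (dilate (s + \<alpha>) b # ws))"
    by (rule compat_deriv_pow[OF c]) (use us ws E in \<open>auto intro: dilate_E\<close>)
  then have "compat (us @ op_scale (q ^ (s * r)) (dilate s ?a) # dilate s ?b # map (dilate r) ws)"
    by (simp add: q_deriv_pow_dilate dilate_dilate add_ac)
  from compat_scale[OF us this, of "1 / q ^ (s * r)"]
  have "compat (us @ dilate s ?a # dilate s ?b # map (dilate r) ws)"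
    by simp
  then have "compat (us @ pmul (dilate s ?a) (dilate s ?b) # map (dilate r) ws)"
    using us Eab ab' by (intro compat_contract) (auto intro: dilate_E compat_pair_dilate)
  then have "compat (us @ dilate s (pmul ?a ?b) # map (dilate r) ws)"
    by (simp add: pmul_dilate[OF ab' Eab])
  then show ?thesis
    unfolding hprod_def dilate_op_scale by (rule compat_scale[OF us])
qed

text \<open>Expand the n-th derivative of the inner product by the iterated Leibniz rule and apply
  associativity of \<open>pmul\<close> term by term. Moving n - l derivatives past the dilation of
  \<open>b\<close> by q^(\<alpha> + m) produces q^((n - l)(m + \<alpha>)).\<close>

lemma hprod_assoc:
  assumes E: "a \<in> E" "b \<in> E" "c \<in> E"
    and ab: "compat [a, dilate \<alpha> b]" and bc: "compat [b, dilate \<beta> c]"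
    and abc: "compat [a, dilate \<alpha> b, dilate (\<alpha> + \<beta>) c]"
  shows "hprod n (hprod m a \<alpha> b) (\<alpha> + \<beta> + m) c v $$ j =
    (\<Sum>l\<le>n. (qbin (l + m) l * q ^ ((n - l) * (m + \<alpha>))) *s
       hprod (m + l) a \<alpha> (hprod (n - l) b \<beta> c) v $$ j)"
proof -
  \<comment> \<open>The same dilation of \<open>c\<close> serves every term, since (\<alpha> + m +
    l) + (\<beta> + n - l) does not depend on l.\<close>
  define C where "C = dilate (\<alpha> + \<beta> + m + n) c"
  define A where "A l = (q_deriv ^^ (m + l)) a" for l
  define B where "B l = dilate (\<alpha> + m + l) ((q_deriv ^^ (n - l)) b)" for l
  define X where "X = pmul ((q_deriv ^^ m) a) (dilate (\<alpha> + m) b)"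
  have CE: "C \<in> E" and AE: "A l \<in> E" and BE: "B l \<in> E" for l
    using E by (auto simp: C_def A_def B_def intro: dilate_E q_deriv_pow_E)
  have pow_add: "(q_deriv ^^ l) ((q_deriv ^^ k) x) = (q_deriv ^^ (k + l)) x" for l k x
    unfolding add.commute[of k l] funpow_add by simp
  \<comment> \<open>Removes the powers of q that arise when derivatives pass dilations.\<close>
  have unscale: "compat (us @ x # ws)" if "set us \<subseteq> E" "compat (us @ op_scale (q ^ i) x # ws)" for us x ws i
    using compat_scale[OF that, of "1 / q ^ i"] by simp
  have ABC: "compat [A l, B l, C]" if "l \<le> n" for l
  proof -
    have 1: "compat ([a] @ (q_deriv ^^ (n - l)) (dilate \<alpha> b) # map (dilate (n - l)) [dilate (\<alpha> + \<beta>) c])"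
      by (rule compat_deriv_pow) (use abc E in \<open>auto intro: dilate_E\<close>)
    have 2: "compat ([a] @ dilate \<alpha> ((q_deriv ^^ (n - l)) b) # [dilate (\<alpha> + \<beta> + (n - l)) c])"
      by (rule unscale[where i = "\<alpha> * (n - l)"])
        (use 1 E(1) in \<open>auto simp: q_deriv_pow_dilate dilate_dilate add_ac\<close>)
    have "compat ([] @ (q_deriv ^^ (m + l)) a # map (dilate (m + l))
        [dilate \<alpha> ((q_deriv ^^ (n - l)) b), dilate (\<alpha> + \<beta> + (n - l)) c])"
      by (rule compat_deriv_pow) (use 2 E in \<open>auto intro: dilate_E q_deriv_pow_E\<close>)
    moreover have "m + l + (\<alpha> + \<beta> + (n - l)) = \<alpha> + \<beta> + m + n" using that by simp
    ultimately show ?thesis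
      by (simp add: A_def B_def C_def dilate_dilate add_ac)
  qed
  have AB: "compat [A l, B l]" for l
  proof -
    have 1: "compat ([a] @ (q_deriv ^^ (n - l)) (dilate \<alpha> b) # map (dilate (n - l)) [])"
      by (rule compat_deriv_pow) (use ab E in \<open>auto intro: dilate_E\<close>)
    have 2: "compat ([a] @ dilate \<alpha> ((q_deriv ^^ (n - l)) b) # [])"
      by (rule unscale[where i = "\<alpha> * (n - l)"]) (use 1 E(1) in \<open>auto simp: q_deriv_pow_dilate\<close>)
    have "compat ([] @ (q_deriv ^^ (m + l)) a # map (dilate (m + l))
        [dilate \<alpha> ((q_deriv ^^ (n - l)) b)])"
      by (rule compat_deriv_pow) (use 2 E in \<open>auto intro: dilate_E q_deriv_pow_E\<close>)
    then show ?thesis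
      by (simp add: A_def B_def dilate_dilate add_ac)
  qed
  have bc': "compat [(q_deriv ^^ k) b, dilate (\<beta> + k) c]" for k
    by (rule compat_hprod_pair[OF bc E(2,3)])
  have C: "C = dilate (\<alpha> + m + l) (dilate (\<beta> + (n - l)) c)" if "l \<le> n" for l
    using that by (simp add: C_def dilate_dilate add_ac)
  have BC: "compat [B l, C]" if "l \<le> n" for l
    unfolding B_def C[OF that]
    by (rule compat_pair_dilate[OF bc']) (use E in \<open>auto intro: dilate_E q_deriv_pow_E\<close>)
  have X: "(q_deriv ^^ n) X = (\<Sum>l\<le>n. op_scale (qbin n l * q ^ ((n - l) * (m + \<alpha>))) (pmul (A l) (B l)))"
  proof (intro ext fls_eqI)
    fix v j
    have c: "compat [(q_deriv ^^ m) a, dilate (\<alpha> + m) b]"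
      by (rule compat_hprod_pair[OF ab E(1,2)])
    have "pmul ((q_deriv ^^ l) ((q_deriv ^^ m) a)) (dilate l ((q_deriv ^^ (n - l)) (dilate (\<alpha> + m) b)))
        = op_scale (q ^ ((n - l) * (m + \<alpha>))) (pmul (A l) (B l))" for l
    proof -
      have "dilate l ((q_deriv ^^ (n - l)) (dilate (\<alpha> + m) b))
          = op_scale (q ^ ((n - l) * (m + \<alpha>))) (B l)"
        by (simp add: q_deriv_pow_dilate dilate_op_scale dilate_dilate B_def add_ac mult.commute)
      then show ?thesis
        using pmul_scale_right[OF AB AE BE] by (simp add: pow_add A_def)
    qed
    then show "(q_deriv ^^ n) X v $$ j
      = (\<Sum>l\<le>n. op_scale (qbin n l * q ^ ((n - l) * (m + \<alpha>))) (pmul (A l) (B l))) v $$ j"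
      unfolding X_def
      using q_deriv_pmul_pow[OF c q_deriv_pow_E[OF E(1)] dilate_E[OF E(2)], of n v j]
      by (simp add: sum_fun_apply fls_nth_sum)
  qed
  have PC: "compat [pmul (A l) (B l), C]" if "l \<le> n" for l
    using compat_contract[of "[]" "A l" "B l" "[C]"] ABC[OF that] AB AE BE by simp
  have PE: "pmul (A l) (B l) \<in> E" for l by (rule pmul_E[OF AB AE BE])
  have L: "pmul ((q_deriv ^^ n) X) C
      = (\<Sum>l\<le>n. op_scale (qbin n l * q ^ ((n - l) * (m + \<alpha>))) (pmul (pmul (A l) (B l)) C))"
  proof -
    have "compat [op_scale x (pmul (A l) (B l)), C]" if "l \<le> n" for l x
      using compat_scale[of "[]"] PC[OF that] by simp
    then have "pmul ((q_deriv ^^ n) X) C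
        = (\<Sum>l\<le>n. pmul (op_scale (qbin n l * q ^ ((n - l) * (m + \<alpha>))) (pmul (A l) (B l))) C)"
      unfolding X using PE CE PC[of 0]
      by (intro pmul_sum_left[THEN conjunct2, THEN conjunct2]) (auto intro: op_scale_E)
    also have "\<dots> = (\<Sum>l\<le>n. op_scale (qbin n l * q ^ ((n - l) * (m + \<alpha>))) (pmul (pmul (A l) (B l)) C))"
      by (rule sum.cong[OF refl]) (use PC PE CE in \<open>auto intro!: pmul_scale_left\<close>)
    finally show ?thesis .
  qed
  have R: "hprod (m + l) a \<alpha> (hprod (n - l) b \<beta> c)
      = op_scale (1 / (q_fact q (m + l) * q_fact q (n - l))) (pmul (pmul (A l) (B l)) C)"
    if "l \<le> n" for l
  proof -
    let ?b = "(q_deriv ^^ (n - l)) b" and ?c = "dilate (\<beta> + (n - l)) c"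
    have bE: "?b \<in> E" "?c \<in> E" using E by (auto intro: dilate_E q_deriv_pow_E)
    have BCm: "pmul (B l) C = dilate (\<alpha> + m + l) (pmul ?b ?c)"
      unfolding B_def C[OF that] by (rule pmul_dilate[OF bc' bE])
    have cA: "compat [A l, pmul (B l) C]"
      using compat_contract[of "[A l]" "B l" C "[]"] ABC[OF that] BC[OF that] AE BE CE by simp
    have "hprod (m + l) a \<alpha> (hprod (n - l) b \<beta> c)
        = op_scale (1 / q_fact q (m + l)) (pmul (A l) (op_scale (1 / q_fact q (n - l)) (pmul (B l) C)))"
      unfolding hprod_def dilate_op_scale BCm A_def by (simp add: add.assoc)
    also have "pmul (A l) (op_scale (1 / q_fact q (n - l)) (pmul (B l) C))
        = op_scale (1 / q_fact q (n - l)) (pmul (A l) (pmul (B l) C))"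
      by (rule pmul_scale_right[OF cA AE pmul_E[OF BC[OF that] BE CE]])
    also have "pmul (A l) (pmul (B l) C) = pmul (pmul (A l) (B l)) C"
      by (rule pmul_assoc[OF AE BE CE AB BC[OF that] ABC[OF that]])
    finally show ?thesis by simp
  qed
  have X0: "compat [(q_deriv ^^ n) X, C]" "(q_deriv ^^ n) X \<in> E"
  proof -
    have "compat [op_scale x (pmul (A l) (B l)), C]" if "l \<le> n" for l x
      using compat_scale[of "[]"] PC[OF that] by simp
    then have "compat [(q_deriv ^^ n) X, C] \<and> (q_deriv ^^ n) X \<in> E"
      unfolding X using PE CE PC[of 0] pmul_sum_left[of "{..n}" "\<lambda>l. op_scale (qbin n l * q ^ ((n - l) * (m + \<alpha>))) (pmul (A l) (B l))" C "pmul (A 0) (B 0)"]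
      by (auto intro: op_scale_E)
    then show "compat [(q_deriv ^^ n) X, C]" "(q_deriv ^^ n) X \<in> E" by auto
  qed
  have "hprod n (hprod m a \<alpha> b) (\<alpha> + \<beta> + m) c
      = op_scale (1 / (q_fact q n * q_fact q m)) (pmul ((q_deriv ^^ n) X) C)"
  proof -
    have "hprod n (hprod m a \<alpha> b) (\<alpha> + \<beta> + m) c
        = op_scale (1 / q_fact q n) (pmul (op_scale (1 / q_fact q m) ((q_deriv ^^ n) X)) C)"
      by (simp only: hprod_def q_deriv_pow_op_scale X_def C_def)
    also have "pmul (op_scale (1 / q_fact q m) ((q_deriv ^^ n) X)) C
        = op_scale (1 / q_fact q m) (pmul ((q_deriv ^^ n) X) C)"
      by (rule pmul_scale_left[OF X0 CE])
    finally show ?thesis by simp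
  qed
  then have "hprod n (hprod m a \<alpha> b) (\<alpha> + \<beta> + m) c v $$ j = (\<Sum>l\<le>n.
      (1 / (q_fact q n * q_fact q m) * (qbin n l * q ^ ((n - l) * (m + \<alpha>)))) *s pmul (pmul (A l) (B l)) C v $$ j)"
    unfolding L by (simp add: sum_fun_apply fls_nth_sum scale_sum_right)
  also have "\<dots> = (\<Sum>l\<le>n. (qbin (l + m) l * q ^ ((n - l) * (m + \<alpha>))) *s
       hprod (m + l) a \<alpha> (hprod (n - l) b \<beta> c) v $$ j)"
  proof (rule sum.cong[OF refl])
    fix l assume "l \<in> {..n}"
    then have l: "l \<le> n" by simp
    \<comment> \<open>Both sides are q^((n - l)(m + \<alpha>)) / ([l]! [m]! [n - l]!).\<close>
    have "1 / (q_fact q n * q_fact q m) * (qbin n l * q ^ ((n - l) * (m + \<alpha>)))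
        = qbin (l + m) l * q ^ ((n - l) * (m + \<alpha>)) * (1 / (q_fact q (m + l) * q_fact q (n - l)))"
      using l by (simp add: qbin_def add.commute)
    then show "(1 / (q_fact q n * q_fact q m) * (qbin n l * q ^ ((n - l) * (m + \<alpha>)))) *s pmul (pmul (A l) (B l)) C v $$ j
        = (qbin (l + m) l * q ^ ((n - l) * (m + \<alpha>))) *s hprod (m + l) a \<alpha> (hprod (n - l) b \<beta> c) v $$ j"
      unfolding R[OF l] by simp
  qed
  finally show ?thesis .
qed

section \<open>Quasi-commutative families\<close>

text \<open>The operators a_1(z), a_2(z q^(\<alpha>_1)), ... of a weighted sequence. The offset
  \<open>s\<close> is the total weight of what stands further to the left.\<close>

fun wseq :: "nat \<Rightarrow> (('l \<Rightarrow> 'l fls) \<times> nat) list \<Rightarrow> ('l \<Rightarrow> 'l fls) list" where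
  "wseq s [] = []"
| "wseq s ((a, \<alpha>) # xs) = dilate s a # wseq (s + \<alpha>) xs"

lemma wseq_append: "wseq s (xs @ ys) = wseq s xs @ wseq (s + sum_list (map snd xs)) ys"
  by (induction xs arbitrary: s) (auto simp: add.assoc)

lemma map_dilate_wseq: "map (dilate r) (wseq s xs) = wseq (s + r) xs"
proof (induction xs arbitrary: s)
  case (Cons x xs)
  then show ?case by (cases x) (simp add: dilate_dilate add_ac)
qed simp

lemma length_wseq [simp]: "length (wseq s xs) = length xs"
  by (induction s xs rule: wseq.induct) auto

lemma wseq_E: "fst ` set xs \<subseteq> E \<Longrightarrow> set (wseq s xs) \<subseteq> E"
  by (induction s xs rule: wseq.induct) (auto intro: dilate_E)

lemma dilate_seq_wseq: "dilate_seq (\<lambda>j. s + (\<Sum>i<j. snd (xs ! i))) (map fst xs) = wseq s xs"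
proof (induction xs arbitrary: s)
  case (Cons x xs)
  have "(\<Sum>i<Suc j. snd ((x # xs) ! i)) = snd x + (\<Sum>i<j. snd (xs ! i))" for j
    by (subst sum.lessThan_Suc_shift) simp
  then show ?case
    using Cons[of "s + snd x"] by (cases x) (simp add: add.assoc del: sum.lessThan_Suc)
qed simp

definition qc :: "(('l \<Rightarrow> 'l fls) \<times> nat) list \<Rightarrow> bool"
  where "qc xs \<longleftrightarrow> compat (wseq 0 xs)"

lemma quasi_commutative_hom_iff:
  assumes "fst ` set xs \<subseteq> E"
  shows "quasi_commutative_hom xs \<longleftrightarrow> qc xs"
proof -
  have "map (\<lambda>j. dilate (\<Sum>i<j. snd (xs ! i)) (fst (xs ! j))) [0..<length xs]
      = dilate_seq (\<lambda>j. 0 + (\<Sum>i<j. snd (xs ! i))) (map fst xs)"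
    by (simp add: dilate_seq_def)
  then have eq: "map (\<lambda>j. dilate (\<Sum>i<j. snd (xs ! i)) (fst (xs ! j))) [0..<length xs] = wseq 0 xs"
    by (simp only: dilate_seq_wseq)
  have l: "length (wseq 0 xs) = length xs" by simp
  show ?thesis
    unfolding quasi_commutative_hom_def qc_def compat_std eq std_den_def[symmetric]
    using act_std_Hom[OF wseq_E[OF assms], of _ 0] unfolding l by simp
qed

lemma qc_one:
  assumes "fst ` set us \<subseteq> E" "qc (us @ ws)"
  shows "qc (us @ (fls_const, 0) # ws)"
proof -
  have "dilate s fls_const = fls_const" for s
    by (simp add: fun_eq_iff fls_eq_iff dilate_nth)
  then show ?thesis
    using assms(2) compat_insert_one[OF wseq_E[OF assms(1)]] by (simp add: qc_def wseq_append)
qed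

lemma qc_zero:
  assumes "fst ` set us \<subseteq> E"
  shows "qc (us @ (0, \<alpha>) # ws)"
proof -
  have z: "dilate s 0 = 0" for s by (simp add: fun_eq_iff fls_eq_iff dilate_nth)
  have "compose_ops (wseq 0 us @ 0 # as) v = (\<lambda>e. 0)" for as v
    using ocomp_zero[OF wseq_E[OF assms]] by (simp add: fun_eq_iff compose_ops_eq ocomp_append)
  then show ?thesis
    unfolding qc_def compat_def by (auto simp: wseq_append z intro!: bexI[of _ 1] dens_one)
qed

lemma qc_lin:
  assumes us: "fst ` set us \<subseteq> E" and "qc (us @ (a, \<alpha>) # ws)" "qc (us @ (b, \<alpha>) # ws)"
  shows "qc (us @ (op_scale c a + b, \<alpha>) # ws)"
proof -
  have "dilate s (op_scale c a + b) = op_scale c (dilate s a) + dilate s b" for s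
    by (simp add: fun_eq_iff fls_eq_iff dilate_nth scale_right_distrib mult.commute)
  then show ?thesis
    using assms(2,3) compat_add[OF wseq_E[OF us] compat_scale[OF wseq_E[OF us]]]
    by (simp add: qc_def wseq_append)
qed

lemma qc_pair: "qc [(a, \<alpha>), (b, \<beta>)] \<longleftrightarrow> compat [a, dilate \<alpha> b]"
  by (simp add: qc_def)

lemma qc_hprod:
  assumes us: "fst ` set us \<subseteq> E" and ws: "fst ` set ws \<subseteq> E" and E: "a \<in> E" "b \<in> E"
    and "qc [(a, \<alpha>), (b, \<beta>)]" "qc (us @ [(a, \<alpha>), (b, \<beta>)] @ ws)"
  shows "qc (us @ (hprod r a \<alpha> b, \<alpha> + \<beta> + r) # ws)"
proof -
  let ?s = "sum_list (map snd us)"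
  have "compat (wseq 0 us @ dilate ?s (hprod r a \<alpha> b) # map (dilate r) (wseq (?s + \<alpha> + \<beta>) ws))"
    by (rule compat_hprod[OF wseq_E[OF us] wseq_E[OF ws] E])
      (use assms(5,6) in \<open>simp_all add: qc_pair, simp add: qc_def wseq_append\<close>)
  then show ?thesis
    by (simp add: qc_def wseq_append map_dilate_wseq add_ac)
qed

section \<open>Maximal families\<close>

text \<open>All lengths are tested: a contraction shortens a sequence, so compatibility of a product
  with k other operators is derived from a sequence of k + 2 entries.\<close>

definition qc_family :: "(('l \<Rightarrow> 'l fls) \<times> nat) set \<Rightarrow> bool"
  where "qc_family T \<longleftrightarrow> fst ` T \<subseteq> E \<and> (\<forall>xs. set xs \<subseteq> T \<longrightarrow> qc xs)"

definition max_qc_family :: "(('l \<Rightarrow> 'l fls) \<times> nat) set \<Rightarrow> bool"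
  where "max_qc_family T \<longleftrightarrow> qc_family T \<and> (\<forall>T'. qc_family T' \<longrightarrow> T \<subseteq> T' \<longrightarrow> T' = T)"

text \<open>Zorn's lemma applies because a sequence has finitely many entries, so a sequence over
  the union of a chain already lies over one member.\<close>

lemma ex_max_qc_family:
  assumes "qc_family T0"
  shows "\<exists>T. max_qc_family T \<and> T0 \<subseteq> T"
proof -
  let ?A = "{T. qc_family T \<and> T0 \<subseteq> T}"
  have "\<exists>M\<in>?A. \<forall>X\<in>?A. M \<subseteq> X \<longrightarrow> X = M"
  proof (rule subset_Zorn_nonempty)
    show "?A \<noteq> {}" using assms by auto
    fix C assume C: "C \<noteq> {}" "subset.chain ?A C"
    then have CA: "qc_family B \<and> T0 \<subseteq> B" if "B \<in> C" for B
      using that by (auto simp: subset_chain_def)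
    have 1: "qc xs" if xs: "set xs \<subseteq> \<Union>C" for xs
    proof -
      obtain B where B: "B \<in> C" "set xs \<subseteq> B"
        by (rule finite_subset_Union_chain[OF finite_set xs C])
      then show ?thesis using CA[OF B(1)] by (simp add: qc_family_def)
    qed
    have 2: "fst x \<in> E" if x: "x \<in> \<Union>C" for x
    proof -
      obtain B where B: "B \<in> C" "x \<in> B" using x by blast
      then show ?thesis using CA[OF B(1)] by (auto simp: qc_family_def)
    qed
    have 3: "T0 \<subseteq> \<Union>C"
    proof -
      obtain B where "B \<in> C" using C(1) by blast
      then show ?thesis using CA[of B] by blast
    qed
    have "fst ` \<Union>C \<subseteq> E" by (rule image_subsetI) (rule 2)
    then have "qc_family (\<Union>C)" unfolding qc_family_def using 1 by simp
    with 3 show "\<Union>C \<in> ?A" by simp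
  qed
  then obtain M where M: "M \<in> ?A" "\<forall>X\<in>?A. M \<subseteq> X \<longrightarrow> X = M" by (rule bexE)
  have "X = M" if "qc_family X" "M \<subseteq> X" for X
  proof -
    have "T0 \<subseteq> X" using M(1) that(2) by auto
    then show ?thesis using M(2) that by simp
  qed
  then have "max_qc_family M" using M(1) unfolding max_qc_family_def by simp
  then show ?thesis using M(1) by auto
qed

text \<open>If in every quasi-commutative sequence the entry \<open>x\<close> may replace some fixed sequence over
  \<open>T\<close>, then \<open>T \<union> {x}\<close> is quasi-commutative: eliminate the occurrences of \<open>x\<close> one at a time.\<close>

lemma max_qc_family_mem:
  assumes T: "max_qc_family T" and x: "fst x \<in> E" and L: "\<And>ls. ls \<in> L \<Longrightarrow> set ls \<subseteq> T"
    and step: "\<And>us ws. fst ` set us \<subseteq> E \<Longrightarrow> fst ` set ws \<subseteq> E \<Longrightarrow>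
      (\<And>ls. ls \<in> L \<Longrightarrow> qc (us @ ls @ ws)) \<Longrightarrow> qc (us @ x # ws)"
  shows "x \<in> T"
proof -
  have TE: "fst ` T \<subseteq> E" and Tqc: "\<And>xs. set xs \<subseteq> T \<Longrightarrow> qc xs"
    using T unfolding max_qc_family_def qc_family_def by auto
  \<comment> \<open>The prefix \<open>us\<close> over \<open>T\<close> is arbitrary so that it can
    absorb the entry just read, or a sequence \<open>ls\<close> put in its place.\<close>
  have "set us \<subseteq> T \<Longrightarrow> set xs \<subseteq> insert x T \<Longrightarrow> qc (us @ xs)" for us xs
  proof (induction xs arbitrary: us)
    case (Cons y ys)
    show ?case
    proof (cases "y \<in> T")
      case True
      then show ?thesis using Cons.IH[of "us @ [y]"] Cons.prems by simp
    next
      case False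
      then have "y = x" using Cons.prems by simp
      moreover have "qc (us @ ls @ ys)" if "ls \<in> L" for ls
        using Cons.IH[of "us @ ls"] Cons.prems L[OF that] by simp
      moreover have "fst ` set us \<subseteq> E" "fst ` set ys \<subseteq> E"
        using TE x Cons.prems by auto
      ultimately show ?thesis using step[of us ys] by (simp only:)
    qed
  qed (use Tqc in simp)
  from this[of "[]"] have "set xs \<subseteq> insert x T \<Longrightarrow> qc xs" for xs by simp
  then have "qc_family (insert x T)"
    unfolding qc_family_def using TE x by simp
  then show ?thesis using T unfolding max_qc_family_def by blast
qed

text \<open>Vanishing components count as well, so the space contains a monomial only if the family
  contains 0 in the other weights.\<close>

definition family_space :: "(('l \<Rightarrow> 'l fls) \<times> nat) set \<Rightarrow> ('l \<Rightarrow> 'l fls) poly set"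
  where "family_space T = {x. \<forall>\<alpha>. (coeff x \<alpha>, \<alpha>) \<in> T}"

lemma q_deriv_pow_zero: "(q_deriv ^^ r) 0 = 0"
  by (induction r) (auto simp: fun_eq_iff fls_eq_iff q_deriv_nth)

lemma dilate_zero: "dilate k 0 = 0"
  by (simp add: fun_eq_iff fls_eq_iff dilate_nth)

lemma op_scale_zero: "op_scale c 0 = 0"
  by (simp add: fun_eq_iff fls_eq_iff)

lemma hprod_zero_left: "hprod r 0 \<alpha> b = 0"
  unfolding hprod_def q_deriv_pow_zero pmul_zero_left by (rule op_scale_zero)

lemma hprod_zero_right: "a \<in> E \<Longrightarrow> hprod r a \<alpha> 0 = 0"
  unfolding hprod_def dilate_zero by (simp only: pmul_zero_right[OF q_deriv_pow_E] op_scale_zero)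

lemma q_deriv_pow_lin:
  "(q_deriv ^^ r) (op_scale c a + b) = op_scale c ((q_deriv ^^ r) a) + (q_deriv ^^ r) b"
proof (induction r)
  case (Suc r)
  have "q_deriv (op_scale c x + y) = op_scale c (q_deriv x) + q_deriv y" for x y
    by (simp add: fun_eq_iff fls_eq_iff q_deriv_nth scale_right_distrib mult.commute)
  with Suc show ?case by (simp only: funpow.simps o_apply)
qed simp

lemma dilate_lin: "dilate k (op_scale c a + b) = op_scale c (dilate k a) + dilate k b"
  by (simp add: fun_eq_iff fls_eq_iff dilate_nth scale_right_distrib mult.commute)

lemma op_scale_lin: "op_scale x (op_scale c a + b) = op_scale c (op_scale x a) + op_scale x b"
  by (simp add: fun_eq_iff fls_eq_iff scale_right_distrib mult.commute)

lemma hprod_lin_left: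
  assumes "compat [a, dilate \<alpha> b]" "compat [a', dilate \<alpha> b]" "a \<in> E" "a' \<in> E" "b \<in> E"
  shows "hprod r (op_scale c a + a') \<alpha> b = op_scale c (hprod r a \<alpha> b) + hprod r a' \<alpha> b"
  unfolding hprod_def q_deriv_pow_lin
    pmul_lin_left[OF compat_hprod_pair[OF assms(1,3,5)] compat_hprod_pair[OF assms(2,4,5)]
      q_deriv_pow_E[OF assms(3)] q_deriv_pow_E[OF assms(4)] dilate_E[OF assms(5)]]
  by (rule op_scale_lin)

lemma hprod_lin_right:
  assumes "compat [a, dilate \<alpha> b]" "compat [a, dilate \<alpha> b']" "a \<in> E" "b \<in> E" "b' \<in> E"
  shows "hprod r a \<alpha> (op_scale c b + b') = op_scale c (hprod r a \<alpha> b) + hprod r a \<alpha> b'"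
  unfolding hprod_def dilate_lin
    pmul_lin_right[OF compat_hprod_pair[OF assms(1,3,4)] compat_hprod_pair[OF assms(2,3,5)]
      q_deriv_pow_E[OF assms(3)] dilate_E[OF assms(4)] dilate_E[OF assms(5)]]
  by (rule op_scale_lin)

lemma q_deriv_pow_const:
  assumes "r > 0"
  shows "(q_deriv ^^ r) fls_const = 0"
proof -
  obtain k where r: "r = Suc k" using assms gr0_implies_Suc by blast
  have "q_deriv fls_const = 0"
    by (auto simp: fun_eq_iff fls_eq_iff q_deriv_nth)
  then show ?thesis
    unfolding r by (simp only: funpow_Suc_right o_apply q_deriv_pow_zero)
qed

lemma hprod_one_left:
  assumes "b \<in> E"
  shows "hprod r fls_const 0 b = (if r = 0 then b else 0)"
proof (cases "r = 0")
  case True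
  then show ?thesis using assms by (simp add: hprod_def pmul_one dilate_E)
next
  case False
  then show ?thesis
    by (simp add: hprod_def q_deriv_pow_const pmul_zero_left) (simp add: fun_eq_iff fls_eq_iff)
qed

lemma hprod_one_right:
  assumes "a \<in> E"
  shows "hprod 0 a \<alpha> fls_const = a"
proof -
  have "dilate \<alpha> fls_const = fls_const" by (auto simp: fun_eq_iff fls_eq_iff dilate_nth)
  then show ?thesis using assms by (simp add: hprod_def pmul_one)
qed

lemma Et_scale_monom: "Et_scale c (monom a n) = monom (op_scale c a) n"
  by (rule poly_eqI) (auto simp: fun_eq_iff fls_eq_iff)

section \<open>Products in components\<close>

text \<open>Common summation bounds make products of polynomials of different degrees comparable,
  which bilinearity requires.\<close>

lemma Et_prod_superset:
  assumes "r < 0" "x \<in> Et" "degree x \<le> N" "degree y \<le> M"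
  shows "Et_prod x r y = (\<Sum>\<alpha>\<le>N. \<Sum>\<beta>\<le>M.
    monom (hprod (nat (- r - 1)) (coeff x \<alpha>) \<alpha> (coeff y \<beta>)) (\<alpha> + \<beta> + nat (- r - 1)))"
proof -
  let ?n = "nat (- r - 1)"
  let ?f = "\<lambda>\<alpha> \<beta>. monom (hprod ?n (coeff x \<alpha>) \<alpha> (coeff y \<beta>)) (\<alpha> + \<beta> + ?n)"
  have xE: "coeff x \<alpha> \<in> E" for \<alpha> using assms(2) by (simp add: Et_def)
  have "Et_prod x r y = (\<Sum>\<alpha>\<le>degree x. \<Sum>\<beta>\<le>degree y. ?f \<alpha> \<beta>)"
    using assms(1) by (simp add: Et_prod_def hom_prod_eq)
  also have "\<dots> = (\<Sum>\<alpha>\<le>degree x. \<Sum>\<beta>\<le>M. ?f \<alpha> \<beta>)"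
    by (intro sum.cong refl sum.mono_neutral_left)
      (use assms(4) in \<open>auto simp: coeff_eq_0 hprod_zero_right[OF xE]\<close>)
  also have "\<dots> = (\<Sum>\<alpha>\<le>N. \<Sum>\<beta>\<le>M. ?f \<alpha> \<beta>)"
    by (rule sum.mono_neutral_left)
      (use assms(3) in \<open>auto simp: coeff_eq_0 hprod_zero_left\<close>)
  finally show ?thesis .
qed

lemma Et_prod_monom:
  assumes "a \<in> E" "r < 0"
  shows "Et_prod (monom a \<alpha>) r (monom b \<beta>)
    = monom (hprod (nat (- r - 1)) a \<alpha> b) (\<alpha> + \<beta> + nat (- r - 1))"
proof -
  let ?n = "nat (- r - 1)"
  have "monom a \<alpha> \<in> Et" using assms(1) by (simp add: Et_def zero_E)
  then have "Et_prod (monom a \<alpha>) r (monom b \<beta>) = (\<Sum>\<alpha>'\<le>\<alpha>. \<Sum>\<beta>'\<le>\<beta>.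
    monom (hprod ?n (coeff (monom a \<alpha>) \<alpha>') \<alpha>' (coeff (monom b \<beta>) \<beta>')) (\<alpha>' + \<beta>' + ?n))"
    using assms(2) by (intro Et_prod_superset) (auto intro: degree_monom_le)
  also have "\<dots> = (\<Sum>\<alpha>'\<in>{\<alpha>}. \<Sum>\<beta>'\<le>\<beta>.
    monom (hprod ?n (coeff (monom a \<alpha>) \<alpha>') \<alpha>' (coeff (monom b \<beta>) \<beta>')) (\<alpha>' + \<beta>' + ?n))"
    by (rule sum.mono_neutral_right) (auto simp: hprod_zero_left)
  also have "\<dots> = (\<Sum>\<beta>'\<le>\<beta>. monom (hprod ?n a \<alpha> (coeff (monom b \<beta>) \<beta>')) (\<alpha> + \<beta>' + ?n))"
    by simp
  also have "\<dots> = (\<Sum>\<beta>'\<in>{\<beta>}. monom (hprod ?n a \<alpha> (coeff (monom b \<beta>) \<beta>')) (\<alpha> + \<beta>' + ?n))"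
    by (rule sum.mono_neutral_right) (auto simp: hprod_zero_right[OF assms(1)])
  finally show ?thesis by simp
qed

lemma Et_prod_nonneg: "r \<ge> 0 \<Longrightarrow> Et_prod x r y = 0"
  by (simp add: Et_prod_def)

text \<open>For r = -m - 1 the upper argument l - r - 1 of the axiom is l + m.\<close>

lemma q_binom_qbin: "q_binom q (int l + int m) l = qbin (l + m) l"
proof -
  have "(\<Prod>i<l. q_int q (int (l + m) - int i)) * q_fact q m = q_fact q (l + m)"
  proof (induction l)
    case (Suc l)
    have "(\<Prod>i<Suc l. q_int q (int (Suc l + m) - int i))
        = q_int q (int (Suc l + m)) * (\<Prod>i<l. q_int q (int (l + m) - int i))"
      by (subst prod.lessThan_Suc_shift) simp
    with Suc show ?case by (simp add: q_fact_Suc mult.assoc del: prod.lessThan_Suc of_nat_Suc)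
  qed simp
  then have "(\<Prod>i<l. q_int q (int (l + m) - int i)) = q_fact q (l + m) / q_fact q m"
    by (simp add: field_simps)
  then show ?thesis by (simp add: q_binom_def qbin_def field_simps)
qed

text \<open>The numerator contains the factor [0] at i = l - r - 1.\<close>

lemma q_binom_zero:
  assumes "0 \<le> r" "r < int l"
  shows "q_binom q (int l - r - 1) l = 0"
proof -
  have "nat (int l - r - 1) < l" "int (nat (int l - r - 1)) = int l - r - 1" using assms by auto
  then have "(\<Prod>i<l. q_int q (int l - r - 1 - int i)) = 0"
    by (intro prod_zero) (auto intro!: bexI[of _ "nat (int l - r - 1)"])
  then show ?thesis by (simp add: q_binom_def)
qed

section \<open>The q-vertex algebra of a maximal family\<close>

lemma weight_space_iff:
  "f \<in> weight_space V u \<longleftrightarrow> (if u < 0 then f = 0 else f \<in> V \<and> (\<exists>a\<in>E. f = monom a (nat u)))"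
  by (simp add: weight_space_def)

lemma weight_space_components:
  assumes "\<And>u. f u \<in> weight_space V u" "finite {u. f u \<noteq> 0}" "x = (\<Sum>u | f u \<noteq> 0. f u)"
  shows "f u = (if u < 0 then 0 else monom (coeff x (nat u)) (nat u))"
proof (cases "u < 0")
  case True
  then show ?thesis using assms(1)[of u] by (simp add: weight_space_iff)
next
  case False
  have c: "coeff (f w) \<alpha> = (if w = int \<alpha> then coeff (f w) \<alpha> else 0)" for w \<alpha>
    using assms(1)[of w] by (auto simp: weight_space_iff split: if_splits)
  have "coeff x (nat u) = (\<Sum>w | f w \<noteq> 0. coeff (f w) (nat u))"
    unfolding assms(3) by (rule coeff_sum)
  also have "\<dots> = (\<Sum>w | f w \<noteq> 0. if w = u then coeff (f u) (nat u) else 0)"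
    using False by (intro sum.cong refl) (subst c, simp)
  also have "\<dots> = coeff (f u) (nat u)"
    using assms(2) by (simp add: sum.delta')
  finally have "coeff x (nat u) = coeff (f u) (nat u)" .
  moreover obtain a where "f u = monom a (nat u)"
    using assms(1)[of u] False by (auto simp: weight_space_iff)
  ultimately show ?thesis using False by simp
qed

lemma weight_space_subspace:
  assumes "Et.subspace V"
  shows "Et.subspace (weight_space V u)"
proof (cases "u < 0")
  case True
  then show ?thesis by (simp add: weight_space_def Et.subspace_single_0)
next
  case False
  then have eq: "weight_space V u = V \<inter> {monom a (nat u) | a. a \<in> E}"
    by (auto simp: weight_space_def)
  have "Et.subspace {monom a (nat u) | a. a \<in> E}"
  proof (rule Et.subspaceI)
    have "0 = monom 0 (nat u)" by simp
    then show "0 \<in> {monom a (nat u) | a. a \<in> E}" using zero_E by blast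
  qed (auto simp: add_monom Et_scale_monom intro: add_E op_scale_E)
  then show ?thesis unfolding eq using assms by (rule Et.subspace_inter[rotated])
qed

lemma direct_sum_components:
  assumes "V \<subseteq> Et" "0 \<in> V" "\<And>x \<alpha>. x \<in> V \<Longrightarrow> monom (coeff x \<alpha>) \<alpha> \<in> V" "x \<in> V"
  shows "\<exists>!f. finite {u. f u \<noteq> 0} \<and> (\<forall>u. f u \<in> weight_space V u) \<and> x = (\<Sum>u | f u \<noteq> 0. f u)"
proof (rule ex1I)
  define f where "f u = (if u < 0 then 0 else monom (coeff x (nat u)) (nat u))" for u
  have sub: "{u. f u \<noteq> 0} \<subseteq> int ` {..degree x}"
  proof
    fix u assume "u \<in> {u. f u \<noteq> 0}"
    then have "u \<ge> 0" "coeff x (nat u) \<noteq> 0" by (auto simp: f_def split: if_splits)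
    then show "u \<in> int ` {..degree x}" by (intro image_eqI[of _ _ "nat u"]) (auto intro: le_degree)
  qed
  have "(\<Sum>u | f u \<noteq> 0. f u) = (\<Sum>u\<in>int ` {..degree x}. f u)"
    by (rule sum.mono_neutral_left) (use sub in auto)
  also have "\<dots> = (\<Sum>\<alpha>\<le>degree x. monom (coeff x \<alpha>) \<alpha>)"
    by (subst sum.reindex) (auto simp: f_def)
  also have "\<dots> = x" by (rule poly_as_sum_of_monoms)
  finally have sum: "x = (\<Sum>u | f u \<noteq> 0. f u)" by simp
  have "f u \<in> weight_space V u" for u
    using assms(3)[OF assms(4)] assms(1,4) unfolding weight_space_iff f_def by (auto simp: Et_def)
  then show "finite {u. f u \<noteq> 0} \<and> (\<forall>u. f u \<in> weight_space V u) \<and> x = (\<Sum>u | f u \<noteq> 0. f u)"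
    using finite_subset[OF sub] sum by auto
  fix g assume "finite {u. g u \<noteq> 0} \<and> (\<forall>u. g u \<in> weight_space V u) \<and> x = (\<Sum>u | g u \<noteq> 0. g u)"
  then have "g u = f u" for u
    using weight_space_components[of g V x u] by (simp add: f_def)
  then show "g = f" by (rule ext)
qed

text \<open>The decomposition required by the direct sum axiom can only be the one into
  coefficients, so every component lies in the algebra.\<close>

lemma q_vertex_algebra_components:
  assumes "q_vertex_algebra_in_Et V" "x \<in> V"
  shows "monom (coeff x \<alpha>) \<alpha> \<in> V"
proof -
  interpret V: graded_nonlocal_q_vertex_algebra Et_scale q V "weight_space V" Et_prod Et_one
    using assms(1) by (simp add: q_vertex_algebra_in_Et_def)
  obtain f where f: "finite {u. f u \<noteq> 0}" "\<And>u. f u \<in> weight_space V u" "x = (\<Sum>u | f u \<noteq> 0. f u)"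
    using V.direct_sum[OF assms(2)] by auto
  have "f (int \<alpha>) = monom (coeff x \<alpha>) \<alpha>"
    using weight_space_components[OF f(2,1,3), of "int \<alpha>"] by simp
  then show ?thesis using f(2)[of "int \<alpha>"] V.gr_subset by auto
qed

lemma q_vertex_subalgebra:
  assumes W: "q_vertex_algebra_in_Et W" and "V \<subseteq> W" "Et.subspace V" "Et_one \<in> V"
    and closed: "\<And>x y r. x \<in> V \<Longrightarrow> y \<in> V \<Longrightarrow> Et_prod x r y \<in> V"
    and comp: "\<And>x \<alpha>. x \<in> V \<Longrightarrow> monom (coeff x \<alpha>) \<alpha> \<in> V"
  shows "q_vertex_algebra_in_Et V"
proof -
  interpret W: graded_nonlocal_q_vertex_algebra Et_scale q W "weight_space W" Et_prod Et_one
    using W by (simp add: q_vertex_algebra_in_Et_def)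
  have VW: "x \<in> V \<Longrightarrow> x \<in> W" for x using assms(2) by auto
  have VE: "V \<subseteq> Et" using W assms(2) by (auto simp: q_vertex_algebra_in_Et_def)
  have V0: "0 \<in> V" using assms(3) by (rule Et.subspace_0)
  have ws: "weight_space V u = weight_space W u \<inter> V" for u
    using V0 assms(2) by (auto simp: weight_space_def)
  have wsV: "weight_space V u \<subseteq> V" for u by (simp add: ws)
  have "graded_nonlocal_q_vertex_algebra Et_scale q V (weight_space V) Et_prod Et_one"
  proof (unfold_locales, goal_cases)
    \<comment> \<open>Goals 4, 15 and 16 are the direct sum, the grading and the associativity
      axiom.\<close>
    case (4 a) show ?case by (rule direct_sum_components[OF VE V0 _ 4]) (rule comp)
  next
    case (15 a u b s r)
    then have "Et_prod a r b \<in> weight_space W (s + u - r - 1)" "Et_prod a r b \<in> V"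
      using W.grading[of a u b s r] closed by (auto simp: ws)
    then show ?case by (simp add: ws)
  next
    case (16 a u b c r s)
    then show ?case using W.associativity[of a u b c r s] VW by (auto simp: ws)
  qed (use VW closed wsV assms(3,4) weight_space_subspace W.prd_add_left W.prd_scale_left
      W.prd_add_right W.prd_scale_right W.truncation W.vacuum W.creation_regular
      W.creation_limit in \<open>auto simp: subset_iff\<close>)
  then show ?thesis
    using W VE assms(2-4) closed unfolding q_vertex_algebra_in_Et_def by (auto simp: subset_iff)
qed

context
  fixes T
  assumes T: "max_qc_family T"
begin

lemma family_E: "(a, \<alpha>) \<in> T \<Longrightarrow> a \<in> E"
  using T by (force simp: max_qc_family_def qc_family_def)

lemma family_qc: "set xs \<subseteq> T \<Longrightarrow> qc xs"
  using T by (simp add: max_qc_family_def qc_family_def)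

text \<open>The identity may be inserted anywhere, so it replaces the empty sequence.\<close>

lemma family_one: "(fls_const, 0) \<in> T"
  by (rule max_qc_family_mem[OF T, where L = "{[]}"]) (auto simp: fls_const_E intro: qc_one)

text \<open>An operator product with a factor 0 vanishes, so no replacement sequence is called for
  and \<open>L\<close> is empty.\<close>

lemma family_zero: "(0, \<alpha>) \<in> T"
  by (rule max_qc_family_mem[OF T, where L = "{}"]) (auto simp: zero_E intro: qc_zero)

lemma family_lin:
  assumes "(a, \<alpha>) \<in> T" "(b, \<alpha>) \<in> T"
  shows "(op_scale c a + b, \<alpha>) \<in> T"
proof (rule max_qc_family_mem[OF T, where L = "{[(a, \<alpha>)], [(b, \<alpha>)]}"])
  show "qc (us @ (op_scale c a + b, \<alpha>) # ws)"
    if "fst ` set us \<subseteq> E" "\<And>ls. ls \<in> {[(a, \<alpha>)], [(b, \<alpha>)]} \<Longrightarrow> qc (us @ ls @ ws)" for us ws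
    using that(2)[of "[(a, \<alpha>)]"] that(2)[of "[(b, \<alpha>)]"] by (intro qc_lin[OF that(1)]) auto
qed (use assms family_E in \<open>auto intro!: add_E op_scale_E\<close>)

lemma family_hprod:
  assumes "(a, \<alpha>) \<in> T" "(b, \<beta>) \<in> T"
  shows "(hprod r a \<alpha> b, \<alpha> + \<beta> + r) \<in> T"
proof (rule max_qc_family_mem[OF T, where L = "{[(a, \<alpha>), (b, \<beta>)]}"])
  have q: "qc [(a, \<alpha>), (b, \<beta>)]" using assms by (intro family_qc) auto
  then show "fst (hprod r a \<alpha> b, \<alpha> + \<beta> + r) \<in> E"
    using assms family_E by (auto simp: qc_pair intro: hprod_E)
  show "qc (us @ (hprod r a \<alpha> b, \<alpha> + \<beta> + r) # ws)"
    if "fst ` set us \<subseteq> E" "fst ` set ws \<subseteq> E"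
      "\<And>ls. ls \<in> {[(a, \<alpha>), (b, \<beta>)]} \<Longrightarrow> qc (us @ ls @ ws)" for us ws
    using that(3)[of "[(a, \<alpha>), (b, \<beta>)]"]
    by (intro qc_hprod[OF that(1,2) _ _ q]) (use assms family_E in auto)
qed (use assms in auto)

lemma family_compat: "(a, \<alpha>) \<in> T \<Longrightarrow> (b, \<beta>) \<in> T \<Longrightarrow> compat [a, dilate \<alpha> b]"
  using family_qc[of "[(a, \<alpha>), (b, \<beta>)]"] by (simp add: qc_pair)

lemma family_compat3:
  "(a, \<alpha>) \<in> T \<Longrightarrow> (b, \<beta>) \<in> T \<Longrightarrow> (c, \<gamma>) \<in> T \<Longrightarrow>
    compat [a, dilate \<alpha> b, dilate (\<alpha> + \<beta>) c]"
  using family_qc[of "[(a, \<alpha>), (b, \<beta>), (c, \<gamma>)]"] by (simp add: qc_def)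

private abbreviation "V \<equiv> family_space T"

lemma V_coeff: "x \<in> V \<Longrightarrow> (coeff x \<alpha>, \<alpha>) \<in> T"
  by (simp add: family_space_def)

lemma V_Et: "V \<subseteq> Et"
  using V_coeff family_E by (auto simp: Et_def)

lemma V_monom: "(a, \<alpha>) \<in> T \<Longrightarrow> monom a \<alpha> \<in> V"
  using family_zero by (simp add: family_space_def)

lemma V_subspace: "Et.subspace V"
proof (rule Et.subspaceI)
  show "0 \<in> V" using family_zero by (simp add: family_space_def)
  show "x + y \<in> V" if "x \<in> V" "y \<in> V" for x y
    unfolding family_space_def
  proof (intro CollectI allI)
    fix \<alpha>
    have "coeff (x + y) \<alpha> = op_scale 1 (coeff x \<alpha>) + coeff y \<alpha>" by simp
    then show "(coeff (x + y) \<alpha>, \<alpha>) \<in> T"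
      using family_lin[OF V_coeff[OF that(1)] V_coeff[OF that(2)]] by metis
  qed
  show "Et_scale c x \<in> V" if "x \<in> V" for c x
    unfolding family_space_def
  proof (intro CollectI allI)
    fix \<alpha>
    have "coeff (Et_scale c x) \<alpha> = op_scale c (coeff x \<alpha>) + 0" by simp
    then show "(coeff (Et_scale c x) \<alpha>, \<alpha>) \<in> T"
      using family_lin[OF V_coeff[OF that] family_zero] by metis
  qed
qed

lemma V_induct [consumes 1, case_names zero monom add]:
  assumes "x \<in> V" "P 0" "\<And>a \<alpha>. (a, \<alpha>) \<in> T \<Longrightarrow> P (monom a \<alpha>)"
    "\<And>x y. x \<in> V \<Longrightarrow> y \<in> V \<Longrightarrow> P x \<Longrightarrow> P y \<Longrightarrow> P (x + y)"
  shows "P x"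
proof -
  have "(\<Sum>\<alpha>\<in>X. monom (coeff x \<alpha>) \<alpha>) \<in> V \<and> P (\<Sum>\<alpha>\<in>X. monom (coeff x \<alpha>) \<alpha>)" if "finite X" for X
    using that
  proof (induction X rule: finite_induct)
    case empty
    then show ?case using assms(2) Et.subspace_0[OF V_subspace] by simp
  next
    case (insert \<alpha> X)
    have "monom (coeff x \<alpha>) \<alpha> \<in> V" "P (monom (coeff x \<alpha>) \<alpha>)"
      using V_coeff[OF assms(1)] V_monom assms(3) by auto
    with insert show ?case
      using assms(4) Et.subspace_add[OF V_subspace] by simp
  qed
  from this[of "{..degree x}"] show ?thesis by (simp add: poly_as_sum_of_monoms)
qed

lemma V_prod_closed:
  assumes "x \<in> V" "y \<in> V"
  shows "Et_prod x r y \<in> V"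
proof (cases "r < 0")
  case True
  have "x \<in> Et" using V_Et assms(1) by auto
  then show ?thesis
    using Et_prod_superset[OF True _ order.refl order.refl, of x y] assms
    by (simp add: Et.subspace_sum[OF V_subspace] V_monom family_hprod V_coeff)
next
  case False
  then show ?thesis using Et.subspace_0[OF V_subspace] by (simp add: Et_prod_nonneg)
qed

lemma V_prod_lin_left:
  assumes "x \<in> V" "x' \<in> V" "y \<in> V"
  shows "Et_prod (Et_scale c x + x') r y = Et_scale c (Et_prod x r y) + Et_prod x' r y"
proof (cases "r < 0")
  case True
  let ?N = "max (degree (Et_scale c x + x')) (max (degree x) (degree x'))" and ?n = "nat (- r - 1)"
  have V': "Et_scale c x + x' \<in> V"
    using assms Et.subspace_add[OF V_subspace] Et.subspace_scale[OF V_subspace] by simp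
  note ex = Et_prod_superset[OF True subsetD[OF V_Et], of _ ?N y "degree y"]
  have h: "hprod ?n (coeff (Et_scale c x + x') \<alpha>) \<alpha> (coeff y \<beta>)
    = op_scale c (hprod ?n (coeff x \<alpha>) \<alpha> (coeff y \<beta>)) + hprod ?n (coeff x' \<alpha>) \<alpha> (coeff y \<beta>)" for \<alpha> \<beta>
  proof -
    have "coeff (Et_scale c x + x') \<alpha> = op_scale c (coeff x \<alpha>) + coeff x' \<alpha>" by simp
    then show ?thesis
      using hprod_lin_left family_compat family_E V_coeff assms by metis
  qed
  show ?thesis
    by (simp only: ex[OF V'] ex[OF assms(1)] ex[OF assms(2)] h max.cobounded1 max.cobounded2
        max.coboundedI1 max.coboundedI2 order.refl Et.scale_sum_right Et_scale_monom
        sum.distrib[symmetric] add_monom)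
next
  case False
  then show ?thesis by (simp add: Et_prod_nonneg)
qed

lemma V_prod_lin_right:
  assumes "x \<in> V" "y \<in> V" "y' \<in> V"
  shows "Et_prod x r (Et_scale c y + y') = Et_scale c (Et_prod x r y) + Et_prod x r y'"
proof (cases "r < 0")
  case True
  let ?N = "max (degree (Et_scale c y + y')) (max (degree y) (degree y'))" and ?n = "nat (- r - 1)"
  have V': "Et_scale c y + y' \<in> V"
    using assms Et.subspace_add[OF V_subspace] Et.subspace_scale[OF V_subspace] by simp
  note ex = Et_prod_superset[OF True subsetD[OF V_Et assms(1)] order.refl, of _ ?N]
  have h: "hprod ?n (coeff x \<alpha>) \<alpha> (coeff (Et_scale c y + y') \<beta>)
    = op_scale c (hprod ?n (coeff x \<alpha>) \<alpha> (coeff y \<beta>)) + hprod ?n (coeff x \<alpha>) \<alpha> (coeff y' \<beta>)" for \<alpha> \<beta>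
  proof -
    have "coeff (Et_scale c y + y') \<beta> = op_scale c (coeff y \<beta>) + coeff y' \<beta>" by simp
    then show ?thesis
      using hprod_lin_right family_compat family_E V_coeff assms by metis
  qed
  show ?thesis
    by (simp only: ex h max.cobounded1 max.cobounded2
        max.coboundedI1 max.coboundedI2 order.refl Et.scale_sum_right Et_scale_monom
        sum.distrib[symmetric] add_monom)
next
  case False
  then show ?thesis by (simp add: Et_prod_nonneg)
qed

lemma V_0: "0 \<in> V"
  by (rule Et.subspace_0[OF V_subspace])

lemma V_prod_zero: "y \<in> V \<Longrightarrow> Et_prod 0 r y = 0" "x \<in> V \<Longrightarrow> Et_prod x r 0 = 0"
  \<comment> \<open>With scalar -1 and both summands 0, linearity expresses the product as -u +
    u.\<close>
  using V_prod_lin_left[OF V_0 V_0, of y "-1" r] V_prod_lin_right[OF _ V_0 V_0, of x r "-1"]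
  by simp_all

lemma V_prod_add:
  "x \<in> V \<Longrightarrow> x' \<in> V \<Longrightarrow> y \<in> V \<Longrightarrow> Et_prod (x + x') r y = Et_prod x r y + Et_prod x' r y"
  "x \<in> V \<Longrightarrow> y \<in> V \<Longrightarrow> y' \<in> V \<Longrightarrow> Et_prod x r (y + y') = Et_prod x r y + Et_prod x r y'"
  using V_prod_lin_left[of x x' y 1 r] V_prod_lin_right[of x y y' r 1] by simp_all

lemma V_prod_scale:
  "x \<in> V \<Longrightarrow> y \<in> V \<Longrightarrow> Et_prod (Et_scale c x) r y = Et_scale c (Et_prod x r y)"
  "x \<in> V \<Longrightarrow> y \<in> V \<Longrightarrow> Et_prod x r (Et_scale c y) = Et_scale c (Et_prod x r y)"
  using V_prod_lin_left[of x 0 y c r] V_prod_lin_right[of x y 0 r c] V_0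
  by (simp_all add: V_prod_zero)

text \<open>A finite form of the right side of associativity: for l >= -s the inner product has
  nonnegative index and is 0.\<close>

definition assoc_rhs where
  "assoc_rhs u a r s b c = (\<Sum>l<nat (- s). Et_scale
    (q_binom q (int l - r - 1) l * q powi ((s + int l + 1) * (r - u + 1)))
    (Et_prod a (r - int l) (Et_prod b (s + int l) c)))"

lemma V_assoc_hom:
  assumes T: "(a, \<alpha>) \<in> T" "(b, \<beta>) \<in> T" "(c, \<gamma>) \<in> T"
  shows "Et_prod (Et_prod (monom a \<alpha>) r (monom b \<beta>)) s (monom c \<gamma>)
    = assoc_rhs (int \<alpha>) (monom a \<alpha>) r s (monom b \<beta>) (monom c \<gamma>)"
proof -
  note E = family_E[OF T(1)] family_E[OF T(2)] family_E[OF T(3)]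
  note VT = V_monom[OF T(1)] V_monom[OF T(2)] V_monom[OF T(3)]
  consider "s \<ge> 0" | "r \<ge> 0" | "r < 0" "s < 0" by linarith
  then show ?thesis
  proof cases
    case 1
    then show ?thesis by (simp add: assoc_rhs_def Et_prod_nonneg)
  next
    case 2
    \<comment> \<open>For l <= r the outer product has nonnegative index; for l > r the binomial
      coefficient vanishes.\<close>
    have H: "Et_scale (q_binom q (int l - r - 1) l * x) (Et_prod y (r - int l) z) = 0" for l x y z
      using 2 q_binom_zero[of r l] by (cases "r < int l") (auto simp: Et_prod_nonneg)
    have "assoc_rhs (int \<alpha>) (monom a \<alpha>) r s (monom b \<beta>) (monom c \<gamma>) = 0"
      unfolding assoc_rhs_def by (intro sum.neutral ballI) (rule H)
    then show ?thesis
      using 2 by (simp add: Et_prod_nonneg V_prod_zero VT)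
  next
    case 3
    obtain m n where mn: "r = - int m - 1" "s = - int n - 1"
      using 3 by (metis (no_types, opaque_lifting) add.commute add.inverse_inverse int_ops(4)
          minus_add_distrib nat_int negD of_nat_Suc uminus_add_conv_diff diff_minus_eq_add)
    have "Et_prod (Et_prod (monom a \<alpha>) r (monom b \<beta>)) s (monom c \<gamma>)
        = monom (hprod n (hprod m a \<alpha> b) (\<alpha> + \<beta> + m) c) (\<alpha> + \<beta> + m + \<gamma> + n)"
      using E T hprod_E[OF family_compat[OF T(1,2)] E(1,2)] by (simp add: Et_prod_monom mn)
    also have "hprod n (hprod m a \<alpha> b) (\<alpha> + \<beta> + m) c
        = (\<Sum>l\<le>n. op_scale (qbin (l + m) l * q ^ ((n - l) * (m + \<alpha>)))
            (hprod (m + l) a \<alpha> (hprod (n - l) b \<beta> c)))"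
      using hprod_assoc[OF E family_compat[OF T(1,2)] family_compat[OF T(2,3)] family_compat3[OF T]]
      by (auto simp: fun_eq_iff fls_eq_iff sum_fun_apply fls_nth_sum)
    also have "monom \<dots> (\<alpha> + \<beta> + m + \<gamma> + n) = (\<Sum>l\<le>n. monom (op_scale (qbin (l + m) l * q ^ ((n - l) * (m + \<alpha>)))
            (hprod (m + l) a \<alpha> (hprod (n - l) b \<beta> c))) (\<alpha> + \<beta> + m + \<gamma> + n))"
      by (rule poly_eqI) (simp add: coeff_sum)
    also have "\<dots> = assoc_rhs (int \<alpha>) (monom a \<alpha>) r s (monom b \<beta>) (monom c \<gamma>)"
    proof -
      have "{..<nat (- s)} = {..n}" using mn by auto
      moreover have "monom (op_scale (qbin (l + m) l * q ^ ((n - l) * (m + \<alpha>)))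
            (hprod (m + l) a \<alpha> (hprod (n - l) b \<beta> c))) (\<alpha> + \<beta> + m + \<gamma> + n)
          = Et_scale (q_binom q (int l - r - 1) l * q powi ((s + int l + 1) * (r - int \<alpha> + 1)))
            (Et_prod (monom a \<alpha>) (r - int l) (Et_prod (monom b \<beta>) (s + int l) (monom c \<gamma>)))"
        if "l \<le> n" for l
      proof -
        have 1: "q_binom q (int l - r - 1) l = qbin (l + m) l"
          using q_binom_qbin[of l m] by (simp add: mn)
        \<comment> \<open>With r = -m - 1 and s = -n - 1 the factors are -(n - l) and -(m +
          \<alpha>), so the exponent is a natural number.\<close>
        have "(s + int l + 1) * (r - int \<alpha> + 1) = int ((n - l) * (m + \<alpha>))"
          unfolding mn of_nat_mult of_nat_diff[OF that] by (simp add: algebra_simps)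
        then have 2: "q powi ((s + int l + 1) * (r - int \<alpha> + 1)) = q ^ ((n - l) * (m + \<alpha>))"
          by (simp only: power_int_of_nat)
        have 3: "nat (- (r - int l) - 1) = m + l" "nat (- (s + int l) - 1) = n - l" "r - int l < 0" "s + int l < 0"
          using that by (auto simp: mn)
        have 4: "Et_prod (monom b \<beta>) (s + int l) (monom c \<gamma>) = monom (hprod (n - l) b \<beta> c) (\<beta> + \<gamma> + (n - l))"
          using Et_prod_monom[OF E(2) 3(4), of \<beta> c \<gamma>] 3(2) by simp
        have 5: "\<alpha> + (\<beta> + \<gamma> + (n - l)) + (m + l) = \<alpha> + \<beta> + m + \<gamma> + n" using that by simp
        show ?thesis
          unfolding 1 2 4 Et_prod_monom[OF E(1) 3(3)] 3(1) Et_scale_monom 5 by (rule refl)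
      qed
      ultimately show ?thesis unfolding assoc_rhs_def by simp
    qed
    finally show ?thesis .
  qed
qed

text \<open>Extension by linearity in \<open>b\<close> and then in \<open>c\<close>. The left
  operator stays homogeneous because its weight enters the exponent of q.\<close>

lemma V_assoc:
  assumes a: "(a, \<alpha>) \<in> T" and "b \<in> V" "c \<in> V"
  shows "Et_prod (Et_prod (monom a \<alpha>) r b) s c = assoc_rhs (int \<alpha>) (monom a \<alpha>) r s b c"
proof -
  note aV = V_monom[OF a]
  have rhs_add: "assoc_rhs (int \<alpha>) (monom a \<alpha>) r s (b + b') c
      = assoc_rhs (int \<alpha>) (monom a \<alpha>) r s b c + assoc_rhs (int \<alpha>) (monom a \<alpha>) r s b' c"
    if "b \<in> V" "b' \<in> V" "c \<in> V" for b b' c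
    using that aV unfolding assoc_rhs_def
    by (simp add: V_prod_add V_prod_closed Et.scale_right_distrib sum.distrib)
  have rhs_add': "assoc_rhs (int \<alpha>) (monom a \<alpha>) r s b (c + c')
      = assoc_rhs (int \<alpha>) (monom a \<alpha>) r s b c + assoc_rhs (int \<alpha>) (monom a \<alpha>) r s b c'"
    if "b \<in> V" "c \<in> V" "c' \<in> V" for b c c'
    using that aV unfolding assoc_rhs_def
    by (simp add: V_prod_add V_prod_closed Et.scale_right_distrib sum.distrib)
  have rhs_zero: "assoc_rhs (int \<alpha>) (monom a \<alpha>) r s b c = 0" if "\<And>r. Et_prod b r c = 0" for b c
    using aV that by (simp add: assoc_rhs_def V_prod_zero)
  show ?thesis
    using assms(2)
  proof (induction rule: V_induct)
    case zero
    show ?case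
      using assms(3) aV by (simp add: V_prod_zero rhs_zero)
  next
    case (add b b')
    then show ?case
      using assms(3) aV rhs_add[of b b' c]
      by (simp add: V_prod_add V_prod_closed)
  next
    case (monom b \<beta>)
    note bV = V_monom[OF monom]
    from assms(3) show ?case
    proof (induction rule: V_induct)
      case zero
      show ?case using aV bV by (simp add: V_prod_zero V_prod_closed rhs_zero)
    next
      case (monom c \<gamma>)
      then show ?case using V_assoc_hom a \<open>(b, \<beta>) \<in> T\<close> by blast
    next
      case (add c c')
      then show ?case
        using aV bV rhs_add'[of "monom b \<beta>" c c']
        by (simp add: V_prod_add V_prod_closed)
    qed
  qed
qed

lemma V_quasi_commutative:
  assumes "set xs \<subseteq> V"
  shows "quasi_commutative xs"
  unfolding quasi_commutative_def
proof (intro allI impI)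
  fix \<alpha>s :: "nat list" assume "length \<alpha>s = length xs"
  have sub: "set (map (\<lambda>(x, \<alpha>). (coeff x \<alpha>, \<alpha>)) (zip xs \<alpha>s)) \<subseteq> T"
    using assms V_coeff by (auto dest!: set_zip_leftD)
  then have "fst ` set (map (\<lambda>(x, \<alpha>). (coeff x \<alpha>, \<alpha>)) (zip xs \<alpha>s)) \<subseteq> E"
    by (rule order_trans[OF image_mono])
      (use T in \<open>simp add: max_qc_family_def qc_family_def\<close>)
  then show "quasi_commutative_hom (map (\<lambda>(x, \<alpha>). (coeff x \<alpha>, \<alpha>)) (zip xs \<alpha>s))"
    using family_qc[OF sub] by (simp add: quasi_commutative_hom_iff)
qed

lemma V_vacuum:
  assumes "b \<in> V"
  shows "Et_prod Et_one r b = (if r = -1 then b else 0)"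
  using assms
proof (induction rule: V_induct)
  case zero
  show ?case using V_prod_zero V_monom[OF family_one] by (simp add: Et_one_def)
next
  case (monom a \<alpha>)
  show ?case
  proof (cases "r < 0")
    case True
    have "Et_prod Et_one r (monom a \<alpha>)
        = monom (if nat (- r - 1) = 0 then a else 0) (0 + \<alpha> + nat (- r - 1))"
      using True by (simp add: Et_one_def Et_prod_monom fls_const_E hprod_one_left[OF family_E[OF monom]])
    then show ?thesis using True by auto
  next
    case False
    then show ?thesis by (simp add: Et_prod_nonneg)
  qed
next
  case (add x y)
  then show ?case
    using V_monom[OF family_one] by (simp add: V_prod_add Et_one_def)
qed

lemma V_creation:
  assumes "a \<in> V"
  shows "Et_prod a (-1) Et_one = a"
  using assms
proof (induction rule: V_induct)
  case zero
  show ?case using V_prod_zero V_monom[OF family_one] by (simp add: Et_one_def)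
next
  case (monom a \<alpha>)
  then show ?case
    by (simp add: Et_one_def Et_prod_monom family_E hprod_one_right)
next
  case (add x y)
  then show ?case
    using V_monom[OF family_one] by (simp add: V_prod_add Et_one_def)
qed

lemma V_grading:
  assumes "a \<in> weight_space V u" "b \<in> weight_space V s"
  shows "Et_prod a r b \<in> weight_space V (s + u - r - 1)"
proof (cases "r < 0 \<and> u \<ge> 0 \<and> s \<ge> 0")
  case True
  then obtain a' b' where ab: "a = monom a' (nat u)" "a' \<in> E" "b = monom b' (nat s)" "b' \<in> E" "a \<in> V" "b \<in> V"
    using assms by (auto simp: weight_space_iff)
  have T': "(a', nat u) \<in> T" "(b', nat s) \<in> T"
    using V_coeff[OF ab(5), of "nat u"] V_coeff[OF ab(6), of "nat s"] ab by auto
  let ?n = "nat (- r - 1)"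
  have n: "nat (s + u - r - 1) = nat u + nat s + ?n" "\<not> s + u - r - 1 < 0"
    using True by auto
  have "Et_prod a r b = monom (hprod ?n a' (nat u) b') (nat (s + u - r - 1))"
    unfolding ab(1,3) n(1) using True ab(2) by (simp add: Et_prod_monom)
  then show ?thesis
    unfolding weight_space_iff if_not_P[OF n(2)]
    using V_prod_closed[OF ab(5,6)] family_E[OF family_hprod[OF T']] by blast
next
  case False
  have "a = 0 \<or> b = 0 \<or> r \<ge> 0" using False assms by (auto simp: weight_space_iff split: if_splits)
  moreover have "a \<in> V" "b \<in> V" using assms V_0 by (auto simp: weight_space_iff split: if_splits)
  ultimately have "Et_prod a r b = 0" by (auto simp: Et_prod_nonneg V_prod_zero)
  then show ?thesis
    using Et.subspace_0[OF weight_space_subspace[OF V_subspace]] by simp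
qed

lemma V_associativity:
  assumes "a \<in> weight_space V u" "b \<in> V" "c \<in> V"
  shows "Et_prod (Et_prod a r b) s c = Sum_any (\<lambda>l::nat. Et_scale
    (q_binom q (int l - r - 1) l * q powi ((s + int l + 1) * (r - u + 1)))
    (Et_prod a (r - int l) (Et_prod b (s + int l) c)))" (is "_ = Sum_any ?f")
proof -
  have aV: "a \<in> V" using assms(1) V_0 by (auto simp: weight_space_iff split: if_splits)
  have "{l. ?f l \<noteq> 0} \<subseteq> {..<nat (- s)}"
  proof safe
    fix l assume "?f l \<noteq> 0"
    then have "s + int l < 0"
      using V_prod_zero(2)[OF aV] Et_prod_nonneg[of "s + int l" b c] by (cases "s + int l < 0") auto
    then show "l < nat (- s)" by simp
  qed
  then have rhs: "Sum_any ?f = assoc_rhs u a r s b c"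
    unfolding assoc_rhs_def by (intro Sum_any.expand_superset) auto
  show ?thesis
  proof (cases "a = 0")
    case True
    then show ?thesis
      unfolding rhs assoc_rhs_def using assms V_prod_closed by (simp add: V_prod_zero)
  next
    case False
    then obtain a' where a: "a = monom a' (nat u)" "u \<ge> 0"
      using assms(1) by (auto simp: weight_space_iff split: if_splits)
    then have "(a', nat u) \<in> T" using V_coeff[OF aV, of "nat u"] by simp
    from V_assoc[OF this assms(2,3)] show ?thesis unfolding rhs using a by simp
  qed
qed

lemma V_q_vertex_algebra: "q_vertex_algebra_in_Et V"
proof -
  have one: "Et_one \<in> V" unfolding Et_one_def by (rule V_monom[OF family_one])
  have "graded_nonlocal_q_vertex_algebra Et_scale q V (weight_space V) Et_prod Et_one"
  proof (unfold_locales, goal_cases)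
    \<comment> \<open>Goal 3 is the inclusion of the weight spaces, and goal 11 is truncation, where
      all products with r >= 0 vanish.\<close>
    case (3 u) then show ?case using V_0 by (auto simp: weight_space_def)
  next
    case (4 a)
    show ?case
      by (rule direct_sum_components[OF V_Et V_0 _ 4]) (rule V_monom[OF V_coeff])
  next
    case (11 a b)
    then show ?case using Et_prod_nonneg by blast
  next
    case (15 a u b s r) then show ?case by (rule V_grading)
  next
    case (16 a u b c r s) then show ?case by (rule V_associativity)
  qed (use V_subspace V_prod_closed one weight_space_subspace V_prod_add V_prod_scale V_vacuum
      V_creation Et_prod_nonneg in auto)
  then show ?thesis
    unfolding q_vertex_algebra_in_Et_def
    using V_Et V_subspace V_quasi_commutative one V_prod_closed by simp
qed

end

section \<open>Existence, minimality and the spanning set\<close>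

lemma qc_family_components:
  assumes "S \<subseteq> Et" "quasi_commutative_set S"
  shows "qc_family {(coeff x \<alpha>, \<alpha>) | x \<alpha>. x \<in> S}" (is "qc_family ?T")
proof -
  have TE: "fst ` ?T \<subseteq> E" using assms(1) by (auto simp: Et_def)
  have "qc xs" if xs: "set xs \<subseteq> ?T" for xs
  proof -
    have "\<exists>ys \<alpha>s. length \<alpha>s = length ys \<and> set ys \<subseteq> S \<and>
        xs = map (\<lambda>(x, \<alpha>). (coeff x \<alpha>, \<alpha>)) (zip ys \<alpha>s)"
      using xs
    proof (induction xs)
      case (Cons z xs)
      then obtain ys \<alpha>s where "length \<alpha>s = length ys" "set ys \<subseteq> S"
        "xs = map (\<lambda>(x, \<alpha>). (coeff x \<alpha>, \<alpha>)) (zip ys \<alpha>s)" by auto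
      moreover obtain x \<alpha> where "x \<in> S" "z = (coeff x \<alpha>, \<alpha>)" using Cons.prems by auto
      ultimately show ?case by (intro exI[of _ "x # ys"] exI[of _ "\<alpha> # \<alpha>s"]) simp
    qed (rule exI[of _ "[]"], rule exI[of _ "[]"], simp)
    then obtain ys \<alpha>s where ys: "length \<alpha>s = length ys" "set ys \<subseteq> S"
      "xs = map (\<lambda>(x, \<alpha>). (coeff x \<alpha>, \<alpha>)) (zip ys \<alpha>s)" by blast
    then have "quasi_commutative ys" using assms(2) by (simp add: quasi_commutative_set_def)
    then have "quasi_commutative_hom xs" using ys by (simp add: quasi_commutative_def)
    moreover have "fst ` set xs \<subseteq> E" using xs TE by blast
    ultimately show ?thesis by (simp add: quasi_commutative_hom_iff)
  qed
  then show ?thesis using TE unfolding qc_family_def by simp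
qed

lemma ex_q_vertex_algebra:
  assumes "S \<subseteq> Et" "quasi_commutative_set S"
  shows "\<exists>W. q_vertex_algebra_in_Et W \<and> S \<subseteq> W"
proof -
  obtain T where T: "max_qc_family T" "{(coeff x \<alpha>, \<alpha>) | x \<alpha>. x \<in> S} \<subseteq> T"
    using ex_max_qc_family[OF qc_family_components[OF assms]] by blast
  then have "S \<subseteq> family_space T" by (auto simp: family_space_def)
  then show ?thesis using V_q_vertex_algebra[OF T(1)] by blast
qed

lemma ex_smallest_q_vertex_algebra:
  assumes "S \<subseteq> Et" "quasi_commutative_set S"
  shows "\<exists>V. smallest_q_vertex_algebra S V"
proof -
  let ?\<W> = "{W. q_vertex_algebra_in_Et W \<and> S \<subseteq> W}"
  \<comment> \<open>Some algebra is needed from which the intersection inherits the axioms.\<close>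
  obtain W where W: "W \<in> ?\<W>" using ex_q_vertex_algebra[OF assms] by blast
  have alg: "Et.subspace X" "Et_one \<in> X" "x \<in> X \<Longrightarrow> y \<in> X \<Longrightarrow> Et_prod x r y \<in> X"
    "x \<in> X \<Longrightarrow> monom (coeff x \<alpha>) \<alpha> \<in> X" if "X \<in> ?\<W>" for X x y r \<alpha>
    using that q_vertex_algebra_components by (auto simp: q_vertex_algebra_in_Et_def)
  have "q_vertex_algebra_in_Et (\<Inter>?\<W>)"
  proof (rule q_vertex_subalgebra)
    show "q_vertex_algebra_in_Et W" using W by simp
    show "\<Inter>?\<W> \<subseteq> W" using W by blast
    show "Et.subspace (\<Inter>?\<W>)" by (intro Et.subspace_Inter ballI alg(1))
    show "Et_one \<in> \<Inter>?\<W>" using alg(2) by (rule InterI)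
    show "Et_prod x r y \<in> \<Inter>?\<W>" if "x \<in> \<Inter>?\<W>" "y \<in> \<Inter>?\<W>" for x y r
      by (rule InterI, rule alg(3)) (use that in auto)
    show "monom (coeff x \<alpha>) \<alpha> \<in> \<Inter>?\<W>" if "x \<in> \<Inter>?\<W>" for x \<alpha>
      by (rule InterI, rule alg(4)) (use that in auto)
  qed
  then have "smallest_q_vertex_algebra S (\<Inter>?\<W>)"
    unfolding smallest_q_vertex_algebra_def by blast
  then show ?thesis by blast
qed

lemma smallest_q_vertex_algebra_unique:
  "smallest_q_vertex_algebra S V \<Longrightarrow> smallest_q_vertex_algebra S W \<Longrightarrow> V = W"
  unfolding smallest_q_vertex_algebra_def by blast

lemma nested_prod_simps:
  "nested_prod [] = Et_one" "nested_prod ((a, r) # ars) = Et_prod a r (nested_prod ars)"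
  by (simp_all add: nested_prod_def)

text \<open>The span is shown to be a subalgebra of \<open>V\<close> containing \<open>S\<close>, so
  minimality of \<open>V\<close> gives equality. Homogeneity is used twice: the associativity axiom
  concerns a homogeneous left operator, and homogeneous spanning elements make the span closed under
  components.\<close>

lemma smallest_eq_span:
  assumes V: "smallest_q_vertex_algebra S V" and hom: "\<forall>a\<in>S. homogeneous a"
  shows "V = Et.span {nested_prod ars | ars. \<forall>(a, r)\<in>set ars. a \<in> S \<and> r < 0}"
proof -
  have VA: "q_vertex_algebra_in_Et V" and SV: "S \<subseteq> V"
    using V by (auto simp: smallest_q_vertex_algebra_def)
  interpret V: graded_nonlocal_q_vertex_algebra Et_scale q V "weight_space V" Et_prod Et_one
    using VA by (simp add: q_vertex_algebra_in_Et_def)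
  define P where "P ars \<longleftrightarrow> (\<forall>(a, r)\<in>set ars. a \<in> S \<and> r < 0)"
    for ars :: "(('l \<Rightarrow> 'l fls) poly \<times> int) list"
  define N where "N = {nested_prod ars | ars. P ars}"
  let ?U = "Et.span N"
  have P_Cons: "P ((a, r) # ars) \<longleftrightarrow> a \<in> S \<and> r < 0 \<and> P ars" for a r ars
    by (auto simp: P_def)
  have Sw: "\<exists>u. a \<in> weight_space V u" if a: "a \<in> S" for a
  proof -
    obtain b \<alpha> where b: "b \<in> E" "a = monom b \<alpha>"
      using a hom unfolding homogeneous_def by metis
    have "a \<in> V" using a SV by (rule subsetD[rotated])
    then have "a \<in> weight_space V (int \<alpha>)"
      unfolding weight_space_iff using b by auto
    then show ?thesis by (rule exI)
  qed
  have Nw: "P ars \<Longrightarrow> \<exists>u. nested_prod ars \<in> weight_space V u" for ars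
  proof (induction ars)
    case Nil
    have "Et_one \<in> weight_space V 0"
      unfolding weight_space_iff using V.vac_in fls_const_E by (auto simp: Et_one_def)
    then show ?case unfolding nested_prod_simps by (rule exI)
  next
    case (Cons ar ars)
    obtain a r where ar: "ar = (a, r)" by (cases ar)
    with Cons.prems have "a \<in> S" "P ars" by (auto simp: P_Cons)
    with Cons.IH Sw obtain u s where "a \<in> weight_space V u" "nested_prod ars \<in> weight_space V s"
      by meson
    then have "Et_prod a r (nested_prod ars) \<in> weight_space V (s + u - r - 1)"
      by (rule V.grading)
    then show ?case unfolding ar nested_prod_simps by (rule exI)
  qed
  have NV: "N \<subseteq> V"
  proof
    fix x assume "x \<in> N"
    then obtain u where "x \<in> weight_space V u" using Nw unfolding N_def by auto
    then show "x \<in> V" using V.gr_subset by (rule subsetD[rotated])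
  qed
  have UV: "?U \<subseteq> V" by (rule Et.span_minimal[OF NV V.subspace_V])
  have step: "Et_prod a r y \<in> ?U" if a: "a \<in> S" and y: "y \<in> ?U" for a r y
  proof -
    have aV: "a \<in> V" using a SV by auto
    \<comment> \<open>Membership in \<open>V\<close> is carried along because the linearity axioms
      hold on \<open>V\<close> only.\<close>
    have "y \<in> V \<and> Et_prod a r y \<in> ?U"
      using y
    proof (induction rule: Et.span_induct_alt)
      case base
      have "Et_prod a r 0 = 0"
        using V.prd_scale_right[OF aV V.vac_in, of r 0] by simp
      then show ?case using Et.subspace_0[OF V.subspace_V] by (simp add: Et.span_zero)
    next
      case (step c x y)
      then obtain ars where ars: "P ars" "x = nested_prod ars" unfolding N_def by auto
      have x: "Et_prod a r x \<in> ?U"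
      proof (cases "r < 0")
        case True
        then have "Et_prod a r x = nested_prod ((a, r) # ars)" "P ((a, r) # ars)"
          using ars a by (auto simp: nested_prod_simps P_Cons)
        then have "Et_prod a r x \<in> N" unfolding N_def by auto
        then show ?thesis by (rule Et.span_base)
      next
        case False
        then show ?thesis by (simp add: Et_prod_nonneg Et.span_zero)
      qed
      have xV: "x \<in> V" using step(1) NV by auto
      then have cx: "Et_scale c x \<in> V" by (rule Et.subspace_scale[OF V.subspace_V])
      have "Et_prod a r (Et_scale c x + y) = Et_scale c (Et_prod a r x) + Et_prod a r y"
        using aV xV cx step(2) by (simp add: V.prd_add_right V.prd_scale_right)
      then show ?case
        using x step(2) cx by (simp add: Et.subspace_add[OF V.subspace_V] Et.span_add Et.span_scale)
    qed
    then show ?thesis ..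
  qed
  \<comment> \<open>The index s is arbitrary in the induction on the list, since associativity calls
    for all the indices s + l.\<close>
  have nested: "P ars \<Longrightarrow> y \<in> ?U \<Longrightarrow> Et_prod (nested_prod ars) s y \<in> ?U" for ars s y
  proof (induction ars arbitrary: s y)
    case Nil
    then have "y \<in> V" using UV by auto
    then show ?case using Nil by (simp add: nested_prod_simps V.vacuum Et.span_zero)
  next
    case (Cons ar ars)
    obtain a r where ar: "ar = (a, r)" by (cases ar)
    with Cons.prems have a: "a \<in> S" "P ars" by (auto simp: P_Cons)
    obtain u where u: "a \<in> weight_space V u" using Sw[OF a(1)] by (rule exE)
    have "nested_prod ars \<in> V" using NV a(2) unfolding N_def by auto
    moreover have "y \<in> V" using Cons.prems UV by auto
    ultimately have eq: "Et_prod (Et_prod a r (nested_prod ars)) s y = Sum_any (\<lambda>l::nat. Et_scale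
        (q_binom q (int l - r - 1) l * q powi ((s + int l + 1) * (r - u + 1)))
        (Et_prod a (r - int l) (Et_prod (nested_prod ars) (s + int l) y)))"
      by (rule V.associativity[OF u])
    show ?case
      unfolding ar nested_prod_simps eq Sum_any.expand_set
      by (intro Et.span_sum Et.span_scale step[OF a(1)] Cons.IH[OF a(2) Cons.prems(2)])
  qed
  have closed: "Et_prod x r y \<in> ?U" if x: "x \<in> ?U" and y: "y \<in> ?U" for x y r
  proof -
    have yV: "y \<in> V" using y UV by auto
    have "x \<in> V \<and> Et_prod x r y \<in> ?U"
      using x
    proof (induction rule: Et.span_induct_alt)
      case base
      have "Et_prod 0 r y = 0"
        using V.prd_scale_left[OF V.vac_in yV, of 0 r] by simp
      then show ?case using Et.subspace_0[OF V.subspace_V] by (simp add: Et.span_zero)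
    next
      case (step c x x')
      then obtain ars where ars: "P ars" "x = nested_prod ars" unfolding N_def by auto
      have x: "Et_prod x r y \<in> ?U" unfolding ars(2) by (rule nested[OF ars(1) y])
      have xV: "x \<in> V" using step(1) NV by auto
      then have cx: "Et_scale c x \<in> V" by (rule Et.subspace_scale[OF V.subspace_V])
      have "Et_prod (Et_scale c x + x') r y = Et_scale c (Et_prod x r y) + Et_prod x' r y"
        using yV xV cx step(2) by (simp add: V.prd_add_left V.prd_scale_left)
      then show ?case
        using x step(2) cx by (simp add: Et.subspace_add[OF V.subspace_V] Et.span_add Et.span_scale)
    qed
    then show ?thesis ..
  qed
  \<comment> \<open>A homogeneous spanning element has only itself and 0 as components.\<close>
  have comp: "monom (coeff x \<alpha>) \<alpha> \<in> ?U" if "x \<in> ?U" for x \<alpha>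
    using that
  proof (induction rule: Et.span_induct_alt)
    case base
    show ?case unfolding coeff_0 monom_eq_0 by (rule Et.span_zero)
  next
    case (step c x y)
    then obtain u where u: "x \<in> weight_space V u" using Nw unfolding N_def by auto
    have "monom (coeff x \<alpha>) \<alpha> = x \<or> monom (coeff x \<alpha>) \<alpha> = 0"
      using u by (auto simp: weight_space_iff split: if_splits)
    then have "monom (coeff x \<alpha>) \<alpha> \<in> ?U"
      using Et.span_base[OF step(1)] Et.span_zero[of N] by (elim disjE) simp_all
    moreover have "monom (coeff (Et_scale c x + y) \<alpha>) \<alpha>
        = Et_scale c (monom (coeff x \<alpha>) \<alpha>) + monom (coeff y \<alpha>) \<alpha>"
      by (simp add: Et_scale_monom add_monom plus_fun_def)
    ultimately show ?case using step(2) by (simp only: Et.span_add Et.span_scale)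
  qed
  have "P []" by (simp add: P_def)
  then have "nested_prod [] \<in> N" unfolding N_def by blast
  then have one: "Et_one \<in> ?U" unfolding nested_prod_simps by (rule Et.span_base)
  have "q_vertex_algebra_in_Et ?U"
  proof (rule q_vertex_subalgebra[OF VA UV Et.subspace_span one])
    show "x \<in> ?U \<Longrightarrow> y \<in> ?U \<Longrightarrow> Et_prod x r y \<in> ?U" for x y r by (rule closed)
    show "x \<in> ?U \<Longrightarrow> monom (coeff x \<alpha>) \<alpha> \<in> ?U" for x \<alpha> by (rule comp)
  qed
  moreover have "S \<subseteq> ?U"
  proof
    fix a assume a: "a \<in> S"
    \<comment> \<open>By the creation axiom this product is \<open>a\<close> itself.\<close>
    have "Et_prod a (-1) Et_one \<in> ?U" by (rule step[OF a one])
    then show "a \<in> ?U" using V.creation_limit[of a] a SV by auto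
  qed
  ultimately have "V \<subseteq> ?U" using V by (simp add: smallest_q_vertex_algebra_def)
  then have "V = ?U" using UV by (rule equalityI)
  then show ?thesis unfolding N_def P_def .
qed

end

theorem theorem2p14:
  fixes scale :: "'f::field_char_0 \<Rightarrow> 'l::ab_group_add \<Rightarrow> 'l"
    and embed :: "complex poly fract \<Rightarrow> 'f"
    and S :: "('l \<Rightarrow> 'l fls) poly set"
  assumes "q_operators scale embed"
    and "S \<subseteq> q_operators.Et scale"
    and "q_operators.quasi_commutative_set scale embed S"
  shows "(\<exists>!V. q_operators.smallest_q_vertex_algebra scale embed S V) \<and>
    ((\<forall>a\<in>S. q_operators.homogeneous scale a) \<longrightarrow>
      (\<forall>V. q_operators.smallest_q_vertex_algebra scale embed S V \<longrightarrow>
        V = module.span (q_operators.Et_scale scale)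
          {q_operators.nested_prod scale embed ars | ars.
            \<forall>(a, r)\<in>set ars. a \<in> S \<and> r < 0}))"
proof -
  interpret q_operators scale embed by (rule assms(1))
  show ?thesis
  proof (intro conjI impI allI)
    show "\<exists>!V. smallest_q_vertex_algebra S V"
      using ex_smallest_q_vertex_algebra[OF assms(2,3)] smallest_q_vertex_algebra_unique
      by blast
    show "V = module.span Et_scale {nested_prod ars | ars. \<forall>(a, r)\<in>set ars. a \<in> S \<and> r < 0}"
      if "\<forall>a\<in>S. homogeneous a" "smallest_q_vertex_algebra S V" for V
      by (rule smallest_eq_span[OF that(2,1)])
  qed
qed

end
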